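(* Let $Q$ be a finite quiver on $k$ vertices and $\lambda\in\mathbb{C}^k$. Let $\alpha\in\Sigma_\lambda$ be such that $2\alpha\in\Sigma_\lambda$. Then the scheme $\mathrm{rep}_{2\alpha}\,\Pi_\lambda$ of $2\alpha$-dimensional representations of the deformed preprojective algebra $\Pi_\lambda$ is not smooth. In particular, $\Pi_\lambda$ is not formally smooth.
   Context: A quiver $Q$ is a finite directed graph with vertices $v_1,\dots,v_k$ and finite arrow set $Q_a$. The double quiver $\overline{Q}$ is obtained by adjoining, for every $a\in Q_a$ from $v_i$ to $v_j$, an arrow $a^*$ from $v_j$ to $v_i$. $\mathbb{C}\overline{Q}$ is the path algebra with vertex idempotents $e_1,\dots,e_k$, and $\Pi_\lambda=\mathbb{C}\overline{Q}/(\sum_{a\in Q_a}[a,a^*]-\sum_i\lambda_ie_i)$. For a dimension vector $\beta=(n_1,\dots,n_k)$, $\mathrm{rep}_\beta\Pi_\lambda$ is the closed subscheme of $\bigoplus_b\mathrm{Hom}(\mathbb{C}^{n_{s(b)}},\mathbb{C}^{n_{t(b)}})$ (sum over arrows $b$ of $\overline{Q}$) defined by $\sum_{a\in Q_a}[V_a,V_{a^*}]=(\lambda_11_{n_1},\dots,\lambda_k1_{n_k})$. $\Sigma_\lambda$: $\chi_Q$ is the bilinear form on $\mathbb{Z}^k$ with matrix $\chi_{ij}=\delta_{ij}-\#\{\text{arrows of }Q\text{ from }v_i\text{ to }v_j\}$; a root is a dimension vector of an indecomposable representation of $Q$ over $\mathbb{C}$; $\Delta^+_\lambda$ is the set of roots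 $\beta$ with $\sum_i\lambda_ib_i=0$. $\Sigma_\lambda$ is the set of $\alpha\in\Delta^+_\lambda$ with $1-\chi_Q(\alpha,\alpha)>r-\sum_{i=1}^r\chi_Q(\beta_i,\beta_i)$ for every decomposition $\alpha=\beta_1+\cdots+\beta_r$, $r\ge2$, with all $\beta_i\in\Delta^+_\lambda$. By a theorem of Crawley-Boevey, $\Sigma_\lambda$ is the set of dimension vectors of simple $\Pi_\lambda$-representations. A $\mathbb{C}$-algebra is formally smooth (Cuntz–Quillen) if it has the lifting property with respect to nilpotent ideals: every algebra map $A\to B/I$ with $I\subset B$ a nilpotent two-sided ideal of a $\mathbb{C}$-algebra $B$ lifts to an algebra map $A\to B$. *)

theory Defs
  imports
    "HOL-Algebra.Module"
    "HOL-Algebra.QuotRing"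
    "HOL-Algebra.Subrings"
    "HOL-Library.Poly_Mapping"
    "Jordan_Normal_Form.Matrix"
    "Graph_Theory.Digraph"
    "Graph_Theory.Arc_Walk"
begin

section \<open>Associative unital algebras over the complex numbers\<close>

text \<open>The library locale \<open>algebra\<close> is restricted to commutative algebras, so the associative
  version is introduced here on the same record type. The zero algebra is allowed.\<close>

definition complex_field :: "complex ring" where
  "complex_field = \<lparr>carrier = UNIV, monoid.mult = (*), one = 1, ring.zero = 0, add = (+)\<rparr>"

definition complex_algebra :: "(complex, 'b) module \<Rightarrow> bool" where
  "complex_algebra A \<longleftrightarrow> ring A \<and> module complex_field A \<and>
     (\<forall>c. \<forall>x\<in>carrier A. \<forall>y\<in>carrier A.
        (c \<odot>\<^bsub>A\<^esub> x) \<otimes>\<^bsub>A\<^esub> y = c \<odot>\<^bsub>A\<^esub> (x \<otimes>\<^bsub>A\<^esub> y) \<and>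
        x \<otimes>\<^bsub>A\<^esub> (c \<odot>\<^bsub>A\<^esub> y) = c \<odot>\<^bsub>A\<^esub> (x \<otimes>\<^bsub>A\<^esub> y))"

definition alg_hom :: "(complex, 'a) module \<Rightarrow> (complex, 'b) module \<Rightarrow> ('a \<Rightarrow> 'b) set" where
  "alg_hom A B = {f \<in> Ring.ring_hom A B. \<forall>c. \<forall>x\<in>carrier A. f (c \<odot>\<^bsub>A\<^esub> x) = c \<odot>\<^bsub>B\<^esub> f x}"

definition alg_quot :: "(complex, 'a) module \<Rightarrow> 'a set \<Rightarrow> (complex, 'a set) module" where
  "alg_quot A I = ring.extend (A Quot I) \<lparr>smult = (\<lambda>c K. \<Union>x\<in>K. I +>\<^bsub>A\<^esub> (c \<odot>\<^bsub>A\<^esub> x))\<rparr>"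

definition nilpotent_ideal :: "'a set \<Rightarrow> (complex, 'a) module \<Rightarrow> bool" where
  "nilpotent_ideal I A \<longleftrightarrow> ideal I A \<and>
     (\<exists>n. \<forall>xs. length xs = n \<and> set xs \<subseteq> I \<longrightarrow> foldr (\<otimes>\<^bsub>A\<^esub>) xs \<one>\<^bsub>A\<^esub> = \<zero>\<^bsub>A\<^esub>)"

definition lifts_modulo :: "(complex, 'a) module \<Rightarrow> (complex, 'b) module \<Rightarrow> 'b set \<Rightarrow> bool" where
  "lifts_modulo A B I \<longleftrightarrow>
     (\<forall>f \<in> alg_hom A (alg_quot B I). \<exists>g \<in> alg_hom A B. \<forall>x\<in>carrier A. I +>\<^bsub>B\<^esub> g x = f x)"

definition finite_type :: "(complex, 'a) module \<Rightarrow> bool" where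
  "finite_type A \<longleftrightarrow> (\<exists>S. finite S \<and> S \<subseteq> carrier A \<and>
     (\<forall>T. subring T A \<and> (\<forall>c. \<forall>x\<in>T. c \<odot>\<^bsub>A\<^esub> x \<in> T) \<and> S \<subseteq> T \<longrightarrow> T = carrier A))"

text \<open>The test algebras of the lifting properties below have their carrier in the type
  \<^typ>\<open>nat \<Rightarrow> complex\<close>, since one cannot quantify over types inside a definition. For a finitely
  generated algebra \<open>A\<close> this is no restriction: given \<open>f : A \<rightarrow> B/I\<close> with \<open>B\<close> of any size, replace \<open>B\<close> by
  its subalgebra \<open>B'\<close> generated by lifts of the images of generators of \<open>A\<close>, and \<open>I\<close> by
  \<open>B' \<inter> I\<close>. The algebra \<open>B'\<close> has countable dimension, so it embeds into \<^typ>\<open>nat \<Rightarrow> complex\<close>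
  by coordinates, and \<open>f\<close> lands in \<open>B'/(B' \<inter> I)\<close>.\<close>

type_synonym test_algebra = "(complex, nat \<Rightarrow> complex) module"

text \<open>Cuntz--Quillen: lifting against all nilpotent extensions of associative algebras.\<close>

definition formally_smooth :: "(complex, 'a) module \<Rightarrow> bool" where
  "formally_smooth A \<longleftrightarrow>
     (\<forall>(B :: test_algebra) I. complex_algebra B \<and> nilpotent_ideal I B \<longrightarrow> lifts_modulo A B I)"

text \<open>An affine scheme over the complex numbers is given by its coordinate algebra \<open>A\<close>.
  Smoothness of \<open>Spec A\<close> is smoothness of the structure morphism in Grothendieck's sense
  (EGA IV, 17.3.1): locally of finite presentation and formally smooth, i.e. for every commutative
  \<open>B\<close> and nilpotent ideal \<open>I\<close> every \<open>B/I\<close>-point of \<open>Spec A\<close> lifts to a \<open>B\<close>-point. Over a field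
  finite presentation is the same as finite type. This is ordinary (geometric) smoothness of the
  possibly nonreduced scheme, not of the underlying variety.\<close>

definition smooth_affine_scheme :: "(complex, 'a) module \<Rightarrow> bool" where
  "smooth_affine_scheme A \<longleftrightarrow> finite_type A \<and>
     (\<forall>(B :: test_algebra) I. complex_algebra B \<and> cring B \<and> nilpotent_ideal I B \<longrightarrow>
        lifts_modulo A B I)"


section \<open>Quivers, double quivers and path algebras\<close>

text \<open>A quiver is a \<^locale>\<open>fin_digraph\<close> (loops and multiple arrows allowed). In the double quiver
  \<open>Inl a\<close> is the arrow \<open>a\<close> and \<open>Inr a\<close> is the adjoined arrow \<open>a\<^sup>*\<close>.\<close>

definition double_quiver :: "('v, 'a) pre_digraph \<Rightarrow> ('v, 'a + 'a) pre_digraph" where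
  "double_quiver Q = \<lparr>verts = verts Q, arcs = arcs Q <+> arcs Q,
     tail = case_sum (tail Q) (head Q), head = case_sum (head Q) (tail Q)\<rparr>"

text \<open>A path is a triple (source, arrows in the order in which they are traversed, target).
  Products are written as compositions of maps: \<open>p q\<close> is \<open>q\<close> followed by \<open>p\<close>, so that left modules
  are representations and \<open>[a, a\<^sup>*]\<close> acts as \<open>V\<^sub>a V\<^sub>a\<^sub>* - V\<^sub>a\<^sub>* V\<^sub>a\<close>.\<close>

type_synonym ('v, 'a) path = "'v \<times> 'a list \<times> 'v"

definition paths :: "('v, 'a) pre_digraph \<Rightarrow> ('v, 'a) path set" where
  "paths G = {(u, p, v). pre_digraph.awalk G u p v}"

fun path_mult :: "('v, 'a) path \<Rightarrow> ('v, 'a) path \<Rightarrow> ('v, 'a) path \<Rightarrow>\<^sub>0 complex" where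
  "path_mult (u, p, v) (u', q, v') =
     (if v' = u then Poly_Mapping.single (u', q @ p, v) 1 else 0)"

definition path_scale :: "complex \<Rightarrow> ('p \<Rightarrow>\<^sub>0 complex) \<Rightarrow> ('p \<Rightarrow>\<^sub>0 complex)" where
  "path_scale c f = Poly_Mapping.map ((*) c) f"

definition path_algebra ::
  "('v, 'a) pre_digraph \<Rightarrow> (complex, ('v, 'a) path \<Rightarrow>\<^sub>0 complex) module" where
  "path_algebra G = \<lparr>
     carrier = {f. Poly_Mapping.keys f \<subseteq> paths G},
     monoid.mult = (\<lambda>f g. \<Sum>p\<in>Poly_Mapping.keys f. \<Sum>q\<in>Poly_Mapping.keys g.
        path_scale (Poly_Mapping.lookup f p * Poly_Mapping.lookup g q) (path_mult p q)),
     one = (\<Sum>v\<in>verts G. Poly_Mapping.single (v, [], v) 1),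
     ring.zero = 0,
     add = (+),
     smult = path_scale\<rparr>"

definition vertex_elt :: "'v \<Rightarrow> ('v, 'a) path \<Rightarrow>\<^sub>0 complex" where
  "vertex_elt v = Poly_Mapping.single (v, [], v) 1"

definition arrow_elt :: "('v, 'a) pre_digraph \<Rightarrow> 'a \<Rightarrow> ('v, 'a) path \<Rightarrow>\<^sub>0 complex" where
  "arrow_elt G b = Poly_Mapping.single (tail G b, [b], head G b) 1"


section \<open>The deformed preprojective algebra\<close>

definition preprojective_relation ::
  "('v, 'a) pre_digraph \<Rightarrow> ('v \<Rightarrow> complex) \<Rightarrow> ('v, 'a + 'a) path \<Rightarrow>\<^sub>0 complex" where
  "preprojective_relation Q lam =
     (let D = double_quiver Q; A = path_algebra D in
      (\<Sum>a\<in>arcs Q. arrow_elt D (Inl a) \<otimes>\<^bsub>A\<^esub> arrow_elt D (Inr a)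
                   - arrow_elt D (Inr a) \<otimes>\<^bsub>A\<^esub> arrow_elt D (Inl a))
      - (\<Sum>v\<in>verts Q. path_scale (lam v) (vertex_elt v)))"

definition deformed_preprojective_algebra ::
  "('v, 'a) pre_digraph \<Rightarrow> ('v \<Rightarrow> complex) \<Rightarrow>
     (complex, (('v, 'a + 'a) path \<Rightarrow>\<^sub>0 complex) set) module" where
  "deformed_preprojective_algebra Q lam =
     (let A = path_algebra (double_quiver Q) in
      alg_quot A (genideal A {preprojective_relation Q lam}))"


section \<open>The representation scheme\<close>

type_synonym 'x mpoly = "('x \<Rightarrow>\<^sub>0 nat) \<Rightarrow>\<^sub>0 complex"

definition mvar :: "'x \<Rightarrow> 'x mpoly" where
  "mvar x = Poly_Mapping.single (Poly_Mapping.single x 1) 1"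

definition mconst :: "complex \<Rightarrow> 'x mpoly" where
  "mconst c = Poly_Mapping.single 0 c"

definition polynomial_algebra :: "'x set \<Rightarrow> (complex, 'x mpoly) module" where
  "polynomial_algebra S = \<lparr>
     carrier = {f. \<forall>m\<in>Poly_Mapping.keys f. Poly_Mapping.keys m \<subseteq> S},
     monoid.mult = (*), one = 1, ring.zero = 0, add = (+),
     smult = (\<lambda>c f. mconst c * f)\<rparr>"

text \<open>The variable \<open>(b, i, j)\<close> is the \<open>(i, j)\<close> entry of the matrix \<open>V\<^sub>b\<close>; rows are indexed by the
  target and columns by the source of \<open>b\<close>.\<close>

definition rep_coordinates ::
  "('v, 'b) pre_digraph \<Rightarrow> ('v \<Rightarrow> nat) \<Rightarrow> ('b \<times> nat \<times> nat) set" where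
  "rep_coordinates G \<beta> = {(b, i, j). b \<in> arcs G \<and> i < \<beta> (head G b) \<and> j < \<beta> (tail G b)}"

definition generic_matrix ::
  "('v, 'b) pre_digraph \<Rightarrow> ('v \<Rightarrow> nat) \<Rightarrow> 'b \<Rightarrow> ('b \<times> nat \<times> nat) mpoly mat" where
  "generic_matrix G \<beta> b = mat (\<beta> (head G b)) (\<beta> (tail G b)) (\<lambda>(i, j). mvar (b, i, j))"

text \<open>The \<open>(i, j)\<close> entry of the component at \<open>v\<close> of \<open>\<Sum>\<^sub>a [V\<^sub>a, V\<^sub>a\<^sub>*] - (\<lambda>\<^sub>v 1)\<^sub>v\<close>.
  The product \<open>V\<^sub>a V\<^sub>a\<^sub>*\<close> lives at the head of \<open>a\<close> and \<open>V\<^sub>a\<^sub>* V\<^sub>a\<close> at its tail.\<close>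

definition rep_equation ::
  "('v, 'a) pre_digraph \<Rightarrow> ('v \<Rightarrow> complex) \<Rightarrow> ('v \<Rightarrow> nat) \<Rightarrow> 'v \<Rightarrow> nat \<Rightarrow> nat \<Rightarrow>
     (('a + 'a) \<times> nat \<times> nat) mpoly" where
  "rep_equation Q lam \<beta> v i j =
     (let M = generic_matrix (double_quiver Q) \<beta> in
      (\<Sum>a\<in>{a \<in> arcs Q. head Q a = v}. (M (Inl a) * M (Inr a)) $$ (i, j))
      - (\<Sum>a\<in>{a \<in> arcs Q. tail Q a = v}. (M (Inr a) * M (Inl a)) $$ (i, j))
      - (if i = j then mconst (lam v) else 0))"

text \<open>The coordinate algebra of the (not necessarily reduced) affine scheme
  \<open>rep\<^sub>\<beta> \<Pi>\<^sub>\<lambda>\<close>.\<close>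

definition rep_scheme ::
  "('v, 'a) pre_digraph \<Rightarrow> ('v \<Rightarrow> complex) \<Rightarrow> ('v \<Rightarrow> nat) \<Rightarrow>
     (complex, (('a + 'a) \<times> nat \<times> nat) mpoly set) module" where
  "rep_scheme Q lam \<beta> =
     (let P = polynomial_algebra (rep_coordinates (double_quiver Q) \<beta>) in
      alg_quot P (genideal P
        {rep_equation Q lam \<beta> v i j | v i j. v \<in> verts Q \<and> i < \<beta> v \<and> j < \<beta> v}))"


section \<open>Roots and the set \<open>\<Sigma>\<^sub>\<lambda>\<close>\<close>

text \<open>Dimension vectors are functions on all of the vertex type that vanish outside \<open>verts Q\<close>.\<close>

definition dimension_vector :: "('v, 'a) pre_digraph \<Rightarrow> ('v \<Rightarrow> nat) \<Rightarrow> bool" where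
  "dimension_vector Q \<beta> \<longleftrightarrow> (\<forall>v. v \<notin> verts Q \<longrightarrow> \<beta> v = 0)"

definition quiver_rep :: "('v, 'a) pre_digraph \<Rightarrow> ('v \<Rightarrow> nat) \<Rightarrow> ('a \<Rightarrow> complex mat) \<Rightarrow> bool" where
  "quiver_rep Q \<beta> V \<longleftrightarrow> (\<forall>a\<in>arcs Q. V a \<in> carrier_mat (\<beta> (head Q a)) (\<beta> (tail Q a)))"

definition quiver_rep_iso ::
  "('v, 'a) pre_digraph \<Rightarrow> ('v \<Rightarrow> nat) \<Rightarrow> ('a \<Rightarrow> complex mat) \<Rightarrow> ('a \<Rightarrow> complex mat) \<Rightarrow> bool" where
  "quiver_rep_iso Q \<beta> V W \<longleftrightarrow>
     (\<exists>g. (\<forall>v\<in>verts Q. g v \<in> carrier_mat (\<beta> v) (\<beta> v) \<and> invertible_mat (g v)) \<and>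
          (\<forall>a\<in>arcs Q. g (head Q a) * V a = W a * g (tail Q a)))"

definition rep_direct_sum ::
  "('a \<Rightarrow> complex mat) \<Rightarrow> ('a \<Rightarrow> complex mat) \<Rightarrow> 'a \<Rightarrow> complex mat" where
  "rep_direct_sum V W a =
     four_block_mat (V a) (0\<^sub>m (dim_row (V a)) (dim_col (W a)))
                    (0\<^sub>m (dim_row (W a)) (dim_col (V a))) (W a)"

definition indecomposable_rep ::
  "('v, 'a) pre_digraph \<Rightarrow> ('v \<Rightarrow> nat) \<Rightarrow> ('a \<Rightarrow> complex mat) \<Rightarrow> bool" where
  "indecomposable_rep Q \<beta> V \<longleftrightarrow> quiver_rep Q \<beta> V \<and> \<beta> \<noteq> (\<lambda>v. 0) \<and>
     \<not> (\<exists>\<gamma> \<delta> V' V''. dimension_vector Q \<gamma> \<and> dimension_vector Q \<delta> \<and>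
          \<gamma> \<noteq> (\<lambda>v. 0) \<and> \<delta> \<noteq> (\<lambda>v. 0) \<and> \<beta> = (\<lambda>v. \<gamma> v + \<delta> v) \<and>
          quiver_rep Q \<gamma> V' \<and> quiver_rep Q \<delta> V'' \<and>
          quiver_rep_iso Q \<beta> V (rep_direct_sum V' V''))"

definition quiver_root :: "('v, 'a) pre_digraph \<Rightarrow> ('v \<Rightarrow> nat) \<Rightarrow> bool" where
  "quiver_root Q \<beta> \<longleftrightarrow> dimension_vector Q \<beta> \<and> (\<exists>V. indecomposable_rep Q \<beta> V)"

definition euler_matrix :: "('v, 'a) pre_digraph \<Rightarrow> 'v \<Rightarrow> 'v \<Rightarrow> int" where
  "euler_matrix Q i j =
     (if i = j then 1 else 0) - int (card {a \<in> arcs Q. tail Q a = i \<and> head Q a = j})"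

definition euler_form :: "('v, 'a) pre_digraph \<Rightarrow> ('v \<Rightarrow> int) \<Rightarrow> ('v \<Rightarrow> int) \<Rightarrow> int" where
  "euler_form Q x y = (\<Sum>i\<in>verts Q. \<Sum>j\<in>verts Q. x i * euler_matrix Q i j * y j)"

abbreviation tits_form :: "('v, 'a) pre_digraph \<Rightarrow> ('v \<Rightarrow> nat) \<Rightarrow> int" where
  "tits_form Q \<beta> \<equiv> euler_form Q (\<lambda>v. int (\<beta> v)) (\<lambda>v. int (\<beta> v))"

definition Delta_plus :: "('v, 'a) pre_digraph \<Rightarrow> ('v \<Rightarrow> complex) \<Rightarrow> ('v \<Rightarrow> nat) set" where
  "Delta_plus Q lam = {\<beta>. quiver_root Q \<beta> \<and> (\<Sum>v\<in>verts Q. lam v * of_nat (\<beta> v)) = 0}"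

definition Sigma_set :: "('v, 'a) pre_digraph \<Rightarrow> ('v \<Rightarrow> complex) \<Rightarrow> ('v \<Rightarrow> nat) set" where
  "Sigma_set Q lam = {\<alpha> \<in> Delta_plus Q lam.
     \<forall>bs. length bs \<ge> 2 \<and> set bs \<subseteq> Delta_plus Q lam \<and> \<alpha> = (\<lambda>v. \<Sum>\<beta>\<leftarrow>bs. \<beta> v) \<longrightarrow>
       1 - tits_form Q \<alpha> > int (length bs) - (\<Sum>\<beta>\<leftarrow>bs. tits_form Q \<beta>)}"

end

(* Taking the decomposition 2 alpha = alpha + alpha in the definition of Sigma gives q(alpha) < 0 for
   the Tits form q. An indecomposable representation of Q of dimension alpha extends to a
   representation W of Pi_lambda, because its endomorphisms have a single eigenvalue. Counting
   dimensions, q(alpha) < 0 implies that the kernel of the differential of the moment map at W is not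
   isotropic for the symplectic form omega, so it contains x, y with omega(x, y) <> 0.

   At the point V = W + W of rep_{2 alpha}, a tangent vector X lifts from C[t]/t^2 to C[t]/t^3 only if
   tr(theta sum_a [X_a, X_{a^*}]) = 0 for every endomorphism theta of V: this is the second order term
   of the moment map equation, and the image of the differential is orthogonal to End(V). For X with
   off-diagonal blocks x and y and theta the projection to the first copy of W, the trace is
   omega(x, y). The same trace obstructs lifting the representation V + tX of Pi_lambda from
   matrices over C[t]/t^2 to matrices over C[t]/t^3, even though the vertex idempotents may move. *)

theory Submission
  imports Defs "Jordan_Normal_Form.Jordan_Normal_Form_Existence"
begin

section \<open>Finite linear systems\<close>

text \<open>The doubled point is forced because the identity cannot serve as \<theta>: the trace of
  a sum of commutators is zero for every X. A second copy of W supplies an endomorphism that sees a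
  single corner of the moment map, where the two off-diagonal blocks of X meet.

  The dimension count is symplectic linear algebra. The representations of the double quiver form a
  space of dimension N = 2 sum_a \<alpha>(tail a) \<alpha>(head a), and the moment map imposes sum_v
  \<alpha>(v)^2 equations on it. Negativity of q makes this number less than N/2, so the kernel of
  the differential has dimension greater than N/2, too large for an isotropic subspace. The argument
  is carried out with explicit linear systems over finite index sets instead of ranks and dimensions
  of subspaces.

  Both smoothness notions are tested on one family of algebras, matrices over C[t]/t^3 with the
  square-zero ideal of multiples of t^2: all matrices on the total space for the algebra, 1 x 1
  matrices for the scheme.\<close>

lemma homogeneous_system_nonzero_solution:
  fixes c :: "'e \<Rightarrow> 'r \<Rightarrow> 'f::field"
  assumes "finite E" "finite R" "card E < card R"
  shows "\<exists>x. (\<forall>r. r \<notin> R \<longrightarrow> x r = 0) \<and> (\<exists>r\<in>R. x r \<noteq> 0) \<and>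
           (\<forall>e\<in>E. (\<Sum>r\<in>R. c e r * x r) = 0)"
  using assms
proof (induction E arbitrary: R c rule: finite_induct)
  case empty
  then obtain r where "r \<in> R" by (metis card.empty card_gt_0_iff all_not_in_conv)
  then show ?case by (intro exI[of _ "\<lambda>s. if s = r then 1 else 0"]) auto
next
  case (insert e E)
  show ?case
  proof (cases "\<forall>r\<in>R. c e r = 0")
    case True
    with insert.IH[of R c] insert.prems insert.hyps show ?thesis by auto
  next
    case False
    then obtain q where q: "q \<in> R" "c e q \<noteq> 0" by auto
    define R' where "R' = R - {q}"
    have R': "finite R'" "R = insert q R'" "q \<notin> R'" using q insert.prems by (auto simp: R'_def)
    have "card E < card R'" using insert.prems insert.hyps R' by simp
    then obtain x where x: "\<And>r. r \<notin> R' \<Longrightarrow> x r = 0" "\<exists>r\<in>R'. x r \<noteq> 0"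
      "\<And>e'. e' \<in> E \<Longrightarrow> (\<Sum>r\<in>R'. (c e' r - c e' q / c e q * c e r) * x r) = 0"
      using insert.IH[OF R'(1), of "\<lambda>e' r. c e' r - c e' q / c e q * c e r"] by blast
    define z where "z = x(q := - (\<Sum>r\<in>R'. c e r * x r) / c e q)"
    have zs: "(\<Sum>r\<in>R. c e' r * z r) = c e' q * z q + (\<Sum>r\<in>R'. c e' r * x r)" for e'
    proof -
      have "(\<Sum>r\<in>R'. c e' r * z r) = (\<Sum>r\<in>R'. c e' r * x r)"
        by (rule sum.cong) (use R' in \<open>auto simp: z_def\<close>)
      then show ?thesis using R' by simp
    qed
    have "(\<Sum>r\<in>R. c e r * z r) = 0" unfolding zs using q by (simp add: z_def)
    moreover have "(\<Sum>r\<in>R. c e' r * z r) = 0" if "e' \<in> E" for e'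
    proof -
      have "(\<Sum>r\<in>R'. c e' r * x r) = c e' q / c e q * (\<Sum>r\<in>R'. c e r * x r)"
        using x(3)[OF that] by (simp add: algebra_simps sum_subtractf sum_distrib_left)
      then show ?thesis unfolding zs by (simp add: z_def)
    qed
    moreover have "\<exists>r\<in>R. z r \<noteq> 0" using x(2) R' by (auto simp: z_def)
    moreover have "\<forall>r. r \<notin> R \<longrightarrow> z r = 0" using x(1) R' by (auto simp: z_def)
    ultimately show ?thesis by (intro exI[of _ z]) auto
  qed
qed

text \<open>Elimination of one unknown at a time. The criterion serves twice: it extends an
  indecomposable representation to the adjoined arrows, where the relations y come from
  endomorphisms, and it produces a vector y with \<omega>(x, y) = 1.\<close>

lemma Fredholm_alternative:
  fixes c :: "'e \<Rightarrow> 'r \<Rightarrow> 'f::field"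
  assumes "finite R" "finite E"
    and "\<And>y. (\<forall>r\<in>R. (\<Sum>e\<in>E. y e * c e r) = 0) \<Longrightarrow> (\<Sum>e\<in>E. y e * b e) = 0"
  shows "\<exists>x. \<forall>e\<in>E. (\<Sum>r\<in>R. c e r * x r) = b e"
  using assms
proof (induction R arbitrary: E c b rule: finite_induct)
  case empty
  have "b e = 0" if "e \<in> E" for e
    using empty.prems(2)[of "\<lambda>e'. if e' = e then 1 else 0"] that empty.prems(1)
    by (simp add: if_distrib[of "\<lambda>u. u * _"] cong: if_cong)
  then show ?case by simp
next
  case (insert q R)
  show ?case
  proof (cases "\<forall>e\<in>E. c e q = 0")
    case True
    have "\<exists>x. \<forall>e\<in>E. (\<Sum>r\<in>R. c e r * x r) = b e"
      by (rule insert.IH[OF insert.prems(1)], rule insert.prems(2)) (use True in auto)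
    then show ?thesis using True insert.hyps by auto
  next
    case False
    then obtain d where d: "d \<in> E" "c d q \<noteq> 0" by auto
    define E' where "E' = E - {d}"
    have E': "finite E'" "E = insert d E'" "d \<notin> E'" using d insert.prems by (auto simp: E'_def)
    define t where "t e = c e q / c d q" for e
    have "\<exists>x. \<forall>e\<in>E'. (\<Sum>r\<in>R. (c e r - t e * c d r) * x r) = b e - t e * b d"
    proof (rule insert.IH[OF E'(1)])
      fix y assume y: "\<forall>r\<in>R. (\<Sum>e\<in>E'. y e * (c e r - t e * c d r)) = 0"
      \<comment> \<open>The coefficient at the pivot equation d is chosen so that z combines the
        original equations exactly as y combines the reduced ones; the eliminated column q then
        cancels as well.\<close>
      define z where "z = y(d := - (\<Sum>e\<in>E'. y e * t e))"
      have zs: "(\<Sum>e\<in>E. z e * f e) = (\<Sum>e\<in>E'. y e * (f e - t e * f d))" for f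
      proof -
        have "(\<Sum>e\<in>E'. z e * f e) = (\<Sum>e\<in>E'. y e * f e)"
          by (rule sum.cong) (use E' in \<open>auto simp: z_def\<close>)
        then show ?thesis using E'
          by (simp add: z_def algebra_simps sum_subtractf sum_distrib_left)
      qed
      have "(\<Sum>e\<in>E. z e * b e) = 0"
      proof (rule insert.prems(2), rule ballI)
        fix r assume "r \<in> insert q R"
        then show "(\<Sum>e\<in>E. z e * c e r) = 0"
          unfolding zs using y d by (auto simp: t_def)
      qed
      then show "(\<Sum>e\<in>E'. y e * (b e - t e * b d)) = 0" unfolding zs .
    qed
    then obtain x where x: "\<And>e. e \<in> E' \<Longrightarrow> (\<Sum>r\<in>R. (c e r - t e * c d r) * x r) = b e - t e * b d"
      by blast
    define z where "z = x(q := (b d - (\<Sum>r\<in>R. c d r * x r)) / c d q)"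
    have zs: "(\<Sum>r\<in>insert q R. c e r * z r) = c e q * z q + (\<Sum>r\<in>R. c e r * x r)" for e
    proof -
      have "(\<Sum>r\<in>R. c e r * z r) = (\<Sum>r\<in>R. c e r * x r)"
        by (rule sum.cong) (use insert.hyps in \<open>auto simp: z_def\<close>)
      then show ?thesis using insert.hyps by simp
    qed
    have zq: "c e q * z q = t e * (b d - (\<Sum>r\<in>R. c d r * x r))" for e
      by (simp add: z_def t_def)
    have "(\<Sum>r\<in>insert q R. c e r * z r) = b e" if "e \<in> E" for e
    proof (cases "e = d")
      case True
      then show ?thesis unfolding zs zq using d by (simp add: t_def)
    next
      case False
      then have "e \<in> E'" using that E' by auto
      from x[OF this] show ?thesis unfolding zs zq
        by (simp add: algebra_simps sum_subtractf sum_distrib_left)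
    qed
    then show ?thesis by blast
  qed
qed

text \<open>The row space is spanned by \<open>card E\<close> rows, so that many suitable columns
  detect whether a combination of rows is zero. If a new row d needs a new column q, some
  combination w vanishes on S but not at q; it must involve d, and subtracting a multiple of w
  removes d from any other combination.\<close>

lemma row_combination_pivots:
  fixes c :: "'e \<Rightarrow> 'r \<Rightarrow> 'f::field"
  assumes "finite E"
  shows "\<exists>S\<subseteq>R. finite S \<and> card S \<le> card E \<and>
           (\<forall>y. (\<forall>s\<in>S. (\<Sum>e\<in>E. y e * c e s) = 0) \<longrightarrow> (\<forall>r\<in>R. (\<Sum>e\<in>E. y e * c e r) = 0))"
  using assms
proof (induction E rule: finite_induct)
  case empty
  then show ?case by auto
next
  case (insert d E)
  from insert.IH obtain S where S: "S \<subseteq> R" "finite S" "card S \<le> card E"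
    "\<And>y r. (\<forall>s\<in>S. (\<Sum>e\<in>E. y e * c e s) = 0) \<Longrightarrow> r \<in> R \<Longrightarrow> (\<Sum>e\<in>E. y e * c e r) = 0"
    by blast
  define f where "f y r = (\<Sum>e\<in>insert d E. y e * c e r)" for y r
  have f: "f y r = y d * c d r + (\<Sum>e\<in>E. y e * c e r)" for y r
    using insert.hyps by (simp add: f_def)
  show ?case
  proof (cases "\<forall>y. (\<forall>s\<in>S. f y s = 0) \<longrightarrow> (\<forall>r\<in>R. f y r = 0)")
    case True
    then show ?thesis using S insert.hyps by (intro exI[of _ S]) (auto simp: f_def)
  next
    case False
    then obtain w q where w: "\<And>s. s \<in> S \<Longrightarrow> f w s = 0" "q \<in> R" "f w q \<noteq> 0" by blast
    have wd: "w d \<noteq> 0" using S(4)[of w q] w by (auto simp: f)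
    have "f z r = 0" if z: "\<forall>s\<in>insert q S. f z s = 0" and r: "r \<in> R" for z r
    proof -
      define k where "k = z d / w d"
      have eq: "(\<Sum>e\<in>E. (z e - k * w e) * c e r) = f z r - k * f w r" for r
        using wd by (simp add: f k_def algebra_simps sum_subtractf sum_distrib_left)
      have "\<forall>s\<in>S. (\<Sum>e\<in>E. (z e - k * w e) * c e s) = 0" unfolding eq using z w(1) by simp
      from S(4)[OF this] have *: "f z r = k * f w r" if "r \<in> R" for r using eq that by simp
      from *[OF w(2)] z w(3) have "k = 0" by simp
      with *[OF r] show ?thesis by simp
    qed
    moreover have "card (insert q S) \<le> card (insert d E)"
      using S insert.hyps by (simp add: card_insert_if)
    ultimately show ?thesis using S w(2) unfolding f_def[symmetric]
      by (intro exI[of _ "insert q S"]) blast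
  qed
qed

text \<open>If \<open>\<omega>\<close> vanished on the solution space \<open>K\<close>, each \<open>\<omega>(x, _)\<close> with \<open>x \<in> K\<close> would be a
  combination of the equations; the pivots produce a nonzero \<open>x \<in> K\<close> for which it is not.\<close>

lemma solution_space_not_isotropic:
  fixes c :: "'e \<Rightarrow> 'r \<Rightarrow> 'f::field" and \<epsilon> :: "'r \<Rightarrow> 'f"
  assumes fin: "finite R" "finite E" and big: "2 * card E < card R"
    and \<sigma>: "\<And>r. r \<in> R \<Longrightarrow> \<sigma> r \<in> R" "\<And>r. r \<in> R \<Longrightarrow> \<sigma> (\<sigma> r) = r"
    and \<epsilon>: "\<And>r. r \<in> R \<Longrightarrow> \<epsilon> r \<noteq> 0"
  obtains x y where "\<And>e. e \<in> E \<Longrightarrow> (\<Sum>r\<in>R. c e r * x r) = 0"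
    "\<And>e. e \<in> E \<Longrightarrow> (\<Sum>r\<in>R. c e r * y r) = 0"
    "\<And>r. r \<notin> R \<Longrightarrow> x r = 0" "\<And>r. r \<notin> R \<Longrightarrow> y r = 0"
    "(\<Sum>r\<in>R. \<epsilon> r * x (\<sigma> r) * y r) \<noteq> 0"
proof -
  obtain S where S: "S \<subseteq> R" "finite S" "card S \<le> card E"
    "\<And>y r. (\<forall>s\<in>S. (\<Sum>e\<in>E. y e * c e s) = 0) \<Longrightarrow> r \<in> R \<Longrightarrow> (\<Sum>e\<in>E. y e * c e r) = 0"
    using row_combination_pivots[OF fin(2), of R c] by blast
  \<comment> \<open>To the equations E are added the conditions x(\<sigma> s) = 0 for the pivots s,
    so that the row \<omega>(x, _) vanishes on the pivot columns. Together these are at most 2 card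
    E < card R conditions, which leaves a nonzero x.\<close>
  define c' where "c' = case_sum c (\<lambda>s r. if r = \<sigma> s then 1 else 0)"
  have "card (E <+> S) < card R" using S big fin by (simp add: card_Plus)
  with fin S(2) obtain x where x: "\<And>r. r \<notin> R \<Longrightarrow> x r = 0" "\<exists>r\<in>R. x r \<noteq> 0"
    "\<And>e. e \<in> E <+> S \<Longrightarrow> (\<Sum>r\<in>R. c' e r * x r) = 0"
    using homogeneous_system_nonzero_solution[of "E <+> S" R c'] by (metis finite_Plus)
  have xE: "(\<Sum>r\<in>R. c e r * x r) = 0" if "e \<in> E" for e
    using x(3)[of "Inl e"] that by (auto simp: c'_def)
  have xS: "x (\<sigma> s) = 0" if "s \<in> S" for s
    using x(3)[of "Inr s"] that S \<sigma> fin
    by (auto simp: c'_def if_distrib[of "\<lambda>u. u * _"] InrI subset_iff cong: if_cong)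
  \<comment> \<open>The extra row \<open>None\<close> asks for \<omega>(x, y) = 1 on top of the
    equations E.\<close>
  have "\<exists>y. \<forall>e\<in>insert None (Some ` E).
      (\<Sum>r\<in>R. (case e of None \<Rightarrow> \<epsilon> r * x (\<sigma> r) | Some e \<Rightarrow> c e r) * y r) =
      (case e of None \<Rightarrow> 1 | Some _ \<Rightarrow> 0)"
  proof (rule Fredholm_alternative[OF fin(1)])
    show "finite (insert None (Some ` E))" using fin by simp
    fix y assume "\<forall>r\<in>R. (\<Sum>e\<in>insert None (Some ` E).
       y e * (case e of None \<Rightarrow> \<epsilon> r * x (\<sigma> r) | Some e \<Rightarrow> c e r)) = 0"
    then have y: "y None * (\<epsilon> r * x (\<sigma> r)) + (\<Sum>e\<in>E. y (Some e) * c e r) = 0" if "r \<in> R" for r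
      using that fin by (simp add: sum.reindex)
    \<comment> \<open>On the pivot columns a relation involves only the rows of E. Its E part
      therefore vanishes in every column, and the \<open>None\<close> part must vanish on its
      own.\<close>
    have "\<forall>s\<in>S. (\<Sum>e\<in>E. y (Some e) * c e s) = 0" using y xS S(1) by force
    from S(4)[OF this] y have *: "y None * (\<epsilon> r * x (\<sigma> r)) = 0" if "r \<in> R" for r using that by simp
    from x(2) obtain q where "q \<in> R" "x q \<noteq> 0" by blast
    with *[of "\<sigma> q"] \<sigma> \<epsilon> have "y None = 0" by auto
    then show "(\<Sum>e\<in>insert None (Some ` E). y e * (case e of None \<Rightarrow> 1 | Some _ \<Rightarrow> 0)) = 0"
      using fin by (simp add: sum.reindex)
  qed
  then obtain y where y: "(\<Sum>r\<in>R. \<epsilon> r * x (\<sigma> r) * y r) = 1"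
    "\<And>e. e \<in> E \<Longrightarrow> (\<Sum>r\<in>R. c e r * y r) = 0" by auto
  define y' where "y' r = (if r \<in> R then y r else 0)" for r
  have y': "(\<Sum>r\<in>R. f r * y' r) = (\<Sum>r\<in>R. f r * y r)" for f
    by (rule sum.cong) (auto simp: y'_def)
  show thesis
    by (rule that[of x y']) (auto simp: y' y xE x(1), auto simp: y'_def)
qed

section \<open>Traces of endomorphisms of indecomposable representations\<close>

lemma similar_mat_four_block_swap:
  fixes A B :: "'a::comm_ring_1 mat"
  assumes A: "A \<in> carrier_mat n n" and B: "B \<in> carrier_mat m m"
  shows "similar_mat (four_block_mat A (0\<^sub>m n m) (0\<^sub>m m n) B)
                     (four_block_mat B (0\<^sub>m m n) (0\<^sub>m n m) A)"
proof -
  let ?P = "four_block_mat (0\<^sub>m n m) (1\<^sub>m n) (1\<^sub>m m) (0\<^sub>m m n) :: 'a mat"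
  let ?Q = "four_block_mat (0\<^sub>m m n) (1\<^sub>m m) (1\<^sub>m n) (0\<^sub>m n m) :: 'a mat"
  have 1: "?P * ?Q = 1\<^sub>m (n + m)"
    by (subst mult_four_block_mat[of _ n m _ n _ m _ _ n _ m]) auto
  have 2: "?Q * ?P = 1\<^sub>m (m + n)"
    by (subst mult_four_block_mat[of _ m n _ m _ n _ _ m _ n]) auto
  have 3: "?P * four_block_mat B (0\<^sub>m m n) (0\<^sub>m n m) A = four_block_mat (0\<^sub>m n m) A B (0\<^sub>m m n)"
    using A B by (subst mult_four_block_mat[of _ n m _ n _ m _ _ m _ n]) auto
  have 4: "four_block_mat (0\<^sub>m n m) A B (0\<^sub>m m n) * ?Q = four_block_mat A (0\<^sub>m n m) (0\<^sub>m m n) B"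
    using A B by (subst mult_four_block_mat[of _ n m _ n _ m _ _ n _ m]) auto
  have "similar_mat_wit (four_block_mat A (0\<^sub>m n m) (0\<^sub>m m n) B)
          (four_block_mat B (0\<^sub>m m n) (0\<^sub>m n m) A) ?P ?Q"
    by (rule similar_mat_witI[of _ _ "n + m"]) (use 1 2 3 4 A B in \<open>auto simp: add.commute[of m n]\<close>)
  then show ?thesis unfolding similar_mat_def by blast
qed

text \<open>Jordan blocks with eigenvalue c are gathered in front, any other block being moved past
  N by a swap. Only triangularity and the two diagonals are recorded: they give disjoint spectra and
  the trace.\<close>

lemma jordan_matrix_split_eigenvalue:
  fixes c :: "'a::field"
  shows "\<exists>r s N M. r + s = sum_list (map fst n_as) \<and> N \<in> carrier_mat r r \<and> M \<in> carrier_mat s s \<and>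
    upper_triangular N \<and> upper_triangular M \<and>
    (\<forall>i<r. N $$ (i,i) = c) \<and> (\<forall>i<s. M $$ (i,i) \<noteq> c) \<and>
    similar_mat (jordan_matrix n_as) (four_block_mat N (0\<^sub>m r s) (0\<^sub>m s r) M)"
proof (induction n_as)
  case Nil
  show ?case
    by (rule exI[of _ 0], rule exI[of _ 0], rule exI[of _ "0\<^sub>m 0 0"], rule exI[of _ "0\<^sub>m 0 0"])
      (auto intro!: similar_mat_refl simp: jordan_matrix_def)
next
  case (Cons na n_as)
  obtain n a where na: "na = (n, a)" by force
  let ?m = "sum_list (map fst n_as)" and ?J = "jordan_block n a"
  from Cons.IH obtain r s N M where IH: "r + s = ?m" "N \<in> carrier_mat r r" "M \<in> carrier_mat s s"
    "upper_triangular N" "upper_triangular M" "\<And>i. i < r \<Longrightarrow> N $$ (i,i) = c"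
    "\<And>i. i < s \<Longrightarrow> M $$ (i,i) \<noteq> c"
    "similar_mat (jordan_matrix n_as) (four_block_mat N (0\<^sub>m r s) (0\<^sub>m s r) M)"
    by blast
  let ?F = "\<lambda>A B. four_block_mat A (0\<^sub>m (dim_row A) (dim_col B)) (0\<^sub>m (dim_row B) (dim_col A)) (B :: 'a mat)"
  have J: "?J \<in> carrier_mat n n" "upper_triangular ?J" "\<And>i. i < n \<Longrightarrow> ?J $$ (i,i) = a"
    by (auto simp: jordan_block_def)
  have 1: "similar_mat (jordan_matrix (na # n_as)) (?F ?J (?F N M))"
    unfolding na jordan_matrix_Cons
    using similar_mat_four_block_0_0[OF similar_mat_refl[OF J(1)] IH(8) J(1), of ?m] IH(1,2,3) by auto
  also have "?F ?J (?F N M) = ?F (?F ?J N) M"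
    by (rule assoc_four_block_mat)
  finally have 2: "similar_mat (jordan_matrix (na # n_as)) (?F (?F ?J N) M)" .
  show ?case
  proof (cases "a = c")
    case True
    show ?thesis
      by (rule exI[of _ "n + r"], rule exI[of _ s], rule exI[of _ "?F ?J N"], rule exI[of _ M])
        (use 2 IH J True in \<open>auto simp: na intro!: upper_triangular_four_block\<close>)
  next
    case False
    have "similar_mat (?F ?J N) (?F N ?J)"
      using similar_mat_four_block_swap[OF J(1) IH(2)] IH(2) by simp
    from similar_mat_four_block_0_0[OF this similar_mat_refl[OF IH(3)], of "n + r"]
    have "similar_mat (?F (?F ?J N) M) (?F (?F N ?J) M)"
      using IH(2,3) by (simp add: add.commute)
    also have "?F (?F N ?J) M = ?F N (?F ?J M)"
      by (rule assoc_four_block_mat[symmetric])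
    finally have "similar_mat (jordan_matrix (na # n_as)) (?F N (?F ?J M))"
      using 2 similar_mat_trans by blast
    then show ?thesis
      by (intro exI[of _ r] exI[of _ "n + s"] exI[of _ N] exI[of _ "?F ?J M"])
        (use IH J False in \<open>auto simp: na intro!: upper_triangular_four_block\<close>)
  qed
qed

text \<open>The generalised eigenspace for c and its complement, in matrix form. The size r may be 0
  or n, so that one c can be used at all vertices, whether or not it is an eigenvalue there.\<close>

lemma split_eigenvalue:
  fixes A :: "complex mat"
  assumes A: "A \<in> carrier_mat n n"
  obtains r N M P P' where "r \<le> n" "N \<in> carrier_mat r r" "M \<in> carrier_mat (n - r) (n - r)"
    "upper_triangular N" "upper_triangular M"
    "\<And>i. i < r \<Longrightarrow> N $$ (i,i) = c" "\<And>i. i < n - r \<Longrightarrow> M $$ (i,i) \<noteq> c"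
    "P \<in> carrier_mat n n" "P' \<in> carrier_mat n n" "P * P' = 1\<^sub>m n" "P' * P = 1\<^sub>m n"
    "A = P * four_block_mat N (0\<^sub>m r (n - r)) (0\<^sub>m (n - r) r) M * P'"
proof -
  obtain as where as: "char_poly A = (\<Prod>a\<leftarrow>as. [:- a, 1:])"
    using char_poly_factorized[OF A] by blast
  obtain n_as where jnf: "similar_mat A (jordan_matrix n_as)"
    using jordan_nf_exists[OF A as] unfolding jordan_nf_def by blast
  have n: "sum_list (map fst n_as) = n"
  proof -
    obtain m P Q where "{A, jordan_matrix n_as, P, Q} \<subseteq> carrier_mat m m"
      using similar_matD[OF jnf] by blast
    then have "dim_row A = m" "dim_row (jordan_matrix n_as) = m" by auto
    then show ?thesis using A by simp
  qed
  obtain r s N M where *: "r + s = n" "N \<in> carrier_mat r r" "M \<in> carrier_mat s s"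
    "upper_triangular N" "upper_triangular M"
    "\<And>i. i < r \<Longrightarrow> N $$ (i,i) = c" "\<And>i. i < s \<Longrightarrow> M $$ (i,i) \<noteq> c"
    "similar_mat (jordan_matrix n_as) (four_block_mat N (0\<^sub>m r s) (0\<^sub>m s r) M)"
    using jordan_matrix_split_eigenvalue[of n_as c] n by blast
  obtain P P' where "similar_mat_wit A (four_block_mat N (0\<^sub>m r s) (0\<^sub>m s r) M) P P'"
    using similar_mat_trans[OF jnf *(8)] unfolding similar_mat_def by blast
  from similar_mat_witD2[OF A this] show thesis
    by (intro that[of r N M P P']) (use * in auto)
qed

text \<open>Sylvester's equation with disjoint spectra. Entry (i, j) of A X = X B involves, besides
  X(i, j), only entries below it in its column and to the left of it in its row; hence the induction
  from the lower left corner with measure (n - i) + j.\<close>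

lemma upper_triangular_intertwiner_eq_0:
  fixes A B X :: "'a::field mat"
  assumes A: "A \<in> carrier_mat n n" "upper_triangular A"
    and B: "B \<in> carrier_mat m m" "upper_triangular B"
    and X: "X \<in> carrier_mat n m" and AX: "A * X = X * B"
    and diag: "\<And>i j. i < n \<Longrightarrow> j < m \<Longrightarrow> A $$ (i,i) \<noteq> B $$ (j,j)"
  shows "X = 0\<^sub>m n m"
proof -
  have "X $$ (i,j) = 0" if "i < n" "j < m" for i j
    using that
  proof (induction "(n - i) + j" arbitrary: i j rule: less_induct)
    case less
    have below: "X $$ (k,j) = 0" if "i < k" "k < n" for k
      by (rule less.hyps) (use that less.prems in auto)
    have left: "X $$ (i,k) = 0" if "k < j" for k
      by (rule less.hyps) (use that less.prems in auto)
    have "(A * X) $$ (i,j) = (\<Sum>k<n. A $$ (i,k) * X $$ (k,j))"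
      using A X less.prems by (auto simp: scalar_prod_def atLeast0LessThan intro!: sum.cong)
    also have "\<dots> = (\<Sum>k<n. if k = i then A $$ (i,i) * X $$ (i,j) else 0)"
    proof (rule sum.cong)
      fix k assume "k \<in> {..<n}"
      then show "A $$ (i,k) * X $$ (k,j) = (if k = i then A $$ (i,i) * X $$ (i,j) else 0)"
        using A less.prems below[of k] by (cases k i rule: linorder_cases) auto
    qed simp
    also have "\<dots> = A $$ (i,i) * X $$ (i,j)" using less.prems by simp
    finally have 1: "(A * X) $$ (i,j) = A $$ (i,i) * X $$ (i,j)" .
    have "(X * B) $$ (i,j) = (\<Sum>k<m. X $$ (i,k) * B $$ (k,j))"
      using B X less.prems by (auto simp: scalar_prod_def atLeast0LessThan intro!: sum.cong)
    also have "\<dots> = (\<Sum>k<m. if k = j then X $$ (i,j) * B $$ (j,j) else 0)"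
    proof (rule sum.cong)
      fix k assume "k \<in> {..<m}"
      then show "X $$ (i,k) * B $$ (k,j) = (if k = j then X $$ (i,j) * B $$ (j,j) else 0)"
        using B less.prems left[of k] by (cases k j rule: linorder_cases) (auto simp: upper_triangular_def)
    qed simp
    also have "\<dots> = X $$ (i,j) * B $$ (j,j)" using less.prems by simp
    finally have "A $$ (i,i) * X $$ (i,j) = X $$ (i,j) * B $$ (j,j)" using 1 AX by metis
    then show ?case using diag[OF less.prems] by (metis mult.commute mult_right_cancel)
  qed
  then show ?thesis using X by (intro eq_matI) auto
qed

lemma trace_mult_commute:
  fixes A B :: "'a::comm_ring_1 mat"
  assumes "A \<in> carrier_mat n m" "B \<in> carrier_mat m n"
  shows "(\<Sum>i<n. (A * B) $$ (i,i)) = (\<Sum>i<m. (B * A) $$ (i,i))"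
proof -
  have "(\<Sum>i<n. (A * B) $$ (i,i)) = (\<Sum>i<n. \<Sum>k<m. A $$ (i,k) * B $$ (k,i))"
    using assms by (intro sum.cong) (auto simp: scalar_prod_def atLeast0LessThan intro!: sum.cong)
  also have "\<dots> = (\<Sum>k<m. \<Sum>i<n. B $$ (k,i) * A $$ (i,k))"
    by (subst sum.swap) (simp add: mult.commute)
  also have "\<dots> = (\<Sum>i<m. (B * A) $$ (i,i))"
    using assms by (intro sum.cong) (auto simp: scalar_prod_def atLeast0LessThan intro!: sum.cong)
  finally show ?thesis .
qed

lemma four_block_mat_inject:
  assumes "A \<in> carrier_mat n m" "B \<in> carrier_mat n m'" "C \<in> carrier_mat n' m" "D \<in> carrier_mat n' m'"
    and "A' \<in> carrier_mat n m" "B' \<in> carrier_mat n m'" "C' \<in> carrier_mat n' m" "D' \<in> carrier_mat n' m'"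
    and eq: "four_block_mat A B C D = four_block_mat A' B' C' D'"
  shows "A = A'" "B = B'" "C = C'" "D = D'"
proof -
  have e: "four_block_mat A B C D $$ (i,j) = four_block_mat A' B' C' D' $$ (i,j)" for i j
    using eq by simp
  show "A = A'"
  proof (rule eq_matI)
    fix i j assume "i < dim_row A'" "j < dim_col A'"
    then show "A $$ (i,j) = A' $$ (i,j)" using e[of i j] assms(1-8) by simp
  qed (use assms in auto)
  show "B = B'"
  proof (rule eq_matI)
    fix i j assume "i < dim_row B'" "j < dim_col B'"
    then show "B $$ (i,j) = B' $$ (i,j)" using e[of i "j + m"] assms(1-8) by simp
  qed (use assms in auto)
  show "C = C'"
  proof (rule eq_matI)
    fix i j assume "i < dim_row C'" "j < dim_col C'"
    then show "C $$ (i,j) = C' $$ (i,j)" using e[of "i + n" j] assms(1-8) by simp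
  qed (use assms in auto)
  show "D = D'"
  proof (rule eq_matI)
    fix i j assume "i < dim_row D'" "j < dim_col D'"
    then show "D $$ (i,j) = D' $$ (i,j)" using e[of "i + n" "j + m"] assms(1-8) by simp
  qed (use assms in auto)
qed

lemma exists_char_poly_root:
  fixes A :: "complex mat"
  assumes A: "A \<in> carrier_mat n n" and n: "0 < n"
  obtains c where "poly (char_poly A) c = 0"
proof -
  obtain as where as: "char_poly A = (\<Prod>a\<leftarrow>as. [:- a, 1:])" "length as = n"
    using char_poly_factorized[OF A] by blast
  then obtain a as' where "as = a # as'" using n by (cases as) auto
  with as show thesis by (intro that[of a]) simp
qed

text \<open>Fitting's lemma: the splitting off of the generalised eigenspaces of an endomorphism to one
  eigenvalue is a decomposition of the representation.\<close>

lemma indecomposable_endomorphism_trace: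
  fixes Y :: "'v \<Rightarrow> complex mat"
  assumes wf: "wf_digraph Q" and \<beta>: "dimension_vector Q \<beta>" and V: "indecomposable_rep Q \<beta> V"
    and Y: "\<And>v. v \<in> verts Q \<Longrightarrow> Y v \<in> carrier_mat (\<beta> v) (\<beta> v)"
    and comm: "\<And>a. a \<in> arcs Q \<Longrightarrow> Y (head Q a) * V a = V a * Y (tail Q a)"
  obtains c where "\<And>v. v \<in> verts Q \<Longrightarrow> (\<Sum>i<\<beta> v. Y v $$ (i,i)) = c * of_nat (\<beta> v)"
proof -
  interpret wf_digraph Q by (rule wf)
  have rep: "V a \<in> carrier_mat (\<beta> (head Q a)) (\<beta> (tail Q a))" if "a \<in> arcs Q" for a
    using V that unfolding indecomposable_rep_def quiver_rep_def by blast
  obtain v0 where v0: "v0 \<in> verts Q" "0 < \<beta> v0"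
    using V \<beta> unfolding indecomposable_rep_def dimension_vector_def by fastforce
  \<comment> \<open>An eigenvalue at one vertex of positive dimension, then used at all vertices. It
    makes the part belonging to c nonzero, so indecomposability has to remove the complementary
    part.\<close>
  obtain c where c: "poly (char_poly (Y v0)) c = 0"
    using exists_char_poly_root[OF Y[OF v0(1)] v0(2)] .
  \<comment> \<open>Under truncated subtraction the first conjunct says r \<le> \<beta> v, in the
    form that the block dimensions need.\<close>
  define good where "good v r N M P P' \<longleftrightarrow> r + (\<beta> v - r) = \<beta> v \<and> N \<in> carrier_mat r r \<and>
      M \<in> carrier_mat (\<beta> v - r) (\<beta> v - r) \<and> upper_triangular N \<and> upper_triangular M \<and>
      (\<forall>i<r. N $$ (i,i) = c) \<and> (\<forall>i<\<beta> v - r. M $$ (i,i) \<noteq> c) \<and>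
      P \<in> carrier_mat (\<beta> v) (\<beta> v) \<and> P' \<in> carrier_mat (\<beta> v) (\<beta> v) \<and>
      P * P' = 1\<^sub>m (\<beta> v) \<and> P' * P = 1\<^sub>m (\<beta> v) \<and>
      Y v = P * four_block_mat N (0\<^sub>m r (\<beta> v - r)) (0\<^sub>m (\<beta> v - r) r) M * P'" for v r N M P P'
  have "\<forall>v\<in>verts Q. \<exists>r N M P P'. good v r N M P P'"
  proof
    fix v assume "v \<in> verts Q"
    from split_eigenvalue[OF Y[OF this], of c] obtain r N M P P' where "r \<le> \<beta> v" and
      *: "N \<in> carrier_mat r r" "M \<in> carrier_mat (\<beta> v - r) (\<beta> v - r)"
      "upper_triangular N" "upper_triangular M"
      "\<And>i. i < r \<Longrightarrow> N $$ (i,i) = c" "\<And>i. i < \<beta> v - r \<Longrightarrow> M $$ (i,i) \<noteq> c"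
      "P \<in> carrier_mat (\<beta> v) (\<beta> v)" "P' \<in> carrier_mat (\<beta> v) (\<beta> v)"
      "P * P' = 1\<^sub>m (\<beta> v)" "P' * P = 1\<^sub>m (\<beta> v)"
      "Y v = P * four_block_mat N (0\<^sub>m r (\<beta> v - r)) (0\<^sub>m (\<beta> v - r) r) M * P'"
      by metis
    moreover have "r + (\<beta> v - r) = \<beta> v" using \<open>r \<le> \<beta> v\<close> by simp
    ultimately show "\<exists>r N M P P'. good v r N M P P'" unfolding good_def by blast
  qed
  then obtain r N M P P' where t: "\<And>v. v \<in> verts Q \<Longrightarrow> good v (r v) (N v) (M v) (P v) (P' v)" by metis
  define s where "s v = \<beta> v - r v" for v
  define D where "D v = four_block_mat (N v) (0\<^sub>m (r v) (s v)) (0\<^sub>m (s v) (r v)) (M v)" for v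
  have g: "r v + s v = \<beta> v" "N v \<in> carrier_mat (r v) (r v)" "M v \<in> carrier_mat (s v) (s v)"
    "upper_triangular (N v)" "upper_triangular (M v)" "\<And>i. i < r v \<Longrightarrow> N v $$ (i,i) = c"
    "\<And>i. i < s v \<Longrightarrow> M v $$ (i,i) \<noteq> c"
    "P v \<in> carrier_mat (\<beta> v) (\<beta> v)" "P' v \<in> carrier_mat (\<beta> v) (\<beta> v)"
    "P v * P' v = 1\<^sub>m (\<beta> v)" "P' v * P v = 1\<^sub>m (\<beta> v)" "Y v = P v * D v * P' v"
    if "v \<in> verts Q" for v
    using t[OF that] unfolding good_def s_def D_def by blast+
  have D: "D v \<in> carrier_mat (\<beta> v) (\<beta> v)" if "v \<in> verts Q" for v
    using g(1-3)[OF that] unfolding D_def by (metis four_block_carrier_mat)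
  have r0: "r v0 \<noteq> 0"
  proof
    assume r0: "r v0 = 0"
    have "similar_mat (Y v0) (D v0)"
      unfolding similar_mat_def
      using similar_mat_witI[OF g(10-12) Y D g(8,9)] v0(1) by blast
    then have "char_poly (Y v0) = char_poly (D v0)" by (rule char_poly_similar)
    also have "D v0 = M v0"
      using g(1-3)[OF v0(1)] r0 unfolding D_def by (intro eq_matI) auto
    also have "char_poly (M v0) = (\<Prod>a\<leftarrow>diag_mat (M v0). [:- a, 1:])"
      using char_poly_upper_triangular[OF g(3,5)[OF v0(1)]] .
    finally have "\<exists>i<s v0. M v0 $$ (i,i) = c"
      using c g(3)[OF v0(1)] by (auto simp: poly_prod_list prod_list_zero_iff diag_mat_def)
    then show False using g(7)[OF v0(1)] by blast
  qed
  \<comment> \<open>The representation V in the bases adapted to the splittings, in which the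
    endomorphism acts by D.\<close>
  define W where "W a = P' (head Q a) * V a * P (tail Q a)" for a
  define W1 W4 where "W1 a = fst (split_block (W a) (r (head Q a)) (r (tail Q a)))"
    and "W4 a = snd (snd (snd (split_block (W a) (r (head Q a)) (r (tail Q a)))))" for a
  have W: "W1 a \<in> carrier_mat (r (head Q a)) (r (tail Q a)) \<and>
           W4 a \<in> carrier_mat (s (head Q a)) (s (tail Q a)) \<and> W a = rep_direct_sum W1 W4 a \<and>
           P' (head Q a) * V a = W a * P' (tail Q a)"
    if a: "a \<in> arcs Q" for a
  proof -
    let ?h = "head Q a" and ?t = "tail Q a"
    have h: "?h \<in> verts Q" and t: "?t \<in> verts Q" using a by auto
    note gh = g[OF h] and gt = g[OF t]
    have Wc: "W a \<in> carrier_mat (\<beta> ?h) (\<beta> ?t)"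
      unfolding W_def using gh gt rep[OF a] by auto
    obtain W2 W3 where sp: "split_block (W a) (r ?h) (r ?t) = (W1 a, W2, W3, W4 a)"
      unfolding W1_def W4_def by (metis prod.collapse)
    from split_block[OF sp, of "s ?h" "s ?t"] Wc gh(1) gt(1)
    have b: "W1 a \<in> carrier_mat (r ?h) (r ?t)" "W2 \<in> carrier_mat (r ?h) (s ?t)"
      "W3 \<in> carrier_mat (s ?h) (r ?t)" "W4 a \<in> carrier_mat (s ?h) (s ?t)"
      "W a = four_block_mat (W1 a) W2 W3 (W4 a)" by auto
    have Va: "V a \<in> carrier_mat (\<beta> ?h) (\<beta> ?t)" by (rule rep[OF a])
    note assoc = assoc_mult_mat[of _ "\<beta> ?h" "\<beta> ?h" _ "\<beta> ?h" _ "\<beta> ?h"]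
      assoc_mult_mat[of _ "\<beta> ?h" "\<beta> ?h" _ "\<beta> ?h" _ "\<beta> ?t"]
      assoc_mult_mat[of _ "\<beta> ?h" "\<beta> ?h" _ "\<beta> ?t" _ "\<beta> ?t"]
      assoc_mult_mat[of _ "\<beta> ?h" "\<beta> ?t" _ "\<beta> ?t" _ "\<beta> ?t"]
      assoc_mult_mat[of _ "\<beta> ?t" "\<beta> ?t" _ "\<beta> ?t" _ "\<beta> ?t"]
    have "D ?h * W a = (P' ?h * P ?h) * D ?h * (P' ?h * V a * P ?t)"
      unfolding W_def using gh(11) D[OF h] by simp
    also have "\<dots> = P' ?h * (P ?h * D ?h * P' ?h) * V a * P ?t"
      using gh(8,9) gt(8,9) D[OF h] Va by (simp add: assoc)
    also have "\<dots> = P' ?h * (Y ?h * V a) * P ?t"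
      using gh(9) gt(8) Y[OF h] Va unfolding gh(12)[symmetric]
      by (simp add: assoc)
    also have "\<dots> = P' ?h * (V a * (P ?t * D ?t * P' ?t)) * P ?t"
      unfolding comm[OF a] gt(12)[symmetric] ..
    also have "\<dots> = W a * D ?t * (P' ?t * P ?t)"
      unfolding W_def
      using gh(8,9) gt(8,9) D[OF t] Va by (simp add: assoc)
    also have "\<dots> = W a * D ?t" using gt(11) D[OF t] Wc by simp
    finally have eq: "D ?h * W a = W a * D ?t" .
    have "four_block_mat (N ?h * W1 a) (N ?h * W2) (M ?h * W3) (M ?h * W4 a) = D ?h * W a"
      unfolding D_def b(5) using gh(2,3) b
      by (subst mult_four_block_mat[of _ "r ?h" "r ?h" _ "s ?h" _ "s ?h" _ _ "r ?t" _ "s ?t"]) auto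
    also have "\<dots> = four_block_mat (W1 a * N ?t) (W2 * M ?t) (W3 * N ?t) (W4 a * M ?t)"
      unfolding eq unfolding D_def b(5) using gt(2,3) b
      by (subst mult_four_block_mat[of _ "r ?h" "r ?t" _ "s ?t" _ "s ?h" _ _ "r ?t" _ "s ?t"]) auto
    finally have eq4: "four_block_mat (N ?h * W1 a) (N ?h * W2) (M ?h * W3) (M ?h * W4 a) =
        four_block_mat (W1 a * N ?t) (W2 * M ?t) (W3 * N ?t) (W4 a * M ?t)" .
    note inj = four_block_mat_inject[of _ "r ?h" "r ?t" _ "s ?t" _ "s ?h", OF _ _ _ _ _ _ _ _ eq4]
    \<comment> \<open>The off-diagonal blocks of W intertwine a block with diagonal c and a block
      whose diagonal avoids c; so they vanish and W is a direct sum.\<close>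
    have off: "N ?h * W2 = W2 * M ?t" "M ?h * W3 = W3 * N ?t"
      by (rule inj; use gh(2,3) gt(2,3) b in auto)+
    have "W2 = 0\<^sub>m (r ?h) (s ?t)"
      by (rule upper_triangular_intertwiner_eq_0[OF gh(2,4) gt(3,5) b(2) off(1)])
        (use gh(6) gt(7) in metis)
    moreover have "W3 = 0\<^sub>m (s ?h) (r ?t)"
      by (rule upper_triangular_intertwiner_eq_0[OF gh(3,5) gt(2,4) b(3) off(2)])
        (use gt(6) gh(7) in metis)
    ultimately have "W a = rep_direct_sum W1 W4 a"
      using b unfolding rep_direct_sum_def by simp
    moreover have "W a * P' ?t = P' ?h * V a * (P ?t * P' ?t)"
      unfolding W_def using gh(9) gt(8,9) Va
      by (simp add: assoc)
    ultimately show ?thesis using b gt(10) gh(9) Va by auto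
  qed
  define \<gamma> \<delta> where "\<gamma> v = (if v \<in> verts Q then r v else 0)"
    and "\<delta> v = (if v \<in> verts Q then s v else 0)" for v
  \<comment> \<open>Since the part belonging to c is nonzero at v0, a nonzero complement would
    decompose V. Afterwards D has constant diagonal c at every vertex, which gives the
    traces.\<close>
  have "\<delta> = (\<lambda>v. 0)"
  proof (rule ccontr)
    assume "\<delta> \<noteq> (\<lambda>v. 0)"
    moreover have "\<gamma> \<noteq> (\<lambda>v. 0)" using r0 v0(1) by (auto simp: \<gamma>_def fun_eq_iff)
    moreover have "\<beta> = (\<lambda>v. \<gamma> v + \<delta> v)"
      using \<beta> g(1) by (auto simp: \<gamma>_def \<delta>_def fun_eq_iff dimension_vector_def)
    moreover have "dimension_vector Q \<gamma>" "dimension_vector Q \<delta>"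
      by (auto simp: \<gamma>_def \<delta>_def dimension_vector_def)
    moreover have "quiver_rep Q \<gamma> W1" "quiver_rep Q \<delta> W4"
      using W by (auto simp: \<gamma>_def \<delta>_def quiver_rep_def)
    moreover have "quiver_rep_iso Q \<beta> V (rep_direct_sum W1 W4)"
      unfolding quiver_rep_iso_def
    proof (intro exI[of _ P'] conjI ballI)
      fix v assume v: "v \<in> verts Q"
      then show "P' v \<in> carrier_mat (\<beta> v) (\<beta> v)" by (rule g)
      show "invertible_mat (P' v)"
        using g(8-11)[OF v] unfolding invertible_mat_def inverts_mat_def square_mat.simps
        by (metis carrier_matD)
    next
      fix a assume "a \<in> arcs Q"
      from W[OF this] show "P' (head Q a) * V a = rep_direct_sum W1 W4 a * P' (tail Q a)" by simp
    qed
    ultimately show False using V unfolding indecomposable_rep_def by blast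
  qed
  then have s0: "s v = 0" "r v = \<beta> v" if "v \<in> verts Q" for v
    using that g(1)[OF that] by (auto simp: \<delta>_def fun_eq_iff split: if_splits)
  show thesis
  proof (rule that[of c])
    fix v assume v: "v \<in> verts Q"
    note gv = g[OF v]
    have "(\<Sum>i<\<beta> v. Y v $$ (i,i)) = (\<Sum>i<\<beta> v. (P' v * (P v * D v)) $$ (i,i))"
      unfolding gv(12) by (rule trace_mult_commute) (use gv D[OF v] in auto)
    also have "P' v * (P v * D v) = D v"
      using gv(8-11) D[OF v] by (metis assoc_mult_mat left_mult_one_mat)
    also have "(\<Sum>i<\<beta> v. D v $$ (i,i)) = (\<Sum>i<\<beta> v. c)"
      by (rule sum.cong) (use gv(2,3,6) s0[OF v] in \<open>auto simp: D_def\<close>)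
    finally show "(\<Sum>i<\<beta> v. Y v $$ (i,i)) = c * of_nat (\<beta> v)" by simp
  qed
qed

section \<open>Complex algebras, quotients and lifting\<close>

lemma complex_algebraD:
  assumes "complex_algebra A"
  shows "ring A" "module complex_field A"
    "\<And>c x y. x \<in> carrier A \<Longrightarrow> y \<in> carrier A \<Longrightarrow>
       (c \<odot>\<^bsub>A\<^esub> x) \<otimes>\<^bsub>A\<^esub> y = c \<odot>\<^bsub>A\<^esub> (x \<otimes>\<^bsub>A\<^esub> y)"
    "\<And>c x y. x \<in> carrier A \<Longrightarrow> y \<in> carrier A \<Longrightarrow>
       x \<otimes>\<^bsub>A\<^esub> (c \<odot>\<^bsub>A\<^esub> y) = c \<odot>\<^bsub>A\<^esub> (x \<otimes>\<^bsub>A\<^esub> y)"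
  using assms unfolding complex_algebra_def by auto

lemma complex_field_simps [simp]:
  "carrier complex_field = UNIV" "x \<otimes>\<^bsub>complex_field\<^esub> y = x * y" "\<one>\<^bsub>complex_field\<^esub> = 1"
  "\<zero>\<^bsub>complex_field\<^esub> = 0" "x \<oplus>\<^bsub>complex_field\<^esub> y = x + y"
  by (auto simp: complex_field_def)

lemma cring_complex_field: "cring complex_field"
proof (rule cringI)
  show "abelian_group complex_field"
  proof (rule abelian_groupI)
    fix x :: complex
    show "\<exists>y\<in>carrier complex_field. y \<oplus>\<^bsub>complex_field\<^esub> x = \<zero>\<^bsub>complex_field\<^esub>"
      by (rule bexI[of _ "- x"]) auto
  qed auto
  show "Group.comm_monoid complex_field" by (rule comm_monoidI) auto
qed (auto simp: algebra_simps)

lemma complex_algebra_smult: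
  assumes "complex_algebra A"
  shows "\<And>c x. x \<in> carrier A \<Longrightarrow> c \<odot>\<^bsub>A\<^esub> x \<in> carrier A"
    "\<And>c d x. x \<in> carrier A \<Longrightarrow> (c + d) \<odot>\<^bsub>A\<^esub> x = c \<odot>\<^bsub>A\<^esub> x \<oplus>\<^bsub>A\<^esub> d \<odot>\<^bsub>A\<^esub> x"
    "\<And>c x y. x \<in> carrier A \<Longrightarrow> y \<in> carrier A \<Longrightarrow>
       c \<odot>\<^bsub>A\<^esub> (x \<oplus>\<^bsub>A\<^esub> y) = c \<odot>\<^bsub>A\<^esub> x \<oplus>\<^bsub>A\<^esub> c \<odot>\<^bsub>A\<^esub> y"
    "\<And>c d x. x \<in> carrier A \<Longrightarrow> (c * d) \<odot>\<^bsub>A\<^esub> x = c \<odot>\<^bsub>A\<^esub> (d \<odot>\<^bsub>A\<^esub> x)"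
    "\<And>x. x \<in> carrier A \<Longrightarrow> 1 \<odot>\<^bsub>A\<^esub> x = x"
proof -
  interpret module complex_field A using complex_algebraD[OF assms] by simp
  show "\<And>c x. x \<in> carrier A \<Longrightarrow> c \<odot>\<^bsub>A\<^esub> x \<in> carrier A" by simp
  show "\<And>c d x. x \<in> carrier A \<Longrightarrow> (c + d) \<odot>\<^bsub>A\<^esub> x = c \<odot>\<^bsub>A\<^esub> x \<oplus>\<^bsub>A\<^esub> d \<odot>\<^bsub>A\<^esub> x"
    using smult_l_distr by simp
  show "\<And>c x y. x \<in> carrier A \<Longrightarrow> y \<in> carrier A \<Longrightarrow>
       c \<odot>\<^bsub>A\<^esub> (x \<oplus>\<^bsub>A\<^esub> y) = c \<odot>\<^bsub>A\<^esub> x \<oplus>\<^bsub>A\<^esub> c \<odot>\<^bsub>A\<^esub> y"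
    using smult_r_distr by simp
  show "\<And>c d x. x \<in> carrier A \<Longrightarrow> (c * d) \<odot>\<^bsub>A\<^esub> x = c \<odot>\<^bsub>A\<^esub> (d \<odot>\<^bsub>A\<^esub> x)"
    using smult_assoc1 by simp
  show "\<And>x. x \<in> carrier A \<Longrightarrow> 1 \<odot>\<^bsub>A\<^esub> x = x"
    using smult_one by simp
qed

lemma complex_algebraI:
  assumes "ring A"
    and "\<And>c x. x \<in> carrier A \<Longrightarrow> c \<odot>\<^bsub>A\<^esub> x \<in> carrier A"
    and "\<And>c d x. x \<in> carrier A \<Longrightarrow> (c + d) \<odot>\<^bsub>A\<^esub> x = c \<odot>\<^bsub>A\<^esub> x \<oplus>\<^bsub>A\<^esub> d \<odot>\<^bsub>A\<^esub> x"
    and "\<And>c x y. x \<in> carrier A \<Longrightarrow> y \<in> carrier A \<Longrightarrow>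
       c \<odot>\<^bsub>A\<^esub> (x \<oplus>\<^bsub>A\<^esub> y) = c \<odot>\<^bsub>A\<^esub> x \<oplus>\<^bsub>A\<^esub> c \<odot>\<^bsub>A\<^esub> y"
    and "\<And>c d x. x \<in> carrier A \<Longrightarrow> (c * d) \<odot>\<^bsub>A\<^esub> x = c \<odot>\<^bsub>A\<^esub> (d \<odot>\<^bsub>A\<^esub> x)"
    and "\<And>x. x \<in> carrier A \<Longrightarrow> 1 \<odot>\<^bsub>A\<^esub> x = x"
    and "\<And>c x y. x \<in> carrier A \<Longrightarrow> y \<in> carrier A \<Longrightarrow>
       (c \<odot>\<^bsub>A\<^esub> x) \<otimes>\<^bsub>A\<^esub> y = c \<odot>\<^bsub>A\<^esub> (x \<otimes>\<^bsub>A\<^esub> y)"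
    and "\<And>c x y. x \<in> carrier A \<Longrightarrow> y \<in> carrier A \<Longrightarrow>
       x \<otimes>\<^bsub>A\<^esub> (c \<odot>\<^bsub>A\<^esub> y) = c \<odot>\<^bsub>A\<^esub> (x \<otimes>\<^bsub>A\<^esub> y)"
  shows "complex_algebra A"
proof -
  interpret ring A by (rule assms(1))
  have "module complex_field A"
    by (rule moduleI) (auto simp: assms(2-6) cring_complex_field abelian_group_axioms)
  then show ?thesis unfolding complex_algebra_def using assms by auto
qed

lemma alg_homD:
  assumes "f \<in> alg_hom A B"
  shows "f \<in> Ring.ring_hom A B"
    "\<And>c x. x \<in> carrier A \<Longrightarrow> f (c \<odot>\<^bsub>A\<^esub> x) = c \<odot>\<^bsub>B\<^esub> f x"
    "\<And>x. x \<in> carrier A \<Longrightarrow> f x \<in> carrier B"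
    "\<And>x y. x \<in> carrier A \<Longrightarrow> y \<in> carrier A \<Longrightarrow> f (x \<otimes>\<^bsub>A\<^esub> y) = f x \<otimes>\<^bsub>B\<^esub> f y"
    "\<And>x y. x \<in> carrier A \<Longrightarrow> y \<in> carrier A \<Longrightarrow> f (x \<oplus>\<^bsub>A\<^esub> y) = f x \<oplus>\<^bsub>B\<^esub> f y"
    "f \<one>\<^bsub>A\<^esub> = \<one>\<^bsub>B\<^esub>"
  using assms unfolding alg_hom_def Ring.ring_hom_def by auto

lemma alg_homI:
  assumes "\<And>x. x \<in> carrier A \<Longrightarrow> f x \<in> carrier B"
    "\<And>c x. x \<in> carrier A \<Longrightarrow> f (c \<odot>\<^bsub>A\<^esub> x) = c \<odot>\<^bsub>B\<^esub> f x"
    "\<And>x y. x \<in> carrier A \<Longrightarrow> y \<in> carrier A \<Longrightarrow> f (x \<otimes>\<^bsub>A\<^esub> y) = f x \<otimes>\<^bsub>B\<^esub> f y"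
    "\<And>x y. x \<in> carrier A \<Longrightarrow> y \<in> carrier A \<Longrightarrow> f (x \<oplus>\<^bsub>A\<^esub> y) = f x \<oplus>\<^bsub>B\<^esub> f y"
    "f \<one>\<^bsub>A\<^esub> = \<one>\<^bsub>B\<^esub>"
  shows "f \<in> alg_hom A B"
  using assms unfolding alg_hom_def Ring.ring_hom_def by auto

lemma alg_hom_comp:
  assumes "f \<in> alg_hom A B" "g \<in> alg_hom B C"
  shows "(\<lambda>x. g (f x)) \<in> alg_hom A C"
  by (rule alg_homI) (simp_all add: alg_homD[OF assms(1)] alg_homD[OF assms(2)])

lemma alg_hom_zero:
  assumes "f \<in> alg_hom A B" "ring A" "ring B"
  shows "f \<zero>\<^bsub>A\<^esub> = \<zero>\<^bsub>B\<^esub>"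
  using ring_hom_zero[OF alg_homD(1)[OF assms(1)] assms(2,3)] .

lemma alg_quot_simps [simp]:
  "carrier (alg_quot A I) = carrier (A Quot I)"
  "monoid.mult (alg_quot A I) = monoid.mult (A Quot I)"
  "one (alg_quot A I) = one (A Quot I)"
  "ring.zero (alg_quot A I) = ring.zero (A Quot I)"
  "add (alg_quot A I) = add (A Quot I)"
  "c \<odot>\<^bsub>alg_quot A I\<^esub> K = (\<Union>x\<in>K. I +>\<^bsub>A\<^esub> (c \<odot>\<^bsub>A\<^esub> x))"
  by (simp_all add: alg_quot_def ring.extend_def)

text \<open>A scalar acts as multiplication by the ring element c 1, so ring ideals are
  automatically subspaces.\<close>

lemma ideal_smult_closed:
  assumes A: "complex_algebra A" and I: "ideal I A" and x: "x \<in> I"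
  shows "c \<odot>\<^bsub>A\<^esub> x \<in> I"
proof -
  interpret ideal I A by (rule I)
  have "(c \<odot>\<^bsub>A\<^esub> \<one>\<^bsub>A\<^esub>) \<otimes>\<^bsub>A\<^esub> x = c \<odot>\<^bsub>A\<^esub> x"
    using x complex_algebraD(3)[OF A, of "\<one>\<^bsub>A\<^esub>" x c] by simp
  moreover have "(c \<odot>\<^bsub>A\<^esub> \<one>\<^bsub>A\<^esub>) \<otimes>\<^bsub>A\<^esub> x \<in> I"
    by (rule I_l_closed[OF x]) (simp add: complex_algebra_smult[OF A])
  ultimately show ?thesis by simp
qed

lemma coset_eq_iff:
  assumes I: "ideal I A" and x: "x \<in> carrier A" and y: "y \<in> carrier A"
  shows "I +>\<^bsub>A\<^esub> x = I +>\<^bsub>A\<^esub> y \<longleftrightarrow> (\<exists>i\<in>I. x = i \<oplus>\<^bsub>A\<^esub> y)"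
proof -
  interpret ideal I A by (rule I)
  have "x \<in> I +>\<^bsub>A\<^esub> y \<longleftrightarrow> (\<exists>i\<in>I. x = i \<oplus>\<^bsub>A\<^esub> y)"
    unfolding a_r_coset_def' by auto
  moreover have "I +>\<^bsub>A\<^esub> x = I +>\<^bsub>A\<^esub> y \<longleftrightarrow> x \<in> I +>\<^bsub>A\<^esub> y"
    using a_repr_independence[OF _ y] a_rcos_self[OF x] a_subgroup
    by (metis a_repr_independence' x y)
  ultimately show ?thesis by simp
qed

lemma alg_quot_proj:
  assumes A: "complex_algebra A" and I: "ideal I A"
  shows "(\<lambda>x. I +>\<^bsub>A\<^esub> x) \<in> alg_hom A (alg_quot A I)"
proof -
  interpret ideal I A by (rule I)
  have hom: "(+>\<^bsub>A\<^esub>) I \<in> Ring.ring_hom A (A Quot I)" by (rule rcos_ring_hom)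
  \<comment> \<open>The scalar multiple of a coset is a union over its representatives; all sets in
    that union coincide.\<close>
  have "I +>\<^bsub>A\<^esub> (c \<odot>\<^bsub>A\<^esub> x) = (\<Union>y\<in>I +>\<^bsub>A\<^esub> x. I +>\<^bsub>A\<^esub> (c \<odot>\<^bsub>A\<^esub> y))" if x: "x \<in> carrier A" for c x
  proof -
    have "I +>\<^bsub>A\<^esub> (c \<odot>\<^bsub>A\<^esub> y) = I +>\<^bsub>A\<^esub> (c \<odot>\<^bsub>A\<^esub> x)" if "y \<in> I +>\<^bsub>A\<^esub> x" for y
    proof -
      from that obtain i where i: "i \<in> I" "y = i \<oplus>\<^bsub>A\<^esub> x" unfolding a_r_coset_def' by auto
      then have "c \<odot>\<^bsub>A\<^esub> y = c \<odot>\<^bsub>A\<^esub> i \<oplus>\<^bsub>A\<^esub> c \<odot>\<^bsub>A\<^esub> x"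
        using x complex_algebra_smult(3)[OF A] by simp
      moreover have "c \<odot>\<^bsub>A\<^esub> i \<in> I" by (rule ideal_smult_closed[OF A I i(1)])
      ultimately show ?thesis
        using i x by (subst coset_eq_iff[OF I]) (auto simp: complex_algebra_smult[OF A])
    qed
    moreover have "x \<in> I +>\<^bsub>A\<^esub> x" using a_rcos_self[OF x] .
    ultimately show ?thesis by blast
  qed
  then show ?thesis
    using hom unfolding alg_hom_def Ring.ring_hom_def by auto
qed

lemma alg_quot_carrierE:
  assumes "X \<in> carrier (A Quot I)"
  obtains x where "x \<in> carrier A" "X = I +>\<^bsub>A\<^esub> x"
  using assms unfolding FactRing_def A_RCOSETS_def' by auto

lemma alg_quot_factor:
  assumes A: "complex_algebra A" and I: "ideal I A" and h: "h \<in> alg_hom A C"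
    and const: "\<And>x y. x \<in> carrier A \<Longrightarrow> y \<in> carrier A \<Longrightarrow> I +>\<^bsub>A\<^esub> x = I +>\<^bsub>A\<^esub> y \<Longrightarrow> h x = h y"
  obtains f where "f \<in> alg_hom (alg_quot A I) C" "\<And>x. x \<in> carrier A \<Longrightarrow> f (I +>\<^bsub>A\<^esub> x) = h x"
proof -
  interpret ideal I A by (rule I)
  define f where "f X = h (SOME x. x \<in> carrier A \<and> X = I +>\<^bsub>A\<^esub> x)" for X
  have f: "f (I +>\<^bsub>A\<^esub> x) = h x" if "x \<in> carrier A" for x
  proof -
    have "(SOME y. y \<in> carrier A \<and> I +>\<^bsub>A\<^esub> x = I +>\<^bsub>A\<^esub> y) \<in> carrier A \<and>
          I +>\<^bsub>A\<^esub> x = I +>\<^bsub>A\<^esub> (SOME y. y \<in> carrier A \<and> I +>\<^bsub>A\<^esub> x = I +>\<^bsub>A\<^esub> y)"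
      by (rule someI[of _ x]) (use that in auto)
    then show ?thesis unfolding f_def using const that by metis
  qed
  note p = alg_homD[OF alg_quot_proj[OF A I]]
  have rep: "\<exists>x\<in>carrier A. X = I +>\<^bsub>A\<^esub> x" if "X \<in> carrier (alg_quot A I)" for X
    using that by (metis alg_quot_carrierE alg_quot_simps(1))
  have "f \<in> alg_hom (alg_quot A I) C"
  proof (rule alg_homI)
    fix X assume "X \<in> carrier (alg_quot A I)"
    then obtain x where x: "x \<in> carrier A" "X = I +>\<^bsub>A\<^esub> x" using rep by blast
    then show "f X \<in> carrier C" using f alg_homD(3)[OF h] by simp
    fix c
    show "f (c \<odot>\<^bsub>alg_quot A I\<^esub> X) = c \<odot>\<^bsub>C\<^esub> f X"
      unfolding x(2) p(2)[OF x(1), symmetric]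
      by (simp only: f x complex_algebra_smult[OF A] alg_homD(2)[OF h])
  next
    fix X Y assume "X \<in> carrier (alg_quot A I)" "Y \<in> carrier (alg_quot A I)"
    then obtain x y where x: "x \<in> carrier A" "X = I +>\<^bsub>A\<^esub> x" "y \<in> carrier A" "Y = I +>\<^bsub>A\<^esub> y"
      using rep by blast
    show "f (X \<otimes>\<^bsub>alg_quot A I\<^esub> Y) = f X \<otimes>\<^bsub>C\<^esub> f Y"
      unfolding x(2,4) p(4)[OF x(1,3), symmetric]
      by (simp only: f x m_closed alg_homD(4)[OF h])
    show "f (X \<oplus>\<^bsub>alg_quot A I\<^esub> Y) = f X \<oplus>\<^bsub>C\<^esub> f Y"
      unfolding x(2,4) p(5)[OF x(1,3), symmetric]
      by (simp only: f x a_closed alg_homD(5)[OF h])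
  next
    show "f \<one>\<^bsub>alg_quot A I\<^esub> = \<one>\<^bsub>C\<^esub>"
      unfolding p(6)[symmetric] by (simp only: f one_closed alg_homD(6)[OF h])
  qed
  then show thesis using f that by blast
qed

text \<open>The lifting property in terms of generators and relations: a map that satisfies the
  relations S modulo J can be changed by elements of J so as to satisfy them exactly. F induces a
  map from the quotient to B/J, and G is a lift of it, pulled back to A.\<close>

lemma lifts_modulo_presented:
  assumes A: "complex_algebra A" and B: "complex_algebra B" and S: "S \<subseteq> carrier A"
    and J: "ideal J B" and lift: "lifts_modulo (alg_quot A (genideal A S)) B J"
    and F: "F \<in> alg_hom A B" and FS: "\<And>s. s \<in> S \<Longrightarrow> F s \<in> J"
  obtains G where "G \<in> alg_hom A B" "\<And>s. s \<in> S \<Longrightarrow> G s = \<zero>\<^bsub>B\<^esub>"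
    "\<And>x. x \<in> carrier A \<Longrightarrow> \<exists>j\<in>J. G x = j \<oplus>\<^bsub>B\<^esub> F x"
proof -
  interpret A: ring A using complex_algebraD(1)[OF A] .
  interpret B: ring B using complex_algebraD(1)[OF B] .
  interpret J: ideal J B by (rule J)
  let ?K = "genideal A S"
  have K: "ideal ?K A" by (rule A.genideal_ideal[OF S])
  interpret K: ideal ?K A by (rule K)
  have h: "(\<lambda>x. J +>\<^bsub>B\<^esub> F x) \<in> alg_hom A (alg_quot B J)"
    by (rule alg_hom_comp[OF F alg_quot_proj[OF B J]])
  have hr: "(\<lambda>x. J +>\<^bsub>B\<^esub> F x) \<in> Ring.ring_hom A (B Quot J)"
    using alg_homD[OF h] unfolding Ring.ring_hom_def by auto
  interpret h: ring_hom_ring A "B Quot J" "\<lambda>x. J +>\<^bsub>B\<^esub> F x"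
    by (rule ring_hom_ringI2) (auto simp: A.ring_axioms J.quotient_is_ring hr)
  have zero: "\<zero>\<^bsub>B Quot J\<^esub> = J" by (simp add: FactRing_def)
  have "S \<subseteq> a_kernel A (B Quot J) (\<lambda>x. J +>\<^bsub>B\<^esub> F x)"
    unfolding a_kernel_def' zero using S FS J.a_rcos_const by auto
  from A.genideal_minimal[OF h.kernel_is_ideal this]
  have ker: "J +>\<^bsub>B\<^esub> F k = \<zero>\<^bsub>B Quot J\<^esub>" if "k \<in> ?K" for k
    using that unfolding a_kernel_def' by auto
  obtain f where f: "f \<in> alg_hom (alg_quot A ?K) (alg_quot B J)"
    "\<And>x. x \<in> carrier A \<Longrightarrow> f (?K +>\<^bsub>A\<^esub> x) = J +>\<^bsub>B\<^esub> F x"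
  proof (rule alg_quot_factor[OF A K h])
    fix x y assume x: "x \<in> carrier A" and y: "y \<in> carrier A" and "?K +>\<^bsub>A\<^esub> x = ?K +>\<^bsub>A\<^esub> y"
    then obtain k where k: "k \<in> ?K" "x = k \<oplus>\<^bsub>A\<^esub> y" using coset_eq_iff[OF K] by auto
    note K.a_Hcarr [simp]
    have "J +>\<^bsub>B\<^esub> F x = \<zero>\<^bsub>B Quot J\<^esub> \<oplus>\<^bsub>B Quot J\<^esub> (J +>\<^bsub>B\<^esub> F y)"
      unfolding k(2) ker[OF k(1), symmetric] by (rule h.hom_add) (use k(1) y in auto)
    also have "\<dots> = J +>\<^bsub>B\<^esub> F y" by (rule h.S.l_zero[OF h.hom_closed[OF y]])
    finally show "J +>\<^bsub>B\<^esub> F x = J +>\<^bsub>B\<^esub> F y" .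
  qed blast
  obtain g where g: "g \<in> alg_hom (alg_quot A ?K) B"
    "\<And>X. X \<in> carrier (alg_quot A ?K) \<Longrightarrow> J +>\<^bsub>B\<^esub> g X = f X"
    using bspec[OF lift[unfolded lifts_modulo_def] f(1)] by auto
  define G where "G x = g (?K +>\<^bsub>A\<^esub> x)" for x
  have G: "G \<in> alg_hom A B"
    unfolding G_def by (rule alg_hom_comp[OF alg_quot_proj[OF A K] g(1)])
  show thesis
  proof (rule that[OF G])
    fix s assume s: "s \<in> S"
    then have "s \<in> ?K" using A.genideal_self[OF S] by blast
    then have "?K +>\<^bsub>A\<^esub> s = ?K +>\<^bsub>A\<^esub> \<zero>\<^bsub>A\<^esub>"
      by (subst coset_eq_iff[OF K]) auto
    then have "G s = G \<zero>\<^bsub>A\<^esub>" unfolding G_def by simp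
    then show "G s = \<zero>\<^bsub>B\<^esub>" using alg_hom_zero[OF G A.ring_axioms B.ring_axioms] by simp
  next
    fix x assume x: "x \<in> carrier A"
    have "?K +>\<^bsub>A\<^esub> x \<in> carrier (alg_quot A ?K)"
      using alg_homD(3)[OF alg_quot_proj[OF A K] x] .
    then have "J +>\<^bsub>B\<^esub> G x = J +>\<^bsub>B\<^esub> F x" unfolding G_def using g(2) f(2)[OF x] by simp
    then show "\<exists>j\<in>J. G x = j \<oplus>\<^bsub>B\<^esub> F x"
      using coset_eq_iff[OF J] alg_homD(3)[OF G x] alg_homD(3)[OF F x] by blast
  qed
qed

section \<open>Transport of test algebras along an injection of carriers\<close>

lemma image_Collect_inv_into:
  assumes "inj_on f A"
  shows "{y \<in> f ` A. P (inv_into A f y)} = f ` {x \<in> A. P x}"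
  using inv_into_f_f[OF assms] by fastforce

text \<open>The lifting properties quantify only over algebras carried by
  \<open>nat \<Rightarrow> complex\<close>, while the matrix algebras used as tests live on other
  types; their structure is therefore carried along an injection.\<close>

definition transport_algebra :: "('b \<Rightarrow> 'c) \<Rightarrow> (complex, 'b) module \<Rightarrow> (complex, 'c) module" where
  "transport_algebra \<iota> B = (let \<kappa> = inv_into (carrier B) \<iota> in \<lparr>
     carrier = \<iota> ` carrier B,
     monoid.mult = (\<lambda>x y. \<iota> (\<kappa> x \<otimes>\<^bsub>B\<^esub> \<kappa> y)), one = \<iota> \<one>\<^bsub>B\<^esub>,
     ring.zero = \<iota> \<zero>\<^bsub>B\<^esub>, add = (\<lambda>x y. \<iota> (\<kappa> x \<oplus>\<^bsub>B\<^esub> \<kappa> y)),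
     module.smult = (\<lambda>c x. \<iota> (c \<odot>\<^bsub>B\<^esub> \<kappa> x))\<rparr>)"

context
  fixes B :: "(complex, 'b) module" and \<iota> :: "'b \<Rightarrow> 'c"
  assumes B: "complex_algebra B" and inj: "inj_on \<iota> (carrier B)"
begin

interpretation B: ring B using complex_algebraD(1)[OF B] .

lemma transport_algebra_simps:
  "carrier (transport_algebra \<iota> B) = \<iota> ` carrier B"
  "x \<in> carrier B \<Longrightarrow> y \<in> carrier B \<Longrightarrow> \<iota> x \<otimes>\<^bsub>transport_algebra \<iota> B\<^esub> \<iota> y = \<iota> (x \<otimes>\<^bsub>B\<^esub> y)"
  "\<one>\<^bsub>transport_algebra \<iota> B\<^esub> = \<iota> \<one>\<^bsub>B\<^esub>"
  "\<zero>\<^bsub>transport_algebra \<iota> B\<^esub> = \<iota> \<zero>\<^bsub>B\<^esub>"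
  "x \<in> carrier B \<Longrightarrow> y \<in> carrier B \<Longrightarrow> \<iota> x \<oplus>\<^bsub>transport_algebra \<iota> B\<^esub> \<iota> y = \<iota> (x \<oplus>\<^bsub>B\<^esub> y)"
  "x \<in> carrier B \<Longrightarrow> c \<odot>\<^bsub>transport_algebra \<iota> B\<^esub> \<iota> x = \<iota> (c \<odot>\<^bsub>B\<^esub> x)"
  by (simp_all add: transport_algebra_def Let_def inv_into_f_f[OF inj])

lemma ring_transport_algebra: "ring (transport_algebra \<iota> B)"
proof (rule ringI)
  show "abelian_group (transport_algebra \<iota> B)"
  proof (rule abelian_groupI)
    fix x assume "x \<in> carrier (transport_algebra \<iota> B)"
    then obtain b where "b \<in> carrier B" "x = \<iota> b" by (auto simp: transport_algebra_simps)
    then show "\<exists>y\<in>carrier (transport_algebra \<iota> B).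
        y \<oplus>\<^bsub>transport_algebra \<iota> B\<^esub> x = \<zero>\<^bsub>transport_algebra \<iota> B\<^esub>"
      by (intro bexI[of _ "\<iota> (\<ominus>\<^bsub>B\<^esub> b)"]) (auto simp: transport_algebra_simps B.l_neg)
  qed (auto simp: transport_algebra_simps B.a_ac)
  show "Group.monoid (transport_algebra \<iota> B)"
    by (rule monoidI) (auto simp: transport_algebra_simps B.m_assoc)
qed (auto simp: transport_algebra_simps B.l_distr B.r_distr)

lemma complex_algebra_transport: "complex_algebra (transport_algebra \<iota> B)"
  by (rule complex_algebraI[OF ring_transport_algebra])
    (auto simp: transport_algebra_simps complex_algebra_smult[OF B] complex_algebraD[OF B])

lemma cring_transport_algebra:
  assumes "cring B"
  shows "cring (transport_algebra \<iota> B)"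
proof -
  interpret cring B by (rule assms)
  interpret T: ring "transport_algebra \<iota> B" by (rule ring_transport_algebra)
  show ?thesis
    by (rule cringI[OF T.abelian_group_axioms _ T.l_distr], rule monoid.monoid_comm_monoidI[OF T.monoid_axioms])
      (auto simp: transport_algebra_simps intro!: arg_cong[of _ _ \<iota>] m_comm)
qed

lemma transport_alg_hom:
  "\<iota> \<in> alg_hom B (transport_algebra \<iota> B)"
  "inv_into (carrier B) \<iota> \<in> alg_hom (transport_algebra \<iota> B) B"
  by (rule alg_homI; auto simp: transport_algebra_simps complex_algebra_smult[OF B] inv_into_f_f[OF inj])+

text \<open>The image is recognised as the kernel of the composite map to B/J, which gives all ideal
  axioms at once.\<close>

lemma transport_ideal:
  assumes J: "ideal J B"
  shows "ideal (\<iota> ` J) (transport_algebra \<iota> B)"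
proof -
  interpret J: ideal J B by (rule J)
  let ?T = "transport_algebra \<iota> B" and ?h = "\<lambda>x. J +>\<^bsub>B\<^esub> inv_into (carrier B) \<iota> x"
  note h = alg_homD[OF alg_hom_comp[OF transport_alg_hom(2) alg_quot_proj[OF B J]]]
  interpret h: ring_hom_ring ?T "B Quot J" ?h
    by (rule ring_hom_ringI2)
      (use h in \<open>auto simp: ring_transport_algebra J.quotient_is_ring Ring.ring_hom_def\<close>)
  have zero: "\<zero>\<^bsub>B Quot J\<^esub> = J" by (simp add: FactRing_def)
  have "a_kernel ?T (B Quot J) ?h = \<iota> ` J"
  proof -
    have eqv: "J +>\<^bsub>B\<^esub> x = J \<longleftrightarrow> x \<in> J" if "x \<in> carrier B" for x
      using J.a_rcos_const[of x] J.a_rcos_self[OF that] by metis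
    have "a_kernel ?T (B Quot J) ?h =
        {y \<in> \<iota> ` carrier B. J +>\<^bsub>B\<^esub> inv_into (carrier B) \<iota> y = J}"
      unfolding a_kernel_def' transport_algebra_simps(1) zero ..
    also have "\<dots> = \<iota> ` {x \<in> carrier B. J +>\<^bsub>B\<^esub> x = J}"
      by (rule image_Collect_inv_into[OF inj])
    also have "{x \<in> carrier B. J +>\<^bsub>B\<^esub> x = J} = J" using eqv J.a_Hcarr by blast
    finally show ?thesis .
  qed
  then show ?thesis using h.kernel_is_ideal by simp
qed

lemma transport_nilpotent_ideal:
  assumes "nilpotent_ideal J B"
  shows "nilpotent_ideal (\<iota> ` J) (transport_algebra \<iota> B)"
proof -
  from assms obtain n where J: "ideal J B" and n: "\<And>xs. length xs = n \<Longrightarrow> set xs \<subseteq> J \<Longrightarrow>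
      foldr (\<otimes>\<^bsub>B\<^esub>) xs \<one>\<^bsub>B\<^esub> = \<zero>\<^bsub>B\<^esub>"
    unfolding nilpotent_ideal_def by auto
  interpret J: ideal J B by (rule J)
  have fold: "foldr (\<otimes>\<^bsub>B\<^esub>) ys \<one>\<^bsub>B\<^esub> \<in> carrier B \<and>
      foldr (\<otimes>\<^bsub>transport_algebra \<iota> B\<^esub>) (map \<iota> ys) \<one>\<^bsub>transport_algebra \<iota> B\<^esub> = \<iota> (foldr (\<otimes>\<^bsub>B\<^esub>) ys \<one>\<^bsub>B\<^esub>)"
    if "set ys \<subseteq> J" for ys
    using that by (induction ys) (auto simp: transport_algebra_simps)
  have "foldr (\<otimes>\<^bsub>transport_algebra \<iota> B\<^esub>) xs \<one>\<^bsub>transport_algebra \<iota> B\<^esub> = \<zero>\<^bsub>transport_algebra \<iota> B\<^esub>"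
    if xs: "length xs = n" "set xs \<subseteq> \<iota> ` J" for xs
  proof -
    from xs(2) have "xs \<in> lists (\<iota> ` J)" by auto
    then obtain ys where "xs = map \<iota> ys" "set ys \<subseteq> J" by (auto simp: lists_image)
    then show ?thesis using fold[of ys] n[of ys] xs(1) by (simp add: transport_algebra_simps)
  qed
  then show ?thesis unfolding nilpotent_ideal_def using transport_ideal[OF J] by blast
qed

end

lemma lift_presented_algebra:
  fixes B :: "(complex, 'b) module" and \<iota> :: "'b \<Rightarrow> nat \<Rightarrow> complex"
  assumes test: "\<And>(T :: test_algebra) I. complex_algebra T \<Longrightarrow> (cring B \<Longrightarrow> cring T) \<Longrightarrow>
      nilpotent_ideal I T \<Longrightarrow> lifts_modulo (alg_quot A (genideal A S)) T I"
    and A: "complex_algebra A" and S: "S \<subseteq> carrier A"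
    and B: "complex_algebra B" and J: "nilpotent_ideal J B" and inj: "inj_on \<iota> (carrier B)"
    and F: "F \<in> alg_hom A B" and FS: "\<And>s. s \<in> S \<Longrightarrow> F s \<in> J"
  obtains G where "G \<in> alg_hom A B" "\<And>s. s \<in> S \<Longrightarrow> G s = \<zero>\<^bsub>B\<^esub>"
    "\<And>x. x \<in> carrier A \<Longrightarrow> \<exists>j\<in>J. G x = j \<oplus>\<^bsub>B\<^esub> F x"
proof -
  interpret B: ring B using complex_algebraD(1)[OF B] .
  let ?T = "transport_algebra \<iota> B" and ?\<kappa> = "inv_into (carrier B) \<iota>"
  note T = complex_algebra_transport[OF B inj]
  have JB: "ideal J B" using J unfolding nilpotent_ideal_def by blast
  interpret J: ideal J B by (rule JB)
  note iota = transport_alg_hom[OF B inj]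
  have lift: "lifts_modulo (alg_quot A (genideal A S)) ?T (\<iota> ` J)"
    by (rule test[OF T cring_transport_algebra[OF B inj] transport_nilpotent_ideal[OF B inj J]])
  obtain H where H: "H \<in> alg_hom A ?T" "\<And>s. s \<in> S \<Longrightarrow> H s = \<zero>\<^bsub>?T\<^esub>"
    "\<And>x. x \<in> carrier A \<Longrightarrow> \<exists>j\<in>\<iota> ` J. H x = j \<oplus>\<^bsub>?T\<^esub> \<iota> (F x)"
    by (rule lifts_modulo_presented[OF A T S transport_ideal[OF B inj JB] lift
      alg_hom_comp[OF F iota(1)]]) (use FS in auto)
  show thesis
  proof (rule that[OF alg_hom_comp[OF H(1) iota(2)]])
    fix s assume "s \<in> S"
    then show "?\<kappa> (H s) = \<zero>\<^bsub>B\<^esub>"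
      using H(2) by (simp add: transport_algebra_simps[OF B inj] inv_into_f_f[OF inj])
  next
    fix x assume x: "x \<in> carrier A"
    from H(3)[OF x] obtain j where "j \<in> J" "H x = \<iota> j \<oplus>\<^bsub>?T\<^esub> \<iota> (F x)" by auto
    then have "?\<kappa> (H x) = j \<oplus>\<^bsub>B\<^esub> F x"
      using alg_homD(3)[OF F x] J.a_subset
      by (simp add: transport_algebra_simps[OF B inj] inv_into_f_f[OF inj] subset_iff)
    then show "\<exists>j\<in>J. ?\<kappa> (H x) = j \<oplus>\<^bsub>B\<^esub> F x" using \<open>j \<in> J\<close> by blast
  qed
qed

section \<open>Matrices over truncated polynomials\<close>

text \<open>\<open>Trunc a b c\<close> stands for \<open>a + b t + c t\<^sup>2\<close> in \<open>\<complex>[t]/(t\<^sup>3)\<close>.\<close>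

datatype trunc = Trunc (cf0: complex) (cf1: complex) (cf2: complex)

instantiation trunc :: comm_ring_1
begin
definition "0 = Trunc 0 0 0"
definition "1 = Trunc 1 0 0"
definition "x + y = Trunc (cf0 x + cf0 y) (cf1 x + cf1 y) (cf2 x + cf2 y)"
definition "x - y = Trunc (cf0 x - cf0 y) (cf1 x - cf1 y) (cf2 x - cf2 y)"
definition "- x = Trunc (- cf0 x) (- cf1 x) (- cf2 x)"
definition "x * y = Trunc (cf0 x * cf0 y) (cf0 x * cf1 y + cf1 x * cf0 y)
   (cf0 x * cf2 y + cf1 x * cf1 y + cf2 x * cf0 y)"
instance
  by standard (auto simp: zero_trunc_def one_trunc_def plus_trunc_def minus_trunc_def
    uminus_trunc_def times_trunc_def trunc.expand algebra_simps)
end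

lemma cf_simps [simp]:
  "cf0 0 = 0" "cf1 0 = 0" "cf2 0 = 0" "cf0 1 = 1" "cf1 1 = 0" "cf2 1 = 0"
  "cf0 (x + y) = cf0 x + cf0 y" "cf1 (x + y) = cf1 x + cf1 y" "cf2 (x + y) = cf2 x + cf2 y"
  "cf0 (x - y) = cf0 x - cf0 y" "cf1 (x - y) = cf1 x - cf1 y" "cf2 (x - y) = cf2 x - cf2 y"
  "cf0 (- x) = - cf0 x" "cf1 (- x) = - cf1 x" "cf2 (- x) = - cf2 x"
  "cf0 (x * y) = cf0 x * cf0 y" "cf1 (x * y) = cf0 x * cf1 y + cf1 x * cf0 y"
  "cf2 (x * y) = cf0 x * cf2 y + cf1 x * cf1 y + cf2 x * cf0 y"
  by (simp_all add: zero_trunc_def one_trunc_def plus_trunc_def minus_trunc_def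
    uminus_trunc_def times_trunc_def)

lemma cf_sum [simp]:
  "cf0 (sum f S) = (\<Sum>s\<in>S. cf0 (f s))" "cf1 (sum f S) = (\<Sum>s\<in>S. cf1 (f s))"
  "cf2 (sum f S) = (\<Sum>s\<in>S. cf2 (f s))"
  by (induction S rule: infinite_finite_induct; simp)+

definition tconst :: "complex \<Rightarrow> trunc" where
  "tconst c = Trunc c 0 0"

lemma tconst_simps [simp]:
  "cf0 (tconst c) = c" "cf1 (tconst c) = 0" "cf2 (tconst c) = 0"
  by (simp_all add: tconst_def)

lemma tconst_hom:
  "tconst 0 = 0" "tconst 1 = 1" "tconst (c + d) = tconst c + tconst d"
  "tconst (c * d) = tconst c * tconst d"
  by (simp_all add: trunc.expand)

text \<open>Matrices are functions on an arbitrary index set, so that the basis vectors (vertex,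
  number) of the total space index rows and columns without renumbering.\<close>

definition mmul :: "'i set \<Rightarrow> ('i \<Rightarrow> 'i \<Rightarrow> 'r::comm_ring_1) \<Rightarrow> ('i \<Rightarrow> 'i \<Rightarrow> 'r) \<Rightarrow> 'i \<Rightarrow> 'i \<Rightarrow> 'r" where
  "mmul I A B = (\<lambda>i j. \<Sum>k\<in>I. A i k * B k j)"

definition mid :: "'i set \<Rightarrow> 'i \<Rightarrow> 'i \<Rightarrow> 'r::comm_ring_1" where
  "mid I = (\<lambda>i j. if i = j \<and> i \<in> I then 1 else 0)"

text \<open>Vanishing off \<open>I\<close> gives each matrix a single representing function; this
  makes \<open>mid I\<close> neutral and lets finitely many coordinates determine the
  matrix.\<close>

definition msupp :: "'i set \<Rightarrow> ('i \<Rightarrow> 'i \<Rightarrow> 'r::zero) set" where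
  "msupp I = {A. \<forall>i j. i \<notin> I \<or> j \<notin> I \<longrightarrow> A i j = 0}"

lemma mmul_assoc: "mmul I (mmul I A B) C = mmul I A (mmul I B C)"
proof (intro ext)
  fix i j
  have "mmul I (mmul I A B) C i j = (\<Sum>l\<in>I. \<Sum>k\<in>I. A i k * (B k l * C l j))"
    by (simp add: mmul_def sum_distrib_right mult.assoc)
  also have "\<dots> = mmul I A (mmul I B C) i j"
    by (subst sum.swap) (simp add: mmul_def sum_distrib_left)
  finally show "mmul I (mmul I A B) C i j = mmul I A (mmul I B C) i j" .
qed

lemma mmul_mid:
  assumes "finite I" "A \<in> msupp I"
  shows "mmul I A (mid I) = A" "mmul I (mid I) A = A"
proof -
  have "mmul I A (mid I) i j = (\<Sum>k\<in>I. if k = j then A i k else 0)" for i j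
    unfolding mmul_def mid_def by (rule sum.cong) auto
  moreover have "mmul I (mid I) A i j = (\<Sum>k\<in>I. if k = i then A k j else 0)" for i j
    unfolding mmul_def mid_def by (rule sum.cong) auto
  ultimately show "mmul I A (mid I) = A" "mmul I (mid I) A = A"
    using assms by (auto simp: msupp_def fun_eq_iff)
qed

lemma msuppI: "(\<And>i j. i \<notin> I \<or> j \<notin> I \<Longrightarrow> A i j = 0) \<Longrightarrow> A \<in> msupp I"
  by (auto simp: msupp_def)

lemma msuppD: "A \<in> msupp I \<Longrightarrow> i \<notin> I \<or> j \<notin> I \<Longrightarrow> A i j = 0"
  by (auto simp: msupp_def)

definition trunc_mat_algebra :: "'i set \<Rightarrow> (complex, 'i \<Rightarrow> 'i \<Rightarrow> trunc) module" where
  "trunc_mat_algebra I = \<lparr>carrier = msupp I, monoid.mult = mmul I, one = mid I,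
     ring.zero = (\<lambda>i j. 0), add = (\<lambda>A B i j. A i j + B i j), module.smult = (\<lambda>c A i j. tconst c * A i j)\<rparr>"

text \<open>The multiples of t^2; the quotient by this ideal is the matrix algebra over
  C[t]/t^2.\<close>

definition trunc_ideal :: "'i set \<Rightarrow> ('i \<Rightarrow> 'i \<Rightarrow> trunc) set" where
  "trunc_ideal I = {A \<in> msupp I. \<forall>i j. cf0 (A i j) = 0 \<and> cf1 (A i j) = 0}"

lemma trunc_mat_algebra_simps [simp]:
  "carrier (trunc_mat_algebra I) = msupp I"
  "A \<otimes>\<^bsub>trunc_mat_algebra I\<^esub> B = mmul I A B"
  "\<one>\<^bsub>trunc_mat_algebra I\<^esub> = mid I"
  "\<zero>\<^bsub>trunc_mat_algebra I\<^esub> = (\<lambda>i j. 0)"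
  "A \<oplus>\<^bsub>trunc_mat_algebra I\<^esub> B = (\<lambda>i j. A i j + B i j)"
  "c \<odot>\<^bsub>trunc_mat_algebra I\<^esub> A = (\<lambda>i j. tconst c * A i j)"
  by (simp_all add: trunc_mat_algebra_def)

lemma msupp_mmul: "A \<in> msupp I \<Longrightarrow> B \<in> msupp I \<Longrightarrow> mmul I A B \<in> msupp I"
  by (auto simp: msupp_def mmul_def)

lemma ring_trunc_mat_algebra:
  assumes "finite I"
  shows "ring (trunc_mat_algebra I)"
proof (rule ringI)
  show "abelian_group (trunc_mat_algebra I)"
  proof (rule abelian_groupI)
    fix A assume "A \<in> carrier (trunc_mat_algebra I)"
    then show "\<exists>B\<in>carrier (trunc_mat_algebra I).
        B \<oplus>\<^bsub>trunc_mat_algebra I\<^esub> A = \<zero>\<^bsub>trunc_mat_algebra I\<^esub>"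
      by (intro bexI[of _ "\<lambda>i j. - A i j"]) (auto simp: msupp_def)
  qed (auto simp: msupp_def add_ac)
  show "Group.monoid (trunc_mat_algebra I)"
    by (rule monoidI) (use assms in \<open>auto simp: mmul_assoc mmul_mid msupp_mmul, auto simp: msupp_def mid_def\<close>)
qed (auto simp: mmul_def algebra_simps sum.distrib)

lemma complex_algebra_trunc_mat:
  assumes "finite I"
  shows "complex_algebra (trunc_mat_algebra I)"
  by (rule complex_algebraI[OF ring_trunc_mat_algebra[OF assms]])
    (auto simp: msupp_def mmul_def tconst_hom algebra_simps sum_distrib_left)

lemma cring_trunc_mat_singleton: "cring (trunc_mat_algebra {i})"
proof -
  interpret ring "trunc_mat_algebra {i}" by (rule ring_trunc_mat_algebra) simp
  have "mmul {i} A B = mmul {i} B A" if "A \<in> msupp {i}" "B \<in> msupp {i}" for A B :: "'a \<Rightarrow> 'a \<Rightarrow> trunc"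
  proof (intro ext)
    fix j k
    show "mmul {i} A B j k = mmul {i} B A j k"
      using msuppD[OF that(1)] msuppD[OF that(2)]
      by (cases "j = i"; cases "k = i") (simp_all add: mmul_def mult.commute)
  qed
  then show ?thesis
    by (intro cringI[OF abelian_group_axioms _ l_distr] monoid.monoid_comm_monoidI[OF monoid_axioms])
      simp_all
qed

lemma nilpotent_trunc_ideal:
  assumes "finite I"
  shows "nilpotent_ideal (trunc_ideal I) (trunc_mat_algebra I)"
proof -
  interpret ring "trunc_mat_algebra I" by (rule ring_trunc_mat_algebra[OF assms])
  have inv: "\<ominus>\<^bsub>trunc_mat_algebra I\<^esub> A = (\<lambda>i j. - A i j)" if "A \<in> msupp I" for A
    using that by (intro minus_equality) (auto simp: msupp_def)
  have "ideal (trunc_ideal I) (trunc_mat_algebra I)"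
  proof (rule idealI[OF ring_axioms])
    show "subgroup (trunc_ideal I) (add_monoid (trunc_mat_algebra I))"
    proof (rule add.subgroupI)
      show "trunc_ideal I \<noteq> {}"
        by (auto simp: trunc_ideal_def msupp_def intro!: exI[of _ "\<lambda>i j. 0"])
    qed (auto simp: inv trunc_ideal_def, auto simp: msupp_def)
  qed (auto simp: trunc_ideal_def msupp_mmul, auto simp: mmul_def)
  \<comment> \<open>Two factors suffice, since t^2 t^2 = 0 in C[t]/t^3.\<close>
  moreover have "foldr (\<otimes>\<^bsub>trunc_mat_algebra I\<^esub>) xs \<one>\<^bsub>trunc_mat_algebra I\<^esub> = \<zero>\<^bsub>trunc_mat_algebra I\<^esub>"
    if xs: "length xs = 2" "set xs \<subseteq> trunc_ideal I" for xs
  proof -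
    obtain A B where "xs = [A, B]" using xs(1) by (auto simp: length_Suc_conv numeral_2_eq_2)
    with xs(2) have AB: "A \<in> trunc_ideal I" "B \<in> trunc_ideal I" and xs: "xs = [A, B]" by auto
    have "mmul I A B = (\<lambda>i j. 0)"
      by (intro ext trunc.expand) (use AB in \<open>simp add: mmul_def trunc_ideal_def\<close>)
    with AB assms show ?thesis by (simp add: xs trunc_ideal_def mmul_mid)
  qed
  ultimately show ?thesis unfolding nilpotent_ideal_def by blast
qed

text \<open>A matrix is sent to the three coefficients of each of its entries, enumerated by e. The
  values of e from n on only add further coordinates, which cannot spoil injectivity.\<close>

lemma trunc_mat_algebra_embeds:
  assumes I: "finite I"
  obtains \<iota> :: "('i \<Rightarrow> 'i \<Rightarrow> trunc) \<Rightarrow> nat \<Rightarrow> complex"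
  where "inj_on \<iota> (carrier (trunc_mat_algebra (I :: 'i set)))"
proof -
  have "finite (I \<times> I \<times> {cf0, cf1, cf2})" using I by simp
  from finite_imp_nat_seg_image_inj_on[OF this] obtain n and e :: "nat \<Rightarrow> 'i \<times> 'i \<times> (trunc \<Rightarrow> complex)"
    where e: "I \<times> I \<times> {cf0, cf1, cf2} = e ` {i. i < n}" by blast
  have "inj_on (\<lambda>A m. snd (snd (e m)) (A (fst (e m)) (fst (snd (e m))))) (msupp I)"
  proof (rule inj_onI)
    fix A B :: "'i \<Rightarrow> 'i \<Rightarrow> trunc"
    assume A: "A \<in> msupp I" and B: "B \<in> msupp I" and eq:
      "(\<lambda>m. snd (snd (e m)) (A (fst (e m)) (fst (snd (e m))))) =
       (\<lambda>m. snd (snd (e m)) (B (fst (e m)) (fst (snd (e m)))))"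
    have "f (A i j) = f (B i j)" if "i \<in> I" "j \<in> I" "f \<in> {cf0, cf1, cf2}" for i j f
    proof -
      have "(i, j, f) \<in> e ` {i. i < n}" using that e by blast
      then obtain m where m: "e m = (i, j, f)" by force
      show ?thesis using fun_cong[OF eq, of m] by (simp add: m)
    qed
    then have *: "cf0 (A i j) = cf0 (B i j) \<and> cf1 (A i j) = cf1 (B i j) \<and> cf2 (A i j) = cf2 (B i j)"
      if "i \<in> I" "j \<in> I" for i j using that by blast
    have "A i j = B i j" for i j
    proof (cases "i \<in> I \<and> j \<in> I")
      case True
      then show ?thesis using * by (intro trunc.expand) blast
    next
      case False
      then show ?thesis using msuppD[OF A] msuppD[OF B] by metis
    qed
    then show "A = B" by (intro ext)
  qed
  then show thesis by (rule that[unfolded trunc_mat_algebra_simps])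
qed

section \<open>Path algebras\<close>

lemma poly_mapping_sum_single:
  fixes f :: "'k \<Rightarrow>\<^sub>0 'c::comm_monoid_add"
  shows "f = (\<Sum>k\<in>Poly_Mapping.keys f. Poly_Mapping.single k (Poly_Mapping.lookup f k))"
  by (rule poly_mapping_eqI) (auto simp: lookup_sum lookup_single when_def in_keys_iff)

lemma poly_mapping_add_induct [case_names single add]:
  fixes f :: "'k \<Rightarrow>\<^sub>0 'c::comm_monoid_add"
  assumes single: "\<And>k c. P (Poly_Mapping.single k c)"
    and add: "\<And>f g. P f \<Longrightarrow> P g \<Longrightarrow> P (f + g)"
  shows "P f"
proof -
  have "P (\<Sum>k\<in>S. Poly_Mapping.single k (Poly_Mapping.lookup f k))" if "finite S" for S
    using that
  proof induction
    case empty
    \<comment> \<open>Zero is the single with coefficient 0 at an arbitrary key, so the induction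
      rule has no separate case for it.\<close>
    show ?case using single[of undefined 0] by simp
  qed (use assms in auto)
  then show ?thesis using poly_mapping_sum_single[of f] finite_keys[of f] by metis
qed

lemma lookup_path_scale [simp]:
  "Poly_Mapping.lookup (path_scale c f) k = c * Poly_Mapping.lookup f k"
  by (simp add: path_scale_def map.rep_eq when_def)

lemma path_scale_simps:
  "path_scale c (f + g) = path_scale c f + path_scale c g"
  "path_scale (c + d) f = path_scale c f + path_scale d f"
  "path_scale c (path_scale d f) = path_scale (c * d) f"
  "path_scale 1 f = f" "path_scale 0 f = 0" "path_scale c 0 = 0"
  "path_scale c (Poly_Mapping.single k d) = Poly_Mapping.single k (c * d)"
  by (rule poly_mapping_eqI; simp add: lookup_add algebra_simps lookup_single when_def)+

lemma keys_path_scale: "Poly_Mapping.keys (path_scale c f) \<subseteq> Poly_Mapping.keys f"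
  by (auto simp: in_keys_iff)

definition lin_ext :: "('k \<Rightarrow> trunc) \<Rightarrow> ('k \<Rightarrow>\<^sub>0 complex) \<Rightarrow> trunc" where
  "lin_ext \<phi> f = (\<Sum>k\<in>Poly_Mapping.keys f. tconst (Poly_Mapping.lookup f k) * \<phi> k)"

lemma lin_ext_add: "lin_ext \<phi> (f + g) = lin_ext \<phi> f + lin_ext \<phi> g"
  unfolding lin_ext_def
  by (rule setsum_keys_plus_distrib) (simp_all add: tconst_hom algebra_simps)

lemma lin_ext_single: "lin_ext \<phi> (Poly_Mapping.single k c) = tconst c * \<phi> k"
  by (cases "c = 0") (simp_all add: lin_ext_def tconst_hom)

lemma lin_ext_zero: "lin_ext \<phi> 0 = 0"
  by (simp add: lin_ext_def)

lemma lin_ext_sum: "lin_ext \<phi> (\<Sum>s\<in>S. f s) = (\<Sum>s\<in>S. lin_ext \<phi> (f s))"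
  by (induction S rule: infinite_finite_induct) (simp_all add: lin_ext_add lin_ext_zero)

lemma lin_ext_path_scale: "lin_ext \<phi> (path_scale c f) = tconst c * lin_ext \<phi> f"
  by (induction f rule: poly_mapping_add_induct)
    (simp_all add: path_scale_simps lin_ext_add lin_ext_single tconst_hom algebra_simps)

lemma keys_sum_subset:
  assumes "\<And>i. i \<in> I \<Longrightarrow> Poly_Mapping.keys (f i) \<subseteq> X"
  shows "Poly_Mapping.keys (sum f I) \<subseteq> X"
  using keys_sum[of f I] assms by blast

definition path_prod ::
  "(('v, 'a) path \<Rightarrow>\<^sub>0 complex) \<Rightarrow> (('v, 'a) path \<Rightarrow>\<^sub>0 complex) \<Rightarrow> ('v, 'a) path \<Rightarrow>\<^sub>0 complex" where
  "path_prod f g = (\<Sum>p\<in>Poly_Mapping.keys f. \<Sum>q\<in>Poly_Mapping.keys g.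
     path_scale (Poly_Mapping.lookup f p * Poly_Mapping.lookup g q) (path_mult p q))"

lemma path_algebra_simps [simp]:
  "carrier (path_algebra G) = {f. Poly_Mapping.keys f \<subseteq> paths G}"
  "f \<otimes>\<^bsub>path_algebra G\<^esub> g = path_prod f g"
  "\<one>\<^bsub>path_algebra G\<^esub> = (\<Sum>v\<in>verts G. Poly_Mapping.single (v, [], v) 1)"
  "\<zero>\<^bsub>path_algebra G\<^esub> = 0"
  "f \<oplus>\<^bsub>path_algebra G\<^esub> g = f + g"
  "c \<odot>\<^bsub>path_algebra G\<^esub> f = path_scale c f"
  by (simp_all add: path_algebra_def path_prod_def)

lemma path_prod_add_left: "path_prod (f + f') g = path_prod f g + path_prod f' g"
  unfolding path_prod_def
  by (rule setsum_keys_plus_distrib)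
    (simp_all add: path_scale_simps distrib_right sum.distrib)

lemma path_prod_add_right: "path_prod f (g + g') = path_prod f g + path_prod f g'"
  unfolding path_prod_def sum.distrib[symmetric]
  by (intro sum.cong refl setsum_keys_plus_distrib)
    (simp_all add: path_scale_simps distrib_left)

lemma path_prod_single:
  "path_prod (Poly_Mapping.single p a) (Poly_Mapping.single q b) = path_scale (a * b) (path_mult p q)"
  by (cases "a = 0"; cases "b = 0") (simp_all add: path_prod_def path_scale_simps)

lemma path_prod_zero: "path_prod 0 g = 0" "path_prod f 0 = 0"
  by (simp_all add: path_prod_def)

lemma path_prod_scale:
  "path_prod (path_scale c f) g = path_scale c (path_prod f g)"
  "path_prod f (path_scale c g) = path_scale c (path_prod f g)"
proof -
  have "path_prod (path_scale c f) g = path_scale c (path_prod f g) \<and>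
        path_prod f (path_scale c g) = path_scale c (path_prod f g)"
  proof (induction f rule: poly_mapping_add_induct)
    case (single p a)
    show ?case
      by (induction g rule: poly_mapping_add_induct)
        (simp_all add: path_scale_simps path_prod_add_right path_prod_single mult_ac)
  qed (simp_all add: path_scale_simps path_prod_add_left)
  then show "path_prod (path_scale c f) g = path_scale c (path_prod f g)"
    "path_prod f (path_scale c g) = path_scale c (path_prod f g)" by auto
qed

lemma path_prod_assoc: "path_prod (path_prod f g) h = path_prod f (path_prod g h)"
proof (induction f rule: poly_mapping_add_induct)
  case (single p a)
  show ?case
  proof (induction g rule: poly_mapping_add_induct)
    case (single q b)
    show ?case
    proof (induction h rule: poly_mapping_add_induct)
      case (single r c)
      obtain u x v u' y v' u'' z v'' where "p = (u, x, v)" "q = (u', y, v')" "r = (u'', z, v'')"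
        by (metis prod_cases3)
      then show ?case
        by (simp add: path_prod_single path_scale_simps path_prod_zero mult.assoc)
    qed (simp_all add: path_prod_add_right)
  qed (simp_all add: path_prod_add_left path_prod_add_right)
qed (simp_all add: path_prod_add_left)

lemma path_prod_sum_left: "path_prod (\<Sum>s\<in>S. f s) g = (\<Sum>s\<in>S. path_prod (f s) g)"
  by (induction S rule: infinite_finite_induct) (simp_all add: path_prod_add_left path_prod_zero)

lemma path_prod_sum_right: "path_prod g (\<Sum>s\<in>S. f s) = (\<Sum>s\<in>S. path_prod g (f s))"
  by (induction S rule: infinite_finite_induct) (simp_all add: path_prod_add_right path_prod_zero)

context fin_digraph
begin

lemma path_prod_keys:
  assumes "Poly_Mapping.keys f \<subseteq> paths G" "Poly_Mapping.keys g \<subseteq> paths G"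
  shows "Poly_Mapping.keys (path_prod f g) \<subseteq> paths G"
proof -
  have "Poly_Mapping.keys (path_scale c (path_mult p q)) \<subseteq> paths G"
    if "p \<in> Poly_Mapping.keys f" "q \<in> Poly_Mapping.keys g" for c p q
  proof -
    have "p \<in> paths G" "q \<in> paths G" using that assms by auto
    moreover obtain u x v u' y v' where pq: "p = (u, x, v)" "q = (u', y, v')"
      by (metis prod_cases3)
    ultimately have "v' = u \<Longrightarrow> awalk u' (y @ x) v"
      by (simp add: paths_def awalk_appendI)
    then have "Poly_Mapping.keys (path_mult p q) \<subseteq> paths G"
      by (simp add: pq paths_def)
    then show ?thesis by (rule order.trans[OF keys_path_scale])
  qed
  then show ?thesis unfolding path_prod_def by (intro keys_sum_subset)
qed

lemma path_one_mult:
  assumes "(u, p, v) \<in> paths G"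
  shows "path_prod (\<Sum>v\<in>verts G. Poly_Mapping.single (v, [], v) 1) (Poly_Mapping.single (u, p, v) c) =
      Poly_Mapping.single (u, p, v) c"
    "path_prod (Poly_Mapping.single (u, p, v) c) (\<Sum>v\<in>verts G. Poly_Mapping.single (v, [], v) 1) =
      Poly_Mapping.single (u, p, v) c"
proof -
  have "u \<in> verts G" "v \<in> verts G" using assms by (auto simp: paths_def dest: awalk_hd_in_verts awalk_last_in_verts)
  then show "path_prod (\<Sum>v\<in>verts G. Poly_Mapping.single (v, [], v) 1) (Poly_Mapping.single (u, p, v) c) =
      Poly_Mapping.single (u, p, v) c"
    "path_prod (Poly_Mapping.single (u, p, v) c) (\<Sum>v\<in>verts G. Poly_Mapping.single (v, [], v) 1) =
      Poly_Mapping.single (u, p, v) c"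
    by (simp_all add: path_prod_sum_left path_prod_sum_right path_prod_single path_scale_simps
      if_distrib[of "path_scale c"] cong: if_cong)
qed

lemma complex_algebra_path_algebra: "complex_algebra (path_algebra G)"
proof (rule complex_algebraI)
  \<comment> \<open>The unit law fails for triples that are not paths, so f is expanded over its own
    keys instead of by the additive induction over all singles.\<close>
  have one: "path_prod \<one>\<^bsub>path_algebra G\<^esub> f = f \<and> path_prod f \<one>\<^bsub>path_algebra G\<^esub> = f"
    if "Poly_Mapping.keys f \<subseteq> paths G" for f
  proof -
    have "path_prod \<one>\<^bsub>path_algebra G\<^esub> (Poly_Mapping.single k c) = Poly_Mapping.single k c \<and>
      path_prod (Poly_Mapping.single k c) \<one>\<^bsub>path_algebra G\<^esub> = Poly_Mapping.single k c"
      if "k \<in> Poly_Mapping.keys f" for k c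
      using path_one_mult[of "fst k" "fst (snd k)" "snd (snd k)" c] that \<open>Poly_Mapping.keys f \<subseteq> paths G\<close>
      by auto
    then have "path_prod \<one>\<^bsub>path_algebra G\<^esub> (\<Sum>k\<in>Poly_Mapping.keys f. Poly_Mapping.single k (Poly_Mapping.lookup f k)) =
        (\<Sum>k\<in>Poly_Mapping.keys f. Poly_Mapping.single k (Poly_Mapping.lookup f k)) \<and>
      path_prod (\<Sum>k\<in>Poly_Mapping.keys f. Poly_Mapping.single k (Poly_Mapping.lookup f k)) \<one>\<^bsub>path_algebra G\<^esub> =
        (\<Sum>k\<in>Poly_Mapping.keys f. Poly_Mapping.single k (Poly_Mapping.lookup f k))"
      unfolding path_prod_sum_right[of \<open>\<one>\<^bsub>path_algebra G\<^esub>\<close>] path_prod_sum_left[of _ _ \<open>\<one>\<^bsub>path_algebra G\<^esub>\<close>]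
      by (intro conjI sum.cong refl) blast+
    then show ?thesis unfolding poly_mapping_sum_single[of f, symmetric] .
  qed
  have vert: "(v, [], v) \<in> paths G" if "v \<in> verts G" for v
    using that by (simp add: paths_def awalk_Nil_iff)
  show "ring (path_algebra G)"
  proof (rule ringI)
    show "abelian_group (path_algebra G)"
    proof (rule abelian_groupI)
      fix f assume "f \<in> carrier (path_algebra G)"
      then show "\<exists>g\<in>carrier (path_algebra G). g \<oplus>\<^bsub>path_algebra G\<^esub> f = \<zero>\<^bsub>path_algebra G\<^esub>"
        by (intro bexI[of _ "- f"]) (auto simp: in_keys_iff)
    next
      fix f g assume "f \<in> carrier (path_algebra G)" "g \<in> carrier (path_algebra G)"
      then show "f \<oplus>\<^bsub>path_algebra G\<^esub> g \<in> carrier (path_algebra G)"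
        using Poly_Mapping.keys_add[of f g] by auto
    qed (simp_all add: add_ac)
    show "Group.monoid (path_algebra G)"
    proof (rule monoidI)
      show "\<one>\<^bsub>path_algebra G\<^esub> \<in> carrier (path_algebra G)"
        using vert by (simp add: keys_sum_subset)
    qed (use one path_prod_keys in \<open>simp_all add: path_prod_assoc\<close>)
  qed (simp_all add: path_prod_add_left path_prod_add_right)
qed (use keys_path_scale in \<open>fastforce simp: path_scale_simps path_prod_scale\<close>)+

end

text \<open>The first arrow of a path is the rightmost factor, as in \<open>path_mult\<close>.\<close>

fun path_mat :: "'i set \<Rightarrow> ('v \<Rightarrow> 'i \<Rightarrow> 'i \<Rightarrow> trunc) \<Rightarrow> ('a \<Rightarrow> 'i \<Rightarrow> 'i \<Rightarrow> trunc) \<Rightarrow>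
    'a list \<Rightarrow> 'v \<Rightarrow> 'i \<Rightarrow> 'i \<Rightarrow> trunc" where
  "path_mat I e g [] v = e v"
| "path_mat I e g (b # p) v = mmul I (path_mat I e g p v) (g b)"

lemma mmul_zero: "mmul I (\<lambda>i j. 0) A = (\<lambda>i j. 0)" "mmul I A (\<lambda>i j. 0) = (\<lambda>i j. 0)"
  by (simp_all add: mmul_def)

text \<open>Multiplicativity of \<Phi> is required only on the supports of f and g, because products
  of arrow matrices respect \<open>path_mult\<close> only for genuine paths of the quiver.\<close>

lemma lin_ext_mult_keys:
  assumes "\<And>p q. p \<in> Poly_Mapping.keys f \<Longrightarrow> q \<in> Poly_Mapping.keys g \<Longrightarrow>
      lin_ext (\<lambda>r. \<Phi> r i j) (path_mult p q) = mmul I (\<Phi> p) (\<Phi> q) i j"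
  shows "lin_ext (\<lambda>r. \<Phi> r i j) (path_prod f g) =
    mmul I (\<lambda>i j. lin_ext (\<lambda>r. \<Phi> r i j) f) (\<lambda>i j. lin_ext (\<lambda>r. \<Phi> r i j) g) i j"
proof -
  have "lin_ext (\<lambda>r. \<Phi> r i j) (path_prod f g) =
      (\<Sum>p\<in>Poly_Mapping.keys f. \<Sum>q\<in>Poly_Mapping.keys g.
        tconst (Poly_Mapping.lookup f p * Poly_Mapping.lookup g q) * mmul I (\<Phi> p) (\<Phi> q) i j)"
    unfolding path_prod_def lin_ext_sum lin_ext_path_scale
    by (intro sum.cong refl) (simp add: assms)
  also have "\<dots> = (\<Sum>p\<in>Poly_Mapping.keys f. \<Sum>q\<in>Poly_Mapping.keys g. \<Sum>k\<in>I.
      (tconst (Poly_Mapping.lookup f p) * \<Phi> p i k) * (tconst (Poly_Mapping.lookup g q) * \<Phi> q k j))"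
    by (simp add: mmul_def sum_distrib_left tconst_hom mult_ac)
  also have "\<dots> = (\<Sum>p\<in>Poly_Mapping.keys f. \<Sum>k\<in>I. \<Sum>q\<in>Poly_Mapping.keys g.
      (tconst (Poly_Mapping.lookup f p) * \<Phi> p i k) * (tconst (Poly_Mapping.lookup g q) * \<Phi> q k j))"
    by (intro sum.cong refl sum.swap)
  also have "\<dots> = (\<Sum>k\<in>I. \<Sum>p\<in>Poly_Mapping.keys f. \<Sum>q\<in>Poly_Mapping.keys g.
      (tconst (Poly_Mapping.lookup f p) * \<Phi> p i k) * (tconst (Poly_Mapping.lookup g q) * \<Phi> q k j))"
    by (rule sum.swap)
  also have "\<dots> = mmul I (\<lambda>i j. lin_ext (\<lambda>r. \<Phi> r i j) f) (\<lambda>i j. lin_ext (\<lambda>r. \<Phi> r i j) g) i j"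
    unfolding mmul_def lin_ext_def sum_product ..
  finally show ?thesis .
qed

text \<open>A path goes to the product of the matrices of its arrows, the empty path at v to
  \<open>e v\<close>. Inserting the idempotents at the ends of two paths shows that the product
  vanishes when they do not compose, which matches the zero in \<open>path_mult\<close>.\<close>

lemma (in fin_digraph) path_algebra_universal:
  assumes I: "finite I"
    and e_supp: "\<And>v. v \<in> verts G \<Longrightarrow> e v \<in> msupp I"
    and g_supp: "\<And>b. b \<in> arcs G \<Longrightarrow> g b \<in> msupp I"
    and e_idem: "\<And>v. v \<in> verts G \<Longrightarrow> mmul I (e v) (e v) = e v"
    and e_orth: "\<And>v w. v \<in> verts G \<Longrightarrow> w \<in> verts G \<Longrightarrow> v \<noteq> w \<Longrightarrow> mmul I (e v) (e w) = (\<lambda>i j. 0)"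
    and e_sum: "\<And>i j. (\<Sum>v\<in>verts G. e v i j) = mid I i j"
    and g_head: "\<And>b. b \<in> arcs G \<Longrightarrow> mmul I (e (head G b)) (g b) = g b"
    and g_tail: "\<And>b. b \<in> arcs G \<Longrightarrow> mmul I (g b) (e (tail G b)) = g b"
  obtains F where "F \<in> alg_hom (path_algebra G) (trunc_mat_algebra I)"
    "\<And>v. v \<in> verts G \<Longrightarrow> F (vertex_elt v) = e v"
    "\<And>b. b \<in> arcs G \<Longrightarrow> F (arrow_elt G b) = g b"
proof -
  let ?P = "path_mat I e g"
  have supp: "?P p v \<in> msupp I" if "awalk u p v" for u p v
    using that
  proof (induction p arbitrary: u)
    case (Cons b p)
    then show ?case using g_supp by (auto simp: awalk_Cons_iff intro: msupp_mmul)
  qed (simp add: awalk_Nil_iff e_supp)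
  have right: "mmul I (?P p v) (e u) = ?P p v" if "awalk u p v" for u p v
    using that by (cases p) (auto simp: awalk_Nil_iff awalk_Cons_iff e_idem mmul_assoc g_tail)
  have left: "mmul I (e v) (?P p v) = ?P p v" if "awalk u p v" for u p v
    using that
  proof (induction p arbitrary: u)
    case (Cons b p)
    then show ?case by (auto simp: awalk_Cons_iff mmul_assoc[symmetric])
  qed (simp add: awalk_Nil_iff e_idem)
  have app: "?P (q @ p) v = mmul I (?P p v) (?P q u)" if "awalk u p v" "awalk u' q u" for u u' v p q
    using that(2)
  proof (induction q arbitrary: u')
    case Nil
    then show ?case using right[OF that(1)] by (simp add: awalk_Nil_iff)
  next
    case (Cons b q)
    then show ?case by (auto simp: awalk_Cons_iff mmul_assoc)
  qed
  have orth: "mmul I (?P p v) (?P q v') = (\<lambda>i j. 0)"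
    if p: "awalk u p v" and q: "awalk u' q v'" and "v' \<noteq> u" for u u' v v' p q
  proof -
    have "mmul I (?P p v) (?P q v') = mmul I (mmul I (?P p v) (e u)) (mmul I (e v') (?P q v'))"
      using right[OF p] left[OF q] by simp
    also have "\<dots> = mmul I (?P p v) (mmul I (mmul I (e u) (e v')) (?P q v'))"
      by (simp add: mmul_assoc)
    also have "\<dots> = (\<lambda>i j. 0)"
      using e_orth[of u v'] awalk_hd_in_verts[OF p] awalk_last_in_verts[OF q] that(3)
      by (simp add: mmul_zero)
    finally show ?thesis .
  qed
  define \<Phi> where "\<Phi> r = ?P (fst (snd r)) (snd (snd r))" for r :: "('a, 'b) path"
  define F where "F f = (\<lambda>i j. lin_ext (\<lambda>r. \<Phi> r i j) f)" for f
  have \<Phi>_mult: "lin_ext (\<lambda>r. \<Phi> r i j) (path_mult p q) = mmul I (\<Phi> p) (\<Phi> q) i j"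
    if "p \<in> paths G" "q \<in> paths G" for p q i j
  proof -
    obtain u x v u' y v' where pq: "p = (u, x, v)" "q = (u', y, v')"
      by (metis prod_cases3)
    with that have "awalk u x v" "awalk u' y v'" by (auto simp: paths_def)
    then show ?thesis
      using app[of u x v u' y] orth[of u x v u' y v']
      by (cases "v' = u") (simp_all add: pq lin_ext_single lin_ext_zero tconst_hom \<Phi>_def)
  qed
  have F: "F \<in> alg_hom (path_algebra G) (trunc_mat_algebra I)"
  proof (rule alg_homI)
    fix f assume f: "f \<in> carrier (path_algebra G)"
    have "\<Phi> r \<in> msupp I" if "r \<in> Poly_Mapping.keys f" for r
    proof -
      have "r \<in> paths G" using f that by auto
      then show ?thesis by (cases r) (auto simp: paths_def \<Phi>_def intro: supp)
    qed
    then have "\<Phi> r i j = 0" if "r \<in> Poly_Mapping.keys f" "i \<notin> I \<or> j \<notin> I" for r i j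
      using that msuppD by metis
    then show "F f \<in> carrier (trunc_mat_algebra I)"
      unfolding trunc_mat_algebra_simps F_def lin_ext_def
      by (intro msuppI sum.neutral ballI) simp
    show "F (c \<odot>\<^bsub>path_algebra G\<^esub> f) = c \<odot>\<^bsub>trunc_mat_algebra I\<^esub> F f" for c
      by (simp add: F_def lin_ext_path_scale)
  next
    fix f g assume fg: "f \<in> carrier (path_algebra G)" "g \<in> carrier (path_algebra G)"
    show "F (f \<oplus>\<^bsub>path_algebra G\<^esub> g) = F f \<oplus>\<^bsub>trunc_mat_algebra I\<^esub> F g"
      by (simp add: F_def lin_ext_add)
    have "F (path_prod f g) i j = mmul I (F f) (F g) i j" for i j
      unfolding F_def by (rule lin_ext_mult_keys) (use fg in \<open>auto intro!: \<Phi>_mult\<close>)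
    then show "F (f \<otimes>\<^bsub>path_algebra G\<^esub> g) = F f \<otimes>\<^bsub>trunc_mat_algebra I\<^esub> F g"
      by (simp add: fun_eq_iff)
  next
    show "F \<one>\<^bsub>path_algebra G\<^esub> = \<one>\<^bsub>trunc_mat_algebra I\<^esub>"
      by (simp add: F_def fun_eq_iff lin_ext_sum lin_ext_single \<Phi>_def tconst_hom e_sum)
  qed
  show thesis
  proof (rule that[OF F])
    show "F (vertex_elt v) = e v" if "v \<in> verts G" for v
      by (simp add: F_def vertex_elt_def lin_ext_single tconst_hom \<Phi>_def)
    show "F (arrow_elt G b) = g b" if "b \<in> arcs G" for b
      by (simp add: F_def arrow_elt_def lin_ext_single tconst_hom \<Phi>_def g_head[OF that])
  qed
qed

section \<open>Polynomial algebras\<close>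

definition monom_eval :: "('x \<Rightarrow> trunc) \<Rightarrow> ('x \<Rightarrow>\<^sub>0 nat) \<Rightarrow> trunc" where
  "monom_eval \<rho> m = (\<Prod>x\<in>Poly_Mapping.keys m. \<rho> x ^ Poly_Mapping.lookup m x)"

lemma monom_eval_superset:
  assumes "finite S" "Poly_Mapping.keys m \<subseteq> S"
  shows "monom_eval \<rho> m = (\<Prod>x\<in>S. \<rho> x ^ Poly_Mapping.lookup m x)"
  unfolding monom_eval_def
  by (rule prod.mono_neutral_left) (use assms in \<open>auto simp: in_keys_iff\<close>)

lemma monom_eval_add: "monom_eval \<rho> (m + n) = monom_eval \<rho> m * monom_eval \<rho> n"
proof -
  let ?S = "Poly_Mapping.keys m \<union> Poly_Mapping.keys n"
  have "monom_eval \<rho> (m + n) = (\<Prod>x\<in>?S. \<rho> x ^ Poly_Mapping.lookup (m + n) x)"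
    by (rule monom_eval_superset) (use Poly_Mapping.keys_add[of m n] in auto)
  also have "\<dots> = monom_eval \<rho> m * monom_eval \<rho> n"
    by (simp add: monom_eval_superset[of ?S] lookup_add power_add prod.distrib)
  finally show ?thesis .
qed

definition poly_eval :: "('x \<Rightarrow> trunc) \<Rightarrow> 'x mpoly \<Rightarrow> trunc" where
  "poly_eval \<rho> = lin_ext (monom_eval \<rho>)"

lemma poly_eval_add: "poly_eval \<rho> (f + g) = poly_eval \<rho> f + poly_eval \<rho> g"
  by (simp add: poly_eval_def lin_ext_add)

lemma poly_eval_mult: "poly_eval \<rho> (f * g) = poly_eval \<rho> f * poly_eval \<rho> g"
proof (induction f rule: poly_mapping_add_induct)
  case (single m a)
  show ?case
    by (induction g rule: poly_mapping_add_induct)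
      (simp_all add: poly_eval_def mult_single lin_ext_single lin_ext_add monom_eval_add
        tconst_hom algebra_simps)
qed (simp_all add: poly_eval_add algebra_simps)

lemma poly_eval_simps:
  "poly_eval \<rho> (mvar x) = \<rho> x" "poly_eval \<rho> (mconst c) = tconst c" "poly_eval \<rho> 1 = 1"
  "poly_eval \<rho> 0 = 0"
  by (simp_all add: poly_eval_def mvar_def mconst_def lin_ext_single lin_ext_zero monom_eval_def
    tconst_hom flip: single_one)

lemma polynomial_algebra_simps [simp]:
  "carrier (polynomial_algebra S) = {f. \<forall>m\<in>Poly_Mapping.keys f. Poly_Mapping.keys m \<subseteq> S}"
  "f \<otimes>\<^bsub>polynomial_algebra S\<^esub> g = f * g"
  "\<one>\<^bsub>polynomial_algebra S\<^esub> = 1"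
  "\<zero>\<^bsub>polynomial_algebra S\<^esub> = 0"
  "f \<oplus>\<^bsub>polynomial_algebra S\<^esub> g = f + g"
  "c \<odot>\<^bsub>polynomial_algebra S\<^esub> f = mconst c * f"
  by (simp_all add: polynomial_algebra_def)

lemma polynomial_algebra_closed:
  "f \<in> carrier (polynomial_algebra S) \<Longrightarrow> g \<in> carrier (polynomial_algebra S) \<Longrightarrow> f * g \<in> carrier (polynomial_algebra S)"
  "f \<in> carrier (polynomial_algebra S) \<Longrightarrow> g \<in> carrier (polynomial_algebra S) \<Longrightarrow> f + g \<in> carrier (polynomial_algebra S)"
  "f \<in> carrier (polynomial_algebra S) \<Longrightarrow> g \<in> carrier (polynomial_algebra S) \<Longrightarrow> f - g \<in> carrier (polynomial_algebra S)"
  "f \<in> carrier (polynomial_algebra S) \<Longrightarrow> - f \<in> carrier (polynomial_algebra S)"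
  "0 \<in> carrier (polynomial_algebra S)" "1 \<in> carrier (polynomial_algebra S)"
  "mconst c \<in> carrier (polynomial_algebra S)"
  "x \<in> S \<Longrightarrow> mvar x \<in> carrier (polynomial_algebra S)"
proof -
  show mult: "f * g \<in> carrier (polynomial_algebra S)"
    if "f \<in> carrier (polynomial_algebra S)" "g \<in> carrier (polynomial_algebra S)" for f g
  proof -
    have "Poly_Mapping.keys m \<subseteq> S" if m: "m \<in> Poly_Mapping.keys (f * g)" for m
    proof -
      obtain a b where "m = a + b" "a \<in> Poly_Mapping.keys f" "b \<in> Poly_Mapping.keys g"
        using subsetD[OF keys_mult m] by blast
      then show ?thesis
        using Poly_Mapping.keys_add[of a b] \<open>f \<in> _\<close> \<open>g \<in> _\<close> by auto
    qed
    then show ?thesis by simp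
  qed
  show add: "f + g \<in> carrier (polynomial_algebra S)"
    if "f \<in> carrier (polynomial_algebra S)" "g \<in> carrier (polynomial_algebra S)" for f g
    using that Poly_Mapping.keys_add[of f g] by auto
  show neg: "- f \<in> carrier (polynomial_algebra S)"
    if "f \<in> carrier (polynomial_algebra S)" for f
    using that by (auto simp: in_keys_iff)
  show "f - g \<in> carrier (polynomial_algebra S)"
    if "f \<in> carrier (polynomial_algebra S)" "g \<in> carrier (polynomial_algebra S)" for f g
    using add[OF that(1) neg[OF that(2)]] by simp
  show "0 \<in> carrier (polynomial_algebra S)" "1 \<in> carrier (polynomial_algebra S)"
    "mconst c \<in> carrier (polynomial_algebra S)"
    by (auto simp: mconst_def)
  show "mvar x \<in> carrier (polynomial_algebra S)" if "x \<in> S"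
    using that by (auto simp: mvar_def)
qed

lemma polynomial_algebra_sum_closed:
  "(\<And>s. s \<in> T \<Longrightarrow> f s \<in> carrier (polynomial_algebra S)) \<Longrightarrow> (\<Sum>s\<in>T. f s) \<in> carrier (polynomial_algebra S)"
  by (induction T rule: infinite_finite_induct)
    (auto simp del: polynomial_algebra_simps(1) intro!: polynomial_algebra_closed)

lemma complex_algebra_polynomial_algebra: "complex_algebra (polynomial_algebra S)"
proof (rule complex_algebraI)
  show "ring (polynomial_algebra S)"
  proof (rule ringI)
    show "abelian_group (polynomial_algebra S)"
    proof (rule abelian_groupI)
      fix f assume "f \<in> carrier (polynomial_algebra S)"
      then show "\<exists>g\<in>carrier (polynomial_algebra S). g \<oplus>\<^bsub>polynomial_algebra S\<^esub> f = \<zero>\<^bsub>polynomial_algebra S\<^esub>"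
        by (intro bexI[of _ "- f"] polynomial_algebra_closed) simp
    qed (simp_all add: polynomial_algebra_closed add_ac del: polynomial_algebra_simps(1))
    show "Group.monoid (polynomial_algebra S)"
      by (rule monoidI) (simp_all add: polynomial_algebra_closed mult.assoc del: polynomial_algebra_simps(1))
  qed (simp_all add: algebra_simps)
  show "c \<odot>\<^bsub>polynomial_algebra S\<^esub> f \<in> carrier (polynomial_algebra S)"
    if "f \<in> carrier (polynomial_algebra S)" for c f
    using that by (simp add: polynomial_algebra_closed del: polynomial_algebra_simps(1))
qed (simp_all add: mconst_def algebra_simps single_add mult_single flip: mult.assoc)

text \<open>The commutative test algebra of truncated polynomials is encoded as the algebra of
  \<open>1 \<times> 1\<close> matrices.\<close>

lemma poly_eval_alg_hom:
  "(\<lambda>f i j. poly_eval \<rho> f) \<in> alg_hom (polynomial_algebra S) (trunc_mat_algebra {()})"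
  by (rule alg_homI)
    (simp_all add: poly_eval_mult poly_eval_add poly_eval_simps mmul_def mid_def msupp_def)

section \<open>Representations on the total space\<close>

abbreviation "dhead Q \<equiv> head (double_quiver Q)"
abbreviation "dtail Q \<equiv> tail (double_quiver Q)"

lemma double_quiver_simps [simp]:
  "verts (double_quiver Q) = verts Q" "arcs (double_quiver Q) = arcs Q <+> arcs Q"
  "dtail Q (Inl a) = tail Q a" "dtail Q (Inr a) = head Q a"
  "dhead Q (Inl a) = head Q a" "dhead Q (Inr a) = tail Q a"
  by (simp_all add: double_quiver_def)

definition total_idx :: "('v, 'a) pre_digraph \<Rightarrow> ('v \<Rightarrow> nat) \<Rightarrow> ('v \<times> nat) set" where
  "total_idx Q \<beta> = (SIGMA v:verts Q. {..<\<beta> v})"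

text \<open>A representation of the double quiver is encoded by matrices indexed by a basis of the total
  space \<open>\<Oplus>\<^sub>v \<complex>\<^bsup>\<beta> v\<^esup>\<close>, each supported in its block.\<close>

definition total_rep :: "('v, 'a) pre_digraph \<Rightarrow> ('v \<Rightarrow> nat) \<Rightarrow>
    ('a + 'a \<Rightarrow> 'v \<times> nat \<Rightarrow> 'v \<times> nat \<Rightarrow> 'r::zero) \<Rightarrow> bool" where
  "total_rep Q \<beta> X \<longleftrightarrow> (\<forall>b\<in>arcs Q <+> arcs Q. \<forall>i j. X b i j \<noteq> 0 \<longrightarrow>
     i \<in> total_idx Q \<beta> \<and> j \<in> total_idx Q \<beta> \<and> fst i = dhead Q b \<and> fst j = dtail Q b)"

text \<open>The polarised moment map: \<open>moment X X\<close> is \<open>\<Sum>\<^sub>a [X\<^sub>a, X\<^sub>a\<^sub>*]\<close>, and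
  \<open>moment V X + moment X V\<close> is its differential at \<open>V\<close> in the direction \<open>X\<close>.\<close>

definition moment :: "('v, 'a) pre_digraph \<Rightarrow> ('v \<Rightarrow> nat) \<Rightarrow>
    ('a + 'a \<Rightarrow> 'v \<times> nat \<Rightarrow> 'v \<times> nat \<Rightarrow> 'r::comm_ring_1) \<Rightarrow>
    ('a + 'a \<Rightarrow> 'v \<times> nat \<Rightarrow> 'v \<times> nat \<Rightarrow> 'r) \<Rightarrow> 'v \<times> nat \<Rightarrow> 'v \<times> nat \<Rightarrow> 'r" where
  "moment Q \<beta> X Y i j = (\<Sum>a\<in>arcs Q. mmul (total_idx Q \<beta>) (X (Inl a)) (Y (Inr a)) i j
     - mmul (total_idx Q \<beta>) (X (Inr a)) (Y (Inl a)) i j)"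

text \<open>The trace form tr(AB).\<close>

definition mtr :: "'i set \<Rightarrow> ('i \<Rightarrow> 'i \<Rightarrow> 'r::comm_ring_1) \<Rightarrow> ('i \<Rightarrow> 'i \<Rightarrow> 'r) \<Rightarrow> 'r" where
  "mtr I A B = (\<Sum>i\<in>I. \<Sum>j\<in>I. A i j * B j i)"

lemma finite_total_idx: "fin_digraph Q \<Longrightarrow> finite (total_idx Q \<beta>)"
  by (simp add: total_idx_def fin_digraph.finite_verts)

lemma sum_total_idx:
  assumes "fin_digraph Q"
  shows "(\<Sum>i\<in>total_idx Q \<beta>. f i) = (\<Sum>v\<in>verts Q. \<Sum>k<\<beta> v. f (v, k))"
  using assms by (simp add: total_idx_def fin_digraph.finite_verts sum.Sigma)

lemma sum_block:
  assumes Q: "fin_digraph Q" and v: "v \<in> verts Q" and f: "\<And>i. f i \<noteq> 0 \<Longrightarrow> fst i = v"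
  shows "(\<Sum>i\<in>total_idx Q \<beta>. f i) = (\<Sum>k<\<beta> v. f (v, k))"
proof -
  have "(\<Sum>w\<in>verts Q. \<Sum>k<\<beta> w. f (w, k)) = (\<Sum>w\<in>verts Q. if w = v then \<Sum>k<\<beta> v. f (v, k) else 0)"
    by (rule sum.cong) (use f in \<open>force intro!: sum.neutral\<close>)+
  then show ?thesis using v fin_digraph.finite_verts[OF Q] by (simp add: sum_total_idx[OF Q])
qed

lemma total_repD:
  assumes "total_rep Q \<beta> X" "b \<in> arcs Q <+> arcs Q" "X b i j \<noteq> 0"
  shows "i \<in> total_idx Q \<beta>" "j \<in> total_idx Q \<beta>" "fst i = dhead Q b" "fst j = dtail Q b"
  using assms unfolding total_rep_def by blast+

text \<open>Every summand goes along an arrow and back, so it preserves each vertex space. Hence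
  only pairs of basis vectors at one vertex carry equations.\<close>

lemma moment_off_diagonal:
  assumes X: "total_rep Q \<beta> X" and Y: "total_rep Q \<beta> Y"
    and "fst i \<noteq> fst j \<or> i \<notin> total_idx Q \<beta> \<or> j \<notin> total_idx Q \<beta>"
  shows "moment Q \<beta> X Y i j = 0"
proof -
  have "X (Inl a) i k * Y (Inr a) k j = 0" "X (Inr a) i k * Y (Inl a) k j = 0"
    if "a \<in> arcs Q" for a k
  proof -
    have "Inl a \<in> arcs Q <+> arcs Q" "Inr a \<in> arcs Q <+> arcs Q" using that by auto
    note b = this
    show "X (Inl a) i k * Y (Inr a) k j = 0"
      using total_repD[OF X b(1)] total_repD[OF Y b(2)] assms(3)
      by (metis double_quiver_simps(4-6) double_quiver_simps(5) mult_zero_left mult_zero_right)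
    show "X (Inr a) i k * Y (Inl a) k j = 0"
      using total_repD[OF X b(2)] total_repD[OF Y b(1)] assms(3)
      by (metis double_quiver_simps(3-6) mult_zero_left mult_zero_right)
  qed
  then show ?thesis by (simp add: moment_def mmul_def)
qed

text \<open>Crawley-Boevey's lifting criterion: the indecomposable representation extends because
  \<open>\<lambda>\<close> annihilates the traces of its endomorphisms.\<close>

lemma root_lifts_to_preprojective:
  assumes Q: "fin_digraph Q" and \<beta>: "\<beta> \<in> Delta_plus Q lam"
  obtains W where "total_rep Q \<beta> W"
    "\<And>i j. moment Q \<beta> W W i j = (if i = j \<and> i \<in> total_idx Q \<beta> then lam (fst i) else 0)"
proof -
  interpret fin_digraph Q by (rule Q)
  let ?I = "total_idx Q \<beta>"
  note finI = finite_total_idx[OF Q, of \<beta>]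
  from \<beta> obtain V where dv: "dimension_vector Q \<beta>" and V: "indecomposable_rep Q \<beta> V"
    and lam: "(\<Sum>v\<in>verts Q. lam v * of_nat (\<beta> v)) = 0"
    unfolding Delta_plus_def quiver_root_def by blast
  have Vc: "V a \<in> carrier_mat (\<beta> (head Q a)) (\<beta> (tail Q a))" if "a \<in> arcs Q" for a
    using V that unfolding indecomposable_rep_def quiver_rep_def by blast
  define T where "T a i j = (if i \<in> ?I \<and> j \<in> ?I \<and> fst i = head Q a \<and> fst j = tail Q a
     then V a $$ (snd i, snd j) else 0)" for a i j
  have T: "T a i j = 0" if "\<not> (i \<in> ?I \<and> j \<in> ?I \<and> fst i = head Q a \<and> fst j = tail Q a)" for a i j
    using that by (auto simp: T_def)
  \<comment> \<open>The matrix of the linear map x |-> sum_a [T_a, x_a] in the unknown entries x(a,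
    p, q) of the adjoined arrows; the equation (i, j) is the (i, j) entry, and b is the diagonal
    matrix of the \<lambda>_v.\<close>
  define c where "c = (\<lambda>(i, j) (a, p, q). (if q = j then T a i p else 0) - (if i = p then T a q j else 0))"
  define b where "b = (\<lambda>(i :: 'a \<times> nat, j). if i = j then lam (fst i) else 0)"
  have "\<exists>x. \<forall>e\<in>?I \<times> ?I. (\<Sum>r\<in>arcs Q \<times> ?I \<times> ?I. c e r * x r) = b e"
  proof (rule Fredholm_alternative)
    fix y assume y: "\<forall>r\<in>arcs Q \<times> ?I \<times> ?I. (\<Sum>e\<in>?I \<times> ?I. y e * c e r) = 0"
    have comm: "(\<Sum>i\<in>?I. y (i, q) * T a i p) = (\<Sum>j\<in>?I. T a q j * y (p, j))"
      if "a \<in> arcs Q" "p \<in> ?I" "q \<in> ?I" for a p q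
    proof -
      have "0 = (\<Sum>e\<in>?I \<times> ?I. y e * c e (a, p, q))" using y that by auto
      also have "\<dots> = (\<Sum>i\<in>?I. \<Sum>j\<in>?I. y (i, j) * c (i, j) (a, p, q))"
        by (simp add: sum.cartesian_product split_def)
      also have "\<dots> = (\<Sum>i\<in>?I. \<Sum>j\<in>?I. (if j = q then y (i, q) * T a i p else 0))
          - (\<Sum>i\<in>?I. \<Sum>j\<in>?I. (if i = p then T a q j * y (p, j) else 0))"
        unfolding sum_subtractf[symmetric]
        by (intro sum.cong refl) (auto simp: c_def algebra_simps)
      also have "(\<Sum>i\<in>?I. \<Sum>j\<in>?I. (if j = q then y (i, q) * T a i p else 0)) =
          (\<Sum>i\<in>?I. y (i, q) * T a i p)"
        using that finI by simp
      also have "(\<Sum>i\<in>?I. \<Sum>j\<in>?I. (if i = p then T a q j * y (p, j) else 0)) =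
          (\<Sum>j\<in>?I. T a q j * y (p, j))"
        using that finI by (subst sum.swap) simp
      finally show ?thesis by simp
    qed
    \<comment> \<open>Read transposed, \<open>comm\<close> says that the relation y commutes with
      all T_a, so its vertex blocks form an endomorphism of V. Blocks between different vertices are
      dropped.\<close>
    define Y where "Y v = mat (\<beta> v) (\<beta> v) (\<lambda>(k, l). y ((v, l), (v, k)))" for v
    obtain t where t: "\<And>v. v \<in> verts Q \<Longrightarrow> (\<Sum>k<\<beta> v. Y v $$ (k, k)) = t * of_nat (\<beta> v)"
    proof (rule indecomposable_endomorphism_trace[OF wf_digraph_axioms dv V, of Y])
      fix a assume a: "a \<in> arcs Q"
      let ?h = "head Q a" and ?t = "tail Q a"
      have hv: "?h \<in> verts Q" "?t \<in> verts Q" using a by auto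
      show "Y ?h * V a = V a * Y ?t"
      proof (rule eq_matI)
        fix k l assume "k < dim_row (V a * Y ?t)" "l < dim_col (V a * Y ?t)"
        then have kl: "k < \<beta> ?h" "l < \<beta> ?t" using Vc[OF a] by (auto simp: Y_def)
        have ind: "(?h, m) \<in> ?I \<longleftrightarrow> m < \<beta> ?h" "(?t, m) \<in> ?I \<longleftrightarrow> m < \<beta> ?t" for m
          using hv by (auto simp: total_idx_def)
        have "(Y ?h * V a) $$ (k, l) = (\<Sum>m<\<beta> ?h. y ((?h, m), (?h, k)) * V a $$ (m, l))"
          using kl Vc[OF a] by (auto simp: Y_def scalar_prod_def atLeast0LessThan intro!: sum.cong)
        also have "\<dots> = (\<Sum>m<\<beta> ?h. y ((?h, m), (?h, k)) * T a (?h, m) (?t, l))"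
          by (rule sum.cong) (use kl ind in \<open>auto simp: T_def\<close>)
        also have "\<dots> = (\<Sum>i\<in>?I. y (i, (?h, k)) * T a i (?t, l))"
          by (rule sum_block[symmetric, OF Q hv(1)]) (auto simp: T_def split: if_splits)
        also have "\<dots> = (\<Sum>j\<in>?I. T a (?h, k) j * y ((?t, l), j))"
          by (rule comm[OF a]) (use kl ind in auto)
        also have "\<dots> = (\<Sum>m<\<beta> ?t. T a (?h, k) (?t, m) * y ((?t, l), (?t, m)))"
          by (rule sum_block[OF Q hv(2)]) (auto simp: T_def split: if_splits)
        also have "\<dots> = (\<Sum>m<\<beta> ?t. V a $$ (k, m) * y ((?t, l), (?t, m)))"
          by (rule sum.cong) (use kl ind in \<open>auto simp: T_def\<close>)
        also have "\<dots> = (V a * Y ?t) $$ (k, l)"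
          using kl Vc[OF a] by (auto simp: Y_def scalar_prod_def atLeast0LessThan intro!: sum.cong)
        finally show "(Y ?h * V a) $$ (k, l) = (V a * Y ?t) $$ (k, l)" .
      qed (use Vc[OF a] in \<open>auto simp: Y_def\<close>)
    qed (auto simp: Y_def)
    \<comment> \<open>Pairing y with the right-hand side gives sum_v \<lambda>_v tr Y_v. As tr Y_v =
      t \<beta>(v), this is t times sum_v \<lambda>_v \<beta>(v), which is 0.\<close>
    have "(\<Sum>e\<in>?I \<times> ?I. y e * b e) = (\<Sum>i\<in>?I. \<Sum>j\<in>?I. if j = i then y (i, i) * lam (fst i) else 0)"
      by (simp add: sum.cartesian_product split_def b_def) (auto intro!: sum.cong)
    also have "\<dots> = (\<Sum>i\<in>?I. y (i, i) * lam (fst i))" using finI by simp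
    also have "\<dots> = (\<Sum>v\<in>verts Q. lam v * (\<Sum>k<\<beta> v. Y v $$ (k, k)))"
      by (simp add: sum_total_idx[OF Q] sum_distrib_left Y_def mult.commute)
    also have "\<dots> = t * (\<Sum>v\<in>verts Q. lam v * of_nat (\<beta> v))"
      by (simp add: t sum_distrib_left mult_ac)
    finally show "(\<Sum>e\<in>?I \<times> ?I. y e * b e) = 0" using lam by simp
  qed (use finI in auto)
  then obtain x where x: "\<And>i j. i \<in> ?I \<Longrightarrow> j \<in> ?I \<Longrightarrow>
      (\<Sum>r\<in>arcs Q \<times> ?I \<times> ?I. c (i, j) r * x r) = (if i = j then lam (fst i) else 0)"
    by (force simp: b_def)
  \<comment> \<open>Entries of x outside the block from head to tail are cut off. In an equation for
    i, j over the same vertex they only meet zero entries of T, so the equation is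
    unaffected.\<close>
  define W where "W = case_sum T (\<lambda>a i j. if i \<in> ?I \<and> j \<in> ?I \<and> fst i = tail Q a \<and> fst j = head Q a
     then x (a, i, j) else 0)"
  have W: "total_rep Q \<beta> W"
    unfolding total_rep_def W_def by (auto simp: T_def split: if_splits)
  have "moment Q \<beta> W W i j = (if i = j then lam (fst i) else 0)"
    if ij: "i \<in> ?I" "j \<in> ?I" "fst i = fst j" for i j
  proof -
    have "(\<Sum>r\<in>arcs Q \<times> ?I \<times> ?I. c (i, j) r * x r) =
        (\<Sum>a\<in>arcs Q. (\<Sum>p\<in>?I. \<Sum>q\<in>?I. c (i, j) (a, p, q) * x (a, p, q)))"
      by (simp add: sum.cartesian_product split_def)
    also have "\<dots> = (\<Sum>a\<in>arcs Q. (\<Sum>p\<in>?I. T a i p * x (a, p, j)) - (\<Sum>q\<in>?I. x (a, i, q) * T a q j))"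
    proof (rule sum.cong[OF refl])
      fix a
      have "(\<Sum>p\<in>?I. \<Sum>q\<in>?I. c (i, j) (a, p, q) * x (a, p, q)) =
          (\<Sum>p\<in>?I. \<Sum>q\<in>?I. if q = j then T a i p * x (a, p, j) else 0)
          - (\<Sum>p\<in>?I. \<Sum>q\<in>?I. if p = i then x (a, i, q) * T a q j else 0)"
        unfolding sum_subtractf[symmetric]
        by (intro sum.cong refl) (auto simp: c_def algebra_simps)
      also have "(\<Sum>p\<in>?I. \<Sum>q\<in>?I. if p = i then x (a, i, q) * T a q j else 0) =
          (\<Sum>q\<in>?I. x (a, i, q) * T a q j)"
        using ij finI by (subst sum.swap) simp
      also have "(\<Sum>p\<in>?I. \<Sum>q\<in>?I. if q = j then T a i p * x (a, p, j) else 0) =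
          (\<Sum>p\<in>?I. T a i p * x (a, p, j))"
        using ij finI by simp
      finally show "(\<Sum>p\<in>?I. \<Sum>q\<in>?I. c (i, j) (a, p, q) * x (a, p, q)) =
        (\<Sum>p\<in>?I. T a i p * x (a, p, j)) - (\<Sum>q\<in>?I. x (a, i, q) * T a q j)" .
    qed
    also have "\<dots> = moment Q \<beta> W W i j"
      unfolding moment_def mmul_def W_def
      by (intro sum.cong refl arg_cong2[of _ _ _ _ "(-)"]) (use ij in \<open>auto simp: T_def\<close>)
    finally show ?thesis using x[OF ij(1,2)] by simp
  qed
  then show thesis
    using moment_off_diagonal[OF W W] by (intro that[OF W]) (metis (full_types))
qed

text \<open>The first sum is the number of moment map equations, the second is half the dimension of
  the representation space of the double quiver. In this form q < 0 is the inequality of the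
  dimension count.\<close>

lemma tits_form_eq:
  assumes Q: "fin_digraph Q"
  shows "tits_form Q \<beta> = (\<Sum>v\<in>verts Q. int (\<beta> v) * int (\<beta> v))
     - (\<Sum>a\<in>arcs Q. int (\<beta> (tail Q a)) * int (\<beta> (head Q a)))"
proof -
  interpret fin_digraph Q by (rule Q)
  have "(\<Sum>i\<in>verts Q. \<Sum>j\<in>verts Q. int (\<beta> i) * int (card {a \<in> arcs Q. tail Q a = i \<and> head Q a = j}) * int (\<beta> j))
      = (\<Sum>i\<in>verts Q. \<Sum>j\<in>verts Q. \<Sum>a\<in>arcs Q. if tail Q a = i then if head Q a = j then int (\<beta> i) * int (\<beta> j) else 0 else 0)"
  proof (intro sum.cong refl)
    fix i j
    have "int (card {a \<in> arcs Q. tail Q a = i \<and> head Q a = j}) =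
        (\<Sum>a\<in>arcs Q. if tail Q a = i \<and> head Q a = j then 1 else 0)"
      by (simp add: sum.If_cases Int_def)
    then show "int (\<beta> i) * int (card {a \<in> arcs Q. tail Q a = i \<and> head Q a = j}) * int (\<beta> j) =
      (\<Sum>a\<in>arcs Q. if tail Q a = i then if head Q a = j then int (\<beta> i) * int (\<beta> j) else 0 else 0)"
      by (auto simp: sum_distrib_left sum_distrib_right intro!: sum.cong)
  qed
  also have "\<dots> = (\<Sum>i\<in>verts Q. \<Sum>a\<in>arcs Q. \<Sum>j\<in>verts Q. if tail Q a = i then if head Q a = j then int (\<beta> i) * int (\<beta> j) else 0 else 0)"
    by (intro sum.cong refl sum.swap)
  also have "\<dots> = (\<Sum>a\<in>arcs Q. \<Sum>i\<in>verts Q. \<Sum>j\<in>verts Q. if tail Q a = i then if head Q a = j then int (\<beta> i) * int (\<beta> j) else 0 else 0)"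
    by (rule sum.swap)
  also have "\<dots> = (\<Sum>a\<in>arcs Q. \<Sum>i\<in>verts Q. if tail Q a = i then int (\<beta> i) * int (\<beta> (head Q a)) else 0)"
    by (intro sum.cong refl) simp
  also have "\<dots> = (\<Sum>a\<in>arcs Q. int (\<beta> (tail Q a)) * int (\<beta> (head Q a)))"
    by (intro sum.cong refl) simp
  finally have arcs: "(\<Sum>i\<in>verts Q. \<Sum>j\<in>verts Q. int (\<beta> i) *
      int (card {a \<in> arcs Q. tail Q a = i \<and> head Q a = j}) * int (\<beta> j)) =
      (\<Sum>a\<in>arcs Q. int (\<beta> (tail Q a)) * int (\<beta> (head Q a)))" .
  have "tits_form Q \<beta> = (\<Sum>i\<in>verts Q. \<Sum>j\<in>verts Q. if i = j then int (\<beta> i) * int (\<beta> i) else 0) -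
    (\<Sum>i\<in>verts Q. \<Sum>j\<in>verts Q. int (\<beta> i) *
      int (card {a \<in> arcs Q. tail Q a = i \<and> head Q a = j}) * int (\<beta> j))"
    unfolding euler_form_def euler_matrix_def sum_subtractf[symmetric]
    by (intro sum.cong refl) (simp add: algebra_simps)
  then show ?thesis unfolding arcs by simp
qed

lemma tits_form_neg:
  assumes \<alpha>: "\<alpha> \<in> Sigma_set Q lam" and two: "(\<lambda>v. 2 * \<alpha> v) \<in> Sigma_set Q lam"
  shows "tits_form Q \<alpha> < 0"
proof -
  have "length [\<alpha>, \<alpha>] \<ge> 2 \<and> set [\<alpha>, \<alpha>] \<subseteq> Delta_plus Q lam \<and>
      (\<lambda>v. 2 * \<alpha> v) = (\<lambda>v. \<Sum>\<beta>\<leftarrow>[\<alpha>, \<alpha>]. \<beta> v)"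
    using \<alpha> by (auto simp: Sigma_set_def)
  with two have "1 - tits_form Q (\<lambda>v. 2 * \<alpha> v) > int (length [\<alpha>, \<alpha>]) - (\<Sum>\<beta>\<leftarrow>[\<alpha>, \<alpha>]. tits_form Q \<beta>)"
    unfolding Sigma_set_def by blast
  \<comment> \<open>With q = q(\<alpha>) the condition now reads 1 - 4 q > 2 - 2 q, that is 2 q <
    -1.\<close>
  moreover have "tits_form Q (\<lambda>v. 2 * \<alpha> v) = 4 * tits_form Q \<alpha>"
    by (simp add: euler_form_def sum_distrib_left mult_ac)
  ultimately show ?thesis by simp
qed

section \<open>Coordinates of the moment map and the kernel of its differential\<close>

definition arrow_coords :: "('v, 'a) pre_digraph \<Rightarrow> ('v \<Rightarrow> nat) \<Rightarrow> (('a + 'a) \<times> ('v \<times> nat) \<times> 'v \<times> nat) set" where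
  "arrow_coords Q \<beta> = (SIGMA b:arcs Q <+> arcs Q.
     ({dhead Q b} \<times> {..<\<beta> (dhead Q b)}) \<times> ({dtail Q b} \<times> {..<\<beta> (dtail Q b)}))"

text \<open>The entries of the product of the matrix algebras gl(\<beta> v), in which the moment map
  takes its values: one equation for each.\<close>

definition vertex_coords :: "('v, 'a) pre_digraph \<Rightarrow> ('v \<Rightarrow> nat) \<Rightarrow> (('v \<times> nat) \<times> 'v \<times> nat) set" where
  "vertex_coords Q \<beta> = (\<lambda>(v, i, j). ((v, i), (v, j))) ` (SIGMA v:verts Q. {..<\<beta> v} \<times> {..<\<beta> v})"

context fin_digraph
begin

lemma finite_arrow_coords: "finite (arrow_coords G \<beta>)"
  unfolding arrow_coords_def by (intro finite_SigmaI) auto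

lemma finite_vertex_coords: "finite (vertex_coords G \<beta>)"
  unfolding vertex_coords_def by (intro finite_imageI finite_SigmaI) auto

lemma card_arrow_coords: "card (arrow_coords G \<beta>) = 2 * (\<Sum>a\<in>arcs G. \<beta> (tail G a) * \<beta> (head G a))"
  unfolding arrow_coords_def
  by (subst card_SigmaI) (simp_all add: card_cartesian_product sum.Plus mult.commute)

lemma card_vertex_coords: "card (vertex_coords G \<beta>) = (\<Sum>v\<in>verts G. \<beta> v * \<beta> v)"
  unfolding vertex_coords_def
  by (subst card_image) (auto simp: inj_on_def card_SigmaI card_cartesian_product)

lemma arrow_coords_iff:
  "(b, p, q) \<in> arrow_coords G \<beta> \<longleftrightarrow> b \<in> arcs G <+> arcs G \<and> p \<in> total_idx G \<beta> \<and> q \<in> total_idx G \<beta> \<and>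
     fst p = dhead G b \<and> fst q = dtail G b"
  by (cases p; cases q) (auto simp: arrow_coords_def total_idx_def)

lemma vertex_coords_iff:
  "(i, j) \<in> vertex_coords G \<beta> \<longleftrightarrow> i \<in> total_idx G \<beta> \<and> j \<in> total_idx G \<beta> \<and> fst i = fst j"
  by (cases i; cases j) (force simp: vertex_coords_def total_idx_def)

lemma sum_arrow_coords:
  assumes "\<And>b p q. (b, p, q) \<notin> arrow_coords G \<beta> \<Longrightarrow> f (b, p, q) = 0"
  shows "(\<Sum>r\<in>arrow_coords G \<beta>. f r) =
    (\<Sum>a\<in>arcs G. (\<Sum>p\<in>total_idx G \<beta>. \<Sum>q\<in>total_idx G \<beta>. f (Inl a, p, q)) +
      (\<Sum>p\<in>total_idx G \<beta>. \<Sum>q\<in>total_idx G \<beta>. f (Inr a, p, q)))"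
proof -
  let ?I = "total_idx G \<beta>"
  have fin: "finite ?I" by (rule finite_total_idx[OF fin_digraph_axioms])
  have "(\<Sum>r\<in>arrow_coords G \<beta>. f r) = (\<Sum>r\<in>(arcs G <+> arcs G) \<times> ?I \<times> ?I. f r)"
  proof (rule sum.mono_neutral_left)
    show "finite ((arcs G <+> arcs G) \<times> ?I \<times> ?I)" using fin by simp
    show "arrow_coords G \<beta> \<subseteq> (arcs G <+> arcs G) \<times> ?I \<times> ?I"
      by (auto simp: arrow_coords_iff)
    show "\<forall>r\<in>(arcs G <+> arcs G) \<times> ?I \<times> ?I - arrow_coords G \<beta>. f r = 0"
      using assms by auto
  qed
  also have "\<dots> = (\<Sum>b\<in>arcs G <+> arcs G. \<Sum>p\<in>?I. \<Sum>q\<in>?I. f (b, p, q))"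
    by (simp add: sum.cartesian_product split_def)
  finally show ?thesis by (simp add: sum.Plus sum.distrib)
qed

text \<open>The last sum is the symplectic form \<omega>(x, y) on representations of the double
  quiver. The claim is \<open>solution_space_not_isotropic\<close> for the differential at W, with
  equations indexed by \<open>vertex_coords\<close> and unknowns by
  \<open>arrow_coords\<close>.\<close>

lemma moment_kernel_not_isotropic:
  fixes W :: "'b + 'b \<Rightarrow> 'a \<times> nat \<Rightarrow> 'a \<times> nat \<Rightarrow> complex"
  assumes W: "total_rep G \<alpha> W" and neg: "tits_form G \<alpha> < 0"
  obtains x y where "total_rep G \<alpha> x" "total_rep G \<alpha> y"
    "\<And>i j. moment G \<alpha> W x i j + moment G \<alpha> x W i j = 0"
    "\<And>i j. moment G \<alpha> W y i j + moment G \<alpha> y W i j = 0"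
    "(\<Sum>a\<in>arcs G. mtr (total_idx G \<alpha>) (x (Inl a)) (y (Inr a)) -
        mtr (total_idx G \<alpha>) (x (Inr a)) (y (Inl a))) \<noteq> 0"
proof -
  let ?I = "total_idx G \<alpha>" and ?R = "arrow_coords G \<alpha>"
  have fin: "finite ?I" by (rule finite_total_idx[OF fin_digraph_axioms])
  \<comment> \<open>The matrix of z |-> moment W z + moment z W; the two cases are the coefficients
    of an entry of an arrow a and of an entry of its adjoined arrow.\<close>
  define c :: "('a \<times> nat) \<times> 'a \<times> nat \<Rightarrow> ('b + 'b) \<times> ('a \<times> nat) \<times> 'a \<times> nat \<Rightarrow> complex"
    where "c = (\<lambda>(i, j) (b, p, q). case b of
      Inl a \<Rightarrow> (if i = p then W (Inr a) q j else 0) - (if q = j then W (Inr a) i p else 0)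
    | Inr a \<Rightarrow> (if q = j then W (Inl a) i p else 0) - (if i = p then W (Inl a) q j else 0))"
  \<comment> \<open>The coordinate dual to (b, p, q) under \<omega> is the transposed entry (q, p)
    of the opposite arrow. With the signs \<open>sg\<close>, the sum of
    \<open>sg r * x (op r) * y r\<close> is \<omega>(x, y).\<close>
  define op :: "('b + 'b) \<times> ('a \<times> nat) \<times> 'a \<times> nat \<Rightarrow> ('b + 'b) \<times> ('a \<times> nat) \<times> 'a \<times> nat"
    where "op = (\<lambda>(b, p, q). (case_sum Inr Inl b, q, p))"
  define sg :: "('b + 'b) \<times> ('a \<times> nat) \<times> 'a \<times> nat \<Rightarrow> complex"
    where "sg = (\<lambda>(b, p, q). case b of Inl _ \<Rightarrow> - 1 | Inr _ \<Rightarrow> 1)"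
  have "int (2 * card (vertex_coords G \<alpha>)) < int (card ?R)"
    using neg unfolding tits_form_eq[OF fin_digraph_axioms] card_arrow_coords card_vertex_coords
    by simp
  then have big: "2 * card (vertex_coords G \<alpha>) < card ?R" by simp
  obtain x y where xy: "\<And>e. e \<in> vertex_coords G \<alpha> \<Longrightarrow> (\<Sum>r\<in>?R. c e r * x r) = 0"
    "\<And>e. e \<in> vertex_coords G \<alpha> \<Longrightarrow> (\<Sum>r\<in>?R. c e r * y r) = 0"
    "\<And>r. r \<notin> ?R \<Longrightarrow> x r = 0" "\<And>r. r \<notin> ?R \<Longrightarrow> y r = 0"
    "(\<Sum>r\<in>?R. sg r * x (op r) * y r) \<noteq> 0"
  proof (rule solution_space_not_isotropic[where c = c, OF finite_arrow_coords finite_vertex_coords big])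
    show "op r \<in> ?R" "op (op r) = r" "sg r \<noteq> 0" if "r \<in> ?R" for r
      using that by (cases r; cases "fst r"; auto simp: arrow_coords_iff op_def sg_def)+
  qed blast
  define X where "X z b p q = z (b, p, q)" for z :: "('b + 'b) \<times> ('a \<times> nat) \<times> 'a \<times> nat \<Rightarrow> complex" and b p q
  have rep: "total_rep G \<alpha> (X z)" if "\<And>r. r \<notin> ?R \<Longrightarrow> z r = 0" for z
    unfolding total_rep_def X_def using that by (metis arrow_coords_iff)
  have ker: "moment G \<alpha> W (X z) i j + moment G \<alpha> (X z) W i j = 0"
    if z: "\<And>r. r \<notin> ?R \<Longrightarrow> z r = 0" and eq: "\<And>e. e \<in> vertex_coords G \<alpha> \<Longrightarrow> (\<Sum>r\<in>?R. c e r * z r) = 0"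
    for z i j
  proof (cases "(i, j) \<in> vertex_coords G \<alpha>")
    case False
    then have off: "fst i \<noteq> fst j \<or> i \<notin> ?I \<or> j \<notin> ?I" by (auto simp: vertex_coords_iff)
    show ?thesis
      using moment_off_diagonal[OF W rep[OF z] off] moment_off_diagonal[OF rep[OF z] W off] by simp
  next
    case True
    then have ij: "i \<in> ?I" "j \<in> ?I" by (auto simp: vertex_coords_iff)
    have pick: "(\<Sum>p\<in>?I. \<Sum>q\<in>?I. if i = p then f q else 0) = (\<Sum>q\<in>?I. f q)"
      for f :: "'a \<times> nat \<Rightarrow> complex"
      using ij fin by (subst sum.swap) simp
    have pick': "(\<Sum>p\<in>?I. \<Sum>q\<in>?I. if q = j then f p else 0) = (\<Sum>p\<in>?I. f p)"
      for f :: "'a \<times> nat \<Rightarrow> complex"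
      using ij fin by simp
    have "0 = (\<Sum>r\<in>?R. c (i, j) r * z r)" using eq[OF True] by simp
    also have "\<dots> = (\<Sum>a\<in>arcs G. (\<Sum>p\<in>?I. \<Sum>q\<in>?I. c (i, j) (Inl a, p, q) * z (Inl a, p, q)) +
      (\<Sum>p\<in>?I. \<Sum>q\<in>?I. c (i, j) (Inr a, p, q) * z (Inr a, p, q)))"
      by (rule sum_arrow_coords) (simp add: z)
    also have "\<dots> = (\<Sum>a\<in>arcs G.
        ((\<Sum>q\<in>?I. z (Inl a, i, q) * W (Inr a) q j) - (\<Sum>p\<in>?I. W (Inr a) i p * z (Inl a, p, j))) +
        ((\<Sum>p\<in>?I. W (Inl a) i p * z (Inr a, p, j)) - (\<Sum>q\<in>?I. z (Inr a, i, q) * W (Inl a) q j)))"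
    proof (intro sum.cong refl arg_cong2[of _ _ _ _ "(+)"])
      fix a
      have "(\<Sum>p\<in>?I. \<Sum>q\<in>?I. c (i, j) (Inl a, p, q) * z (Inl a, p, q)) =
          (\<Sum>p\<in>?I. \<Sum>q\<in>?I. if i = p then z (Inl a, i, q) * W (Inr a) q j else 0) -
          (\<Sum>p\<in>?I. \<Sum>q\<in>?I. if q = j then W (Inr a) i p * z (Inl a, p, j) else 0)"
        unfolding sum_subtractf[symmetric]
        by (intro sum.cong refl) (auto simp: c_def algebra_simps)
      then show "(\<Sum>p\<in>?I. \<Sum>q\<in>?I. c (i, j) (Inl a, p, q) * z (Inl a, p, q)) =
          (\<Sum>q\<in>?I. z (Inl a, i, q) * W (Inr a) q j) - (\<Sum>p\<in>?I. W (Inr a) i p * z (Inl a, p, j))"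
        unfolding pick pick' .
      have "(\<Sum>p\<in>?I. \<Sum>q\<in>?I. c (i, j) (Inr a, p, q) * z (Inr a, p, q)) =
          (\<Sum>p\<in>?I. \<Sum>q\<in>?I. if q = j then W (Inl a) i p * z (Inr a, p, j) else 0) -
          (\<Sum>p\<in>?I. \<Sum>q\<in>?I. if i = p then z (Inr a, i, q) * W (Inl a) q j else 0)"
        unfolding sum_subtractf[symmetric]
        by (intro sum.cong refl) (auto simp: c_def algebra_simps)
      then show "(\<Sum>p\<in>?I. \<Sum>q\<in>?I. c (i, j) (Inr a, p, q) * z (Inr a, p, q)) =
          (\<Sum>p\<in>?I. W (Inl a) i p * z (Inr a, p, j)) - (\<Sum>q\<in>?I. z (Inr a, i, q) * W (Inl a) q j)"
        unfolding pick pick' .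
    qed
    also have "\<dots> = moment G \<alpha> W (X z) i j + moment G \<alpha> (X z) W i j"
      unfolding moment_def mmul_def X_def sum.distrib[symmetric]
      by (intro sum.cong refl) simp
    finally show ?thesis by simp
  qed
  have "(\<Sum>r\<in>?R. sg r * x (op r) * y r) =
      (\<Sum>a\<in>arcs G. (\<Sum>p\<in>?I. \<Sum>q\<in>?I. - (x (Inr a, q, p) * y (Inl a, p, q))) +
         (\<Sum>p\<in>?I. \<Sum>q\<in>?I. x (Inl a, q, p) * y (Inr a, p, q)))"
    by (subst sum_arrow_coords) (simp_all add: xy(4) sg_def op_def)
  also have "\<dots> = (\<Sum>a\<in>arcs G. mtr ?I (X x (Inl a)) (X y (Inr a)) - mtr ?I (X x (Inr a)) (X y (Inl a)))"
  proof (rule sum.cong[OF refl])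
    fix a
    have "mtr ?I (X x b) (X y b') = (\<Sum>p\<in>?I. \<Sum>q\<in>?I. x (b, q, p) * y (b', p, q))" for b b'
      unfolding mtr_def X_def by (rule sum.swap)
    then show "(\<Sum>p\<in>?I. \<Sum>q\<in>?I. - (x (Inr a, q, p) * y (Inl a, p, q))) +
         (\<Sum>p\<in>?I. \<Sum>q\<in>?I. x (Inl a, q, p) * y (Inr a, p, q)) =
        mtr ?I (X x (Inl a)) (X y (Inr a)) - mtr ?I (X x (Inr a)) (X y (Inl a))"
      by (simp add: sum_negf)
  qed
  finally have "(\<Sum>a\<in>arcs G. mtr ?I (X x (Inl a)) (X y (Inr a)) - mtr ?I (X x (Inr a)) (X y (Inl a))) \<noteq> 0"
    using xy(5) by simp
  then show thesis
    using that[OF rep[OF xy(3)] rep[OF xy(4)] ker[OF xy(3,1)] ker[OF xy(4,2)]] by blast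
qed

end

section \<open>The obstruction to smoothness\<close>

text \<open>Two copies of the total space of dimension \<open>\<alpha>\<close> are interleaved in the one of dimension
  \<open>2\<alpha>\<close>: the even and the odd basis vectors at each vertex.\<close>

definition block2 :: "('v \<times> nat \<Rightarrow> 'v \<times> nat \<Rightarrow> 'r) \<Rightarrow> ('v \<times> nat \<Rightarrow> 'v \<times> nat \<Rightarrow> 'r) \<Rightarrow>
    ('v \<times> nat \<Rightarrow> 'v \<times> nat \<Rightarrow> 'r) \<Rightarrow> ('v \<times> nat \<Rightarrow> 'v \<times> nat \<Rightarrow> 'r) \<Rightarrow>
    'v \<times> nat \<Rightarrow> 'v \<times> nat \<Rightarrow> 'r" where
  "block2 A B C D p q =
     (if even (snd p) then (if even (snd q) then A else B) else (if even (snd q) then C else D))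
       (fst p, snd p div 2) (fst q, snd q div 2)"

abbreviation "zmat \<equiv> (\<lambda>_ _. 0)"

lemma half_total_idx: "(fst p, snd p div 2) \<in> total_idx Q \<alpha> \<longleftrightarrow> p \<in> total_idx Q (\<lambda>v. 2 * \<alpha> v)"
  by (cases p) (auto simp: total_idx_def)

lemma sum_lessThan_double: "(\<Sum>k<2 * n. f k) = (\<Sum>k<n. f (2 * k) + f (2 * k + 1))"
  for f :: "nat \<Rightarrow> 'a::comm_monoid_add"
  by (induction n) (simp_all add: add_ac)

lemma sum_total_idx_double:
  assumes "fin_digraph Q"
  shows "(\<Sum>p\<in>total_idx Q (\<lambda>v. 2 * \<alpha> v). f p) =
    (\<Sum>p\<in>total_idx Q \<alpha>. f (fst p, 2 * snd p) + f (fst p, 2 * snd p + 1))"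
  by (simp add: sum_total_idx[OF assms] sum_lessThan_double)

lemma mmul_block2:
  assumes "fin_digraph Q"
  shows "mmul (total_idx Q (\<lambda>v. 2 * \<alpha> v)) (block2 A B C D) (block2 A' B' C' D') =
    block2 (\<lambda>p q. mmul (total_idx Q \<alpha>) A A' p q + mmul (total_idx Q \<alpha>) B C' p q)
      (\<lambda>p q. mmul (total_idx Q \<alpha>) A B' p q + mmul (total_idx Q \<alpha>) B D' p q)
      (\<lambda>p q. mmul (total_idx Q \<alpha>) C A' p q + mmul (total_idx Q \<alpha>) D C' p q)
      (\<lambda>p q. mmul (total_idx Q \<alpha>) C B' p q + mmul (total_idx Q \<alpha>) D D' p q)"
  by (intro ext) (simp add: mmul_def block2_def sum_total_idx_double[OF assms] sum.distrib)

lemma moment_block2: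
  assumes "fin_digraph Q"
  shows "moment Q (\<lambda>v. 2 * \<alpha> v) (\<lambda>b. block2 (A b) (B b) (C b) (D b)) (\<lambda>b. block2 (A' b) (B' b) (C' b) (D' b)) =
    block2 (\<lambda>p q. moment Q \<alpha> A A' p q + moment Q \<alpha> B C' p q)
      (\<lambda>p q. moment Q \<alpha> A B' p q + moment Q \<alpha> B D' p q)
      (\<lambda>p q. moment Q \<alpha> C A' p q + moment Q \<alpha> D C' p q)
      (\<lambda>p q. moment Q \<alpha> C B' p q + moment Q \<alpha> D D' p q)"
  unfolding moment_def mmul_block2[OF assms]
  by (intro ext) (simp add: block2_def flip: sum.distrib sum_subtractf add: algebra_simps)

lemma total_rep_block2:
  assumes "total_rep Q \<alpha> A" "total_rep Q \<alpha> B" "total_rep Q \<alpha> C" "total_rep Q \<alpha> D"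
  shows "total_rep Q (\<lambda>v. 2 * \<alpha> v) (\<lambda>b. block2 (A b) (B b) (C b) (D b))"
  unfolding total_rep_def
proof (intro ballI allI impI)
  fix b p q assume b: "b \<in> arcs Q <+> arcs Q" and nz: "block2 (A b) (B b) (C b) (D b) p q \<noteq> 0"
  define M where "M = (if even (snd p) then (if even (snd q) then A else B) else (if even (snd q) then C else D))"
  have "total_rep Q \<alpha> M" using assms by (simp add: M_def)
  moreover have "M b (fst p, snd p div 2) (fst q, snd q div 2) \<noteq> 0"
    using nz by (simp add: M_def block2_def split: if_splits)
  ultimately show "p \<in> total_idx Q (\<lambda>v. 2 * \<alpha> v) \<and> q \<in> total_idx Q (\<lambda>v. 2 * \<alpha> v) \<and>
      fst p = dhead Q b \<and> fst q = dtail Q b"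
    using total_repD[OF _ b, of \<alpha> M "(fst p, snd p div 2)" "(fst q, snd q div 2)"]
    by (simp add: half_total_idx)
qed

section \<open>The trace form and the stabiliser of a point\<close>

lemma mtr_commute: "mtr I A B = mtr I B A"
  unfolding mtr_def by (subst sum.swap) (simp add: mult.commute)

lemma mtr_mmul: "mtr I (mmul I A B) C = mtr I A (mmul I B C)"
proof -
  have "mtr I (mmul I A B) C = (\<Sum>i\<in>I. \<Sum>j\<in>I. \<Sum>k\<in>I. A i k * (B k j * C j i))"
    by (simp add: mtr_def mmul_def sum_distrib_right mult.assoc)
  also have "\<dots> = (\<Sum>i\<in>I. \<Sum>k\<in>I. \<Sum>j\<in>I. A i k * (B k j * C j i))"
    by (intro sum.cong refl sum.swap)
  also have "\<dots> = mtr I A (mmul I B C)"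
    by (simp add: mtr_def mmul_def sum_distrib_left)
  finally show ?thesis .
qed

lemma mtr_linear:
  "mtr I \<theta> (\<lambda>p q. A p q + B p q) = mtr I \<theta> A + mtr I \<theta> B"
  "mtr I \<theta> (\<lambda>p q. A p q - B p q) = mtr I \<theta> A - mtr I \<theta> B"
  "mtr I \<theta> (\<lambda>p q. c * A p q) = c * mtr I \<theta> A"
  by (simp_all add: mtr_def algebra_simps sum.distrib sum_subtractf sum_distrib_left)

lemma mtr_sum: "mtr I \<theta> (\<lambda>p q. \<Sum>s\<in>S. A s p q) = (\<Sum>s\<in>S. mtr I \<theta> (A s))"
proof (induction S rule: infinite_finite_induct)
  case (insert s S)
  then show ?case by (simp add: mtr_linear(1)[of I \<theta> "A s" "\<lambda>p q. \<Sum>s\<in>S. A s p q"])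
qed (simp_all add: mtr_def)

lemma mtr_moment:
  "mtr (total_idx Q \<beta>) \<theta> (moment Q \<beta> X Y) =
    (\<Sum>a\<in>arcs Q. mtr (total_idx Q \<beta>) \<theta> (mmul (total_idx Q \<beta>) (X (Inl a)) (Y (Inr a)))
      - mtr (total_idx Q \<beta>) \<theta> (mmul (total_idx Q \<beta>) (X (Inr a)) (Y (Inl a))))"
proof -
  have "moment Q \<beta> X Y = (\<lambda>p q. \<Sum>a\<in>arcs Q. mmul (total_idx Q \<beta>) (X (Inl a)) (Y (Inr a)) p q
     - mmul (total_idx Q \<beta>) (X (Inr a)) (Y (Inl a)) p q)"
    by (simp add: moment_def fun_eq_iff)
  then show ?thesis by (simp only: mtr_sum mtr_linear(2))
qed

text \<open>The image of the differential of the moment map is orthogonal to the stabiliser.\<close>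

lemma mtr_moment_differential:
  assumes comm: "\<And>b. b \<in> arcs Q <+> arcs Q \<Longrightarrow>
    mmul (total_idx Q \<beta>) \<theta> (V b) = mmul (total_idx Q \<beta>) (V b) \<theta>"
  shows "mtr (total_idx Q \<beta>) \<theta> (moment Q \<beta> V Y) + mtr (total_idx Q \<beta>) \<theta> (moment Q \<beta> Y V) = 0"
proof -
  let ?I = "total_idx Q \<beta>"
  have swap: "mtr ?I \<theta> (mmul ?I (V b) Z) = mtr ?I \<theta> (mmul ?I Z (V b))" if "b \<in> arcs Q <+> arcs Q" for b Z
  proof -
    have "mtr ?I \<theta> (mmul ?I (V b) Z) = mtr ?I (mmul ?I (V b) \<theta>) Z"
      by (simp add: mtr_mmul[symmetric] comm[OF that])
    also have "\<dots> = mtr ?I (V b) (mmul ?I \<theta> Z)" by (rule mtr_mmul)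
    also have "\<dots> = mtr ?I (mmul ?I \<theta> Z) (V b)" by (rule mtr_commute)
    also have "\<dots> = mtr ?I \<theta> (mmul ?I Z (V b))" by (rule mtr_mmul)
    finally show ?thesis .
  qed
  show ?thesis
    unfolding mtr_moment sum.distrib[symmetric]
  proof (rule sum.neutral, rule ballI)
    fix a assume "a \<in> arcs Q"
    then show "mtr ?I \<theta> (mmul ?I (V (Inl a)) (Y (Inr a))) - mtr ?I \<theta> (mmul ?I (V (Inr a)) (Y (Inl a))) +
        (mtr ?I \<theta> (mmul ?I (Y (Inl a)) (V (Inr a))) - mtr ?I \<theta> (mmul ?I (Y (Inr a)) (V (Inl a)))) = 0"
      using swap[OF InlI, of a "Y (Inr a)"] swap[OF InrI, of a "Y (Inl a)"] by simp
  qed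
qed

text \<open>With \<open>W\<close> of dimension \<open>\<alpha>\<close> and \<open>x, y\<close> tangent at \<open>W\<close> with \<open>\<omega>(x, y) \<noteq> 0\<close>, take
  \<open>V = W \<oplus> W\<close>, \<open>X\<close> with off-diagonal blocks \<open>x\<close> and \<open>y\<close>, and \<open>\<theta>\<close> the projection to the
  first summand; then \<open>tr (\<theta> \<Sum>\<^sub>a [X\<^sub>a, X\<^sub>a\<^sub>*]) = \<omega>(x, y)\<close>.\<close>

lemma exists_obstructed_point:
  assumes Q: "fin_digraph Q" and \<alpha>: "\<alpha> \<in> Sigma_set Q lam" and two: "(\<lambda>v. 2 * \<alpha> v) \<in> Sigma_set Q lam"
  defines "\<beta> \<equiv> \<lambda>v. 2 * \<alpha> v"
  defines "I \<equiv> total_idx Q \<beta>"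
  obtains V X :: "'a + 'a \<Rightarrow> 'v \<times> nat \<Rightarrow> 'v \<times> nat \<Rightarrow> complex" and \<theta>
  where "total_rep Q \<beta> V" "total_rep Q \<beta> X"
    "\<And>p q. moment Q \<beta> V V p q = (if p = q \<and> p \<in> I then lam (fst p) else 0)"
    "\<And>p q. moment Q \<beta> V X p q + moment Q \<beta> X V p q = 0"
    "\<And>p q. p \<noteq> q \<Longrightarrow> \<theta> p q = 0"
    "\<And>b. b \<in> arcs Q <+> arcs Q \<Longrightarrow> mmul I \<theta> (V b) = mmul I (V b) \<theta>"
    "mtr I \<theta> (moment Q \<beta> X X) \<noteq> 0"
proof -
  interpret fin_digraph Q by (rule Q)
  let ?J = "total_idx Q \<alpha>"
  have finJ: "finite ?J" by (rule finite_total_idx[OF Q])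
  have "\<alpha> \<in> Delta_plus Q lam" using \<alpha> by (simp add: Sigma_set_def)
  then obtain W where W: "total_rep Q \<alpha> W"
    "\<And>i j. moment Q \<alpha> W W i j = (if i = j \<and> i \<in> ?J then lam (fst i) else 0)"
    using root_lifts_to_preprojective[OF Q] by blast
  obtain x y where xy: "total_rep Q \<alpha> x" "total_rep Q \<alpha> y"
    "\<And>i j. moment Q \<alpha> W x i j + moment Q \<alpha> x W i j = 0"
    "\<And>i j. moment Q \<alpha> W y i j + moment Q \<alpha> y W i j = 0"
    "(\<Sum>a\<in>arcs Q. mtr ?J (x (Inl a)) (y (Inr a)) - mtr ?J (x (Inr a)) (y (Inl a))) \<noteq> 0"
    using moment_kernel_not_isotropic[OF W(1) tits_form_neg[OF \<alpha> two]] by blast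
  define V X where "V b = block2 (W b) zmat zmat (W b)" and "X b = block2 zmat (x b) (y b) zmat" for b
  define \<theta> :: "'v \<times> nat \<Rightarrow> 'v \<times> nat \<Rightarrow> complex" where "\<theta> = block2 (mid ?J) zmat zmat zmat"
  have zrep: "total_rep Q \<alpha> (\<lambda>b. zmat)" by (simp add: total_rep_def)
  have zmom: "moment Q \<alpha> (\<lambda>b. zmat) Y p q = 0" "moment Q \<alpha> Y (\<lambda>b. zmat) p q = 0"
    for Y :: "'a + 'a \<Rightarrow> 'v \<times> nat \<Rightarrow> 'v \<times> nat \<Rightarrow> complex" and p q
    by (simp_all add: moment_def mmul_def)
  have supp: "M b \<in> msupp ?J" if "total_rep Q \<alpha> M" "b \<in> arcs Q <+> arcs Q"
    for M :: "'a + 'a \<Rightarrow> 'v \<times> nat \<Rightarrow> 'v \<times> nat \<Rightarrow> complex" and b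
    using total_repD[OF that] by (intro msuppI) metis
  have parity: "p = q" if "even (snd p) = even (snd q)" "snd p div 2 = snd q div 2" "fst p = fst q"
    for p q :: "'v \<times> nat"
    using that by (metis even_two_times_div_two odd_two_times_div_two_succ prod_eqI)
  show thesis
  proof (rule that[of V X \<theta>])
    show "total_rep Q \<beta> V" "total_rep Q \<beta> X"
      unfolding V_def X_def \<beta>_def by (intro total_rep_block2 W(1) xy(1,2) zrep)+
    show "moment Q \<beta> V V p q = (if p = q \<and> p \<in> I then lam (fst p) else 0)" for p q
      unfolding V_def \<beta>_def I_def moment_block2[OF Q]
      using parity[of p q] half_total_idx[of p Q \<alpha>]
      by (auto simp: block2_def zmom W(2))
    \<comment> \<open>As V is block diagonal and X is off-diagonal, this is off-diagonal, and its
      blocks are the differential at W applied to x and to y.\<close>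
    show "moment Q \<beta> V X p q + moment Q \<beta> X V p q = 0" for p q
      unfolding V_def X_def \<beta>_def moment_block2[OF Q]
      using xy(3,4) by (simp add: block2_def zmom)
    show "\<theta> p q = 0" if "p \<noteq> q" for p q
      using that parity[of p q] by (auto simp: \<theta>_def block2_def mid_def)
    show "mmul I \<theta> (V b) = mmul I (V b) \<theta>" if b: "b \<in> arcs Q <+> arcs Q" for b
      unfolding \<theta>_def V_def I_def \<beta>_def mmul_block2[OF Q] mmul_mid[OF finJ supp[OF W(1) b]]
      by (simp add: mmul_def)
    \<comment> \<open>Squaring the off-diagonal X puts the moment of x and y into the first diagonal
      corner, the only one that \<theta> keeps.\<close>
    have "mtr I \<theta> (moment Q \<beta> X X) = mtr ?J (mid ?J) (moment Q \<alpha> x y)"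
      unfolding mtr_def I_def X_def \<beta>_def \<theta>_def moment_block2[OF Q] sum_total_idx_double[OF Q]
      by (simp add: block2_def zmom)
    also have "\<dots> = (\<Sum>a\<in>arcs Q. mtr ?J (x (Inl a)) (y (Inr a)) - mtr ?J (x (Inr a)) (y (Inl a)))"
      unfolding mtr_moment
      by (intro sum.cong refl) (simp add: mtr_mmul[symmetric] mmul_mid[OF finJ supp[OF xy(1)]] InlI InrI)
    finally show "mtr I \<theta> (moment Q \<beta> X X) \<noteq> 0" using xy(5) by simp
  qed
qed

section \<open>Second order terms of lifts\<close>

lemma cf_moment:
  fixes G H :: "'a + 'a \<Rightarrow> 'v \<times> nat \<Rightarrow> 'v \<times> nat \<Rightarrow> trunc"
  defines "G0 \<equiv> \<lambda>b p q. cf0 (G b p q)" and "G1 \<equiv> \<lambda>b p q. cf1 (G b p q)" and "G2 \<equiv> \<lambda>b p q. cf2 (G b p q)"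
  shows "cf0 (moment Q \<beta> G G p q) = moment Q \<beta> G0 G0 p q"
    "cf1 (moment Q \<beta> G G p q) = moment Q \<beta> G0 G1 p q + moment Q \<beta> G1 G0 p q"
    "cf2 (moment Q \<beta> G G p q) = moment Q \<beta> G0 G2 p q + moment Q \<beta> G1 G1 p q + moment Q \<beta> G2 G0 p q"
  by (simp_all add: moment_def mmul_def G0_def G1_def G2_def sum.distrib sum_subtractf algebra_simps)

lemma moment_cong:
  assumes "\<And>b. b \<in> arcs Q <+> arcs Q \<Longrightarrow> X b = X' b" "\<And>b. b \<in> arcs Q <+> arcs Q \<Longrightarrow> Y b = Y' b"
  shows "moment Q \<beta> X Y = moment Q \<beta> X' Y'"
  unfolding moment_def by (intro ext sum.cong refl) (simp add: assms InlI InrI)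

text \<open>Whatever t^2 term Y the lift has, it enters the second coefficient only as the
  differential at V applied to Y, which \<theta> annihilates. The trace thus depends on X alone;
  this is the obstruction shared by both parts of the theorem.\<close>

lemma trunc_lift_trace:
  fixes V X :: "'a + 'a \<Rightarrow> 'v \<times> nat \<Rightarrow> 'v \<times> nat \<Rightarrow> complex"
    and G :: "'a + 'a \<Rightarrow> 'v \<times> nat \<Rightarrow> 'v \<times> nat \<Rightarrow> trunc"
  assumes comm: "\<And>b. b \<in> arcs Q <+> arcs Q \<Longrightarrow>
      mmul (total_idx Q \<beta>) \<theta> (V b) = mmul (total_idx Q \<beta>) (V b) \<theta>"
    and V: "\<And>b p q. b \<in> arcs Q <+> arcs Q \<Longrightarrow> cf0 (G b p q) = V b p q"
    and X: "\<And>b p q. b \<in> arcs Q <+> arcs Q \<Longrightarrow> cf1 (G b p q) = X b p q"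
  shows "mtr (total_idx Q \<beta>) \<theta> (\<lambda>p q. cf2 (moment Q \<beta> G G p q)) = mtr (total_idx Q \<beta>) \<theta> (moment Q \<beta> X X)"
proof -
  let ?Y = "\<lambda>b p q. cf2 (G b p q)"
  have "moment Q \<beta> (\<lambda>b p q. cf0 (G b p q)) ?Y = moment Q \<beta> V ?Y"
    "moment Q \<beta> (\<lambda>b p q. cf1 (G b p q)) (\<lambda>b p q. cf1 (G b p q)) = moment Q \<beta> X X"
    "moment Q \<beta> ?Y (\<lambda>b p q. cf0 (G b p q)) = moment Q \<beta> ?Y V"
    by (rule moment_cong; simp add: V X)+
  then have "(\<lambda>p q. cf2 (moment Q \<beta> G G p q)) =
      (\<lambda>p q. (moment Q \<beta> V ?Y p q + moment Q \<beta> X X p q) + moment Q \<beta> ?Y V p q)"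
    by (simp add: cf_moment)
  then show ?thesis
    using mtr_moment_differential[of Q \<beta> \<theta> V ?Y] comm by (simp add: mtr_linear add_ac)
qed

section \<open>The deformed preprojective algebra\<close>

lemma fin_digraph_double_quiver:
  assumes "fin_digraph Q"
  shows "fin_digraph (double_quiver Q)"
proof -
  interpret fin_digraph Q by (rule assms)
  show ?thesis by unfold_locales auto
qed

lemma trunc_ideal_coset:
  assumes "\<exists>j\<in>trunc_ideal I. A = j \<oplus>\<^bsub>trunc_mat_algebra I\<^esub> B"
  shows "cf0 (A p q) = cf0 (B p q)" "cf1 (A p q) = cf1 (B p q)"
  using assms by (auto simp: trunc_ideal_def)

lemma alg_hom_trunc_mat_diff:
  assumes H: "H \<in> alg_hom A (trunc_mat_algebra I)"
    and add: "\<And>x y. x \<oplus>\<^bsub>A\<^esub> y = x + (y :: 'x::ab_group_add)"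
    and "f \<in> carrier A" "g \<in> carrier A" "f - g \<in> carrier A"
  shows "H (f - g) = (\<lambda>p q. H f p q - H g p q)"
  using alg_homD(5)[OF H assms(5,4)] by (simp add: add fun_eq_iff)

lemma alg_hom_trunc_mat_sum:
  assumes H: "H \<in> alg_hom A (trunc_mat_algebra I)"
    and add: "\<And>x y. x \<oplus>\<^bsub>A\<^esub> y = x + (y :: 'x::ab_group_add)"
    and zero: "\<zero>\<^bsub>A\<^esub> = 0" and rings: "ring A" "finite I"
    and f: "\<And>s. s \<in> S \<Longrightarrow> f s \<in> carrier A"
  shows "H (\<Sum>s\<in>S. f s) = (\<lambda>p q. \<Sum>s\<in>S. H (f s) p q)"
proof -
  interpret ring A by (rule rings)
  have H0: "H 0 = (\<lambda>p q. 0)"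
    using alg_hom_zero[OF H rings(1) ring_trunc_mat_algebra[OF rings(2)]] by (simp add: zero)
  have "(\<Sum>s\<in>S. f s) \<in> carrier A \<and> H (\<Sum>s\<in>S. f s) = (\<lambda>p q. \<Sum>s\<in>S. H (f s) p q)"
    using f
  proof (induction S rule: infinite_finite_induct)
    case (insert s S)
    then show ?case
      using a_closed[of "f s" "\<Sum>s\<in>S. f s"] alg_homD(5)[OF H, of "f s" "\<Sum>s\<in>S. f s"]
      by (simp add: add fun_eq_iff)
  qed (use zero_closed H0 in \<open>simp_all add: zero\<close>)
  then show ?thesis by blast
qed

lemma preprojective_relation_carrier:
  assumes Q: "fin_digraph Q"
  shows "preprojective_relation Q lam \<in> carrier (path_algebra (double_quiver Q))"
    "b \<in> arcs Q <+> arcs Q \<Longrightarrow> arrow_elt (double_quiver Q) b \<in> carrier (path_algebra (double_quiver Q))"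
    "v \<in> verts Q \<Longrightarrow> vertex_elt v \<in> carrier (path_algebra (double_quiver Q))"
    and alg_hom_preprojective_relation: "H \<in> alg_hom (path_algebra (double_quiver Q)) (trunc_mat_algebra I) \<Longrightarrow> finite I \<Longrightarrow>
      H (preprojective_relation Q lam) p q =
      (\<Sum>a\<in>arcs Q. mmul I (H (arrow_elt (double_quiver Q) (Inl a))) (H (arrow_elt (double_quiver Q) (Inr a))) p q
         - mmul I (H (arrow_elt (double_quiver Q) (Inr a))) (H (arrow_elt (double_quiver Q) (Inl a))) p q)
      - (\<Sum>v\<in>verts Q. tconst (lam v) * H (vertex_elt v) p q)"
proof -
  let ?D = "double_quiver Q" and ?A = "path_algebra (double_quiver Q)"
  interpret D: fin_digraph ?D by (rule fin_digraph_double_quiver[OF Q])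
  interpret A: ring ?A using complex_algebraD(1)[OF D.complex_algebra_path_algebra] .
  show arrow: "arrow_elt ?D b \<in> carrier ?A" if "b \<in> arcs Q <+> arcs Q" for b
    using D.arc_implies_awalk[of b] that by (simp add: arrow_elt_def paths_def)
  show vertex: "vertex_elt v \<in> carrier ?A" if "v \<in> verts Q" for v
    using that by (simp add: vertex_elt_def paths_def D.awalk_Nil_iff)
  have diff: "f - g \<in> carrier ?A" if "f \<in> carrier ?A" "g \<in> carrier ?A" for f g
    using that keys_diff[of f g] by auto
  have sum: "(\<Sum>s\<in>S. f s) \<in> carrier ?A" if "\<And>s. s \<in> S \<Longrightarrow> f s \<in> carrier ?A" for S f
    using that by (simp add: keys_sum_subset)
  have prod: "path_prod f g \<in> carrier ?A" if "f \<in> carrier ?A" "g \<in> carrier ?A" for f g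
    using that D.path_prod_keys by simp
  have scale: "path_scale c f \<in> carrier ?A" if "f \<in> carrier ?A" for c f
    using that keys_path_scale by fastforce
  let ?x = "\<lambda>b. arrow_elt ?D b"
  have com: "path_prod (?x (Inl a)) (?x (Inr a)) \<in> carrier ?A" "path_prod (?x (Inr a)) (?x (Inl a)) \<in> carrier ?A"
    if "a \<in> arcs Q" for a
    using that by (auto intro!: prod arrow simp del: path_algebra_simps(1))
  have rel: "preprojective_relation Q lam =
    (\<Sum>a\<in>arcs Q. path_prod (?x (Inl a)) (?x (Inr a)) - path_prod (?x (Inr a)) (?x (Inl a)))
     - (\<Sum>v\<in>verts Q. path_scale (lam v) (vertex_elt v))"
    by (simp add: preprojective_relation_def Let_def)
  have c1: "(\<Sum>a\<in>arcs Q. path_prod (?x (Inl a)) (?x (Inr a)) - path_prod (?x (Inr a)) (?x (Inl a))) \<in> carrier ?A"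
    by (intro sum diff com)
  have c2: "(\<Sum>v\<in>verts Q. path_scale (lam v) (vertex_elt v)) \<in> carrier ?A"
    by (intro sum scale vertex)
  show "preprojective_relation Q lam \<in> carrier ?A"
    unfolding rel by (rule diff[OF c1 c2])
  assume H: "H \<in> alg_hom ?A (trunc_mat_algebra I)" and I: "finite I"
  have add: "f \<oplus>\<^bsub>?A\<^esub> g = f + g" for f g by simp
  note Hd = alg_hom_trunc_mat_diff[OF H add] and Hs = alg_hom_trunc_mat_sum[OF H add _ A.ring_axioms I]
  have Hc: "H (path_prod (?x (Inl a)) (?x (Inr a)) - path_prod (?x (Inr a)) (?x (Inl a))) p q =
      mmul I (H (?x (Inl a))) (H (?x (Inr a))) p q - mmul I (H (?x (Inr a))) (H (?x (Inl a))) p q"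
    if a: "a \<in> arcs Q" for a
    using alg_homD(4)[OF H arrow[OF InlI[OF a]] arrow[OF InrI[OF a]]]
      alg_homD(4)[OF H arrow[OF InrI[OF a]] arrow[OF InlI[OF a]]]
    by (simp add: Hd[OF com[OF a] diff[OF com[OF a]]] del: path_algebra_simps(1))
  have Hv: "H (path_scale (lam v) (vertex_elt v)) p q = tconst (lam v) * H (vertex_elt v) p q"
    if "v \<in> verts Q" for v
    using alg_homD(2)[OF H vertex[OF that]] by (simp del: path_algebra_simps(1))
  have s1: "H (\<Sum>a\<in>arcs Q. path_prod (?x (Inl a)) (?x (Inr a)) - path_prod (?x (Inr a)) (?x (Inl a))) =
      (\<lambda>p q. \<Sum>a\<in>arcs Q. H (path_prod (?x (Inl a)) (?x (Inr a)) - path_prod (?x (Inr a)) (?x (Inl a))) p q)"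
    by (rule Hs) (simp, intro diff com)
  have s2: "H (\<Sum>v\<in>verts Q. path_scale (lam v) (vertex_elt v)) =
      (\<lambda>p q. \<Sum>v\<in>verts Q. H (path_scale (lam v) (vertex_elt v)) p q)"
    by (rule Hs) (simp, intro scale vertex)
  show "H (preprojective_relation Q lam) p q =
      (\<Sum>a\<in>arcs Q. mmul I (H (?x (Inl a))) (H (?x (Inr a))) p q - mmul I (H (?x (Inr a))) (H (?x (Inl a))) p q)
      - (\<Sum>v\<in>verts Q. tconst (lam v) * H (vertex_elt v) p q)"
    unfolding rel Hd[OF c1 c2 diff[OF c1 c2]] s1 s2
    by (intro arg_cong2[of _ _ _ _ "(-)"] sum.cong refl Hc Hv)
qed

lemma deformed_preprojective_not_formally_smooth:
  fixes Q :: "('v, 'a) pre_digraph"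
  assumes Q: "fin_digraph Q" and \<alpha>: "\<alpha> \<in> Sigma_set Q lam" and two: "(\<lambda>v. 2 * \<alpha> v) \<in> Sigma_set Q lam"
  shows "\<not> formally_smooth (deformed_preprojective_algebra Q lam)"
proof
  assume smooth: "formally_smooth (deformed_preprojective_algebra Q lam)"
  let ?D = "double_quiver Q" and ?A = "path_algebra (double_quiver Q)"
  interpret Q: fin_digraph Q by (rule Q)
  interpret D: fin_digraph ?D by (rule fin_digraph_double_quiver[OF Q])
  define \<beta> where "\<beta> = (\<lambda>v. 2 * \<alpha> v)"
  define I where "I = total_idx Q \<beta>"
  have finI: "finite I" unfolding I_def by (rule finite_total_idx[OF Q])
  obtain V X \<theta> where V: "total_rep Q \<beta> V" and X: "total_rep Q \<beta> X"
    and VV: "\<And>p q. moment Q \<beta> V V p q = (if p = q \<and> p \<in> I then lam (fst p) else 0)"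
    and VX: "\<And>p q. moment Q \<beta> V X p q + moment Q \<beta> X V p q = 0"
    and diag: "\<And>p q. p \<noteq> q \<Longrightarrow> \<theta> p q = 0"
    and comm: "\<And>b. b \<in> arcs Q <+> arcs Q \<Longrightarrow> mmul I \<theta> (V b) = mmul I (V b) \<theta>"
    and obstr: "mtr I \<theta> (moment Q \<beta> X X) \<noteq> 0"
    using exists_obstructed_point[OF Q \<alpha> two] unfolding \<beta>_def I_def by blast
  \<comment> \<open>Vertices act by the constant projections and arrows by V + t X with zero t^2
    term. Modulo t^2 this is a representation of \<Pi>_\<lambda>.\<close>
  define e :: "'v \<Rightarrow> 'v \<times> nat \<Rightarrow> 'v \<times> nat \<Rightarrow> trunc"
    where "e v p q = (if p = q \<and> p \<in> I \<and> fst p = v then 1 else 0)" for v p q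
  define g where "g b p q = Trunc (V b p q) (X b p q) 0" for b p q
  have e_mult: "mmul I (e v) M p q = (if p \<in> I \<and> fst p = v then M p q else 0)" for v M p q
  proof -
    have "mmul I (e v) M p q = (\<Sum>k\<in>I. if k = p then if fst p = v then M p q else 0 else 0)"
      unfolding mmul_def e_def by (rule sum.cong) auto
    then show ?thesis using finI by simp
  qed
  have mult_e: "mmul I M (e v) p q = (if q \<in> I \<and> fst q = v then M p q else 0)" for v M p q
  proof -
    have "mmul I M (e v) p q = (\<Sum>k\<in>I. if k = q then if fst q = v then M p q else 0 else 0)"
      unfolding mmul_def e_def by (rule sum.cong) auto
    then show ?thesis using finI by simp
  qed
  have g_nz: "p \<in> I \<and> q \<in> I \<and> fst p = dhead Q b \<and> fst q = dtail Q b"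
    if "b \<in> arcs Q <+> arcs Q" "g b p q \<noteq> 0" for b p q
  proof -
    have "V b p q \<noteq> 0 \<or> X b p q \<noteq> 0" using that(2) by (auto simp: g_def zero_trunc_def)
    then show ?thesis
      using total_repD[OF V that(1), of p q] total_repD[OF X that(1), of p q] unfolding I_def by blast
  qed
  obtain F where F: "F \<in> alg_hom ?A (trunc_mat_algebra I)"
    "\<And>v. v \<in> verts ?D \<Longrightarrow> F (vertex_elt v) = e v" "\<And>b. b \<in> arcs ?D \<Longrightarrow> F (arrow_elt ?D b) = g b"
  proof (rule D.path_algebra_universal[OF finI, of e g])
    show "(\<Sum>v\<in>verts ?D. e v p q) = mid I p q" for p q
    proof (cases "p = q \<and> p \<in> I")
      case True
      then have "fst p \<in> verts Q" by (auto simp: I_def total_idx_def)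
      with True show ?thesis by (simp add: e_def mid_def Q.finite_verts)
    next
      case False
      then have "e v p q = 0" for v by (auto simp: e_def)
      then show ?thesis using False by (auto simp: mid_def)
    qed
    show "g b \<in> msupp I" if "b \<in> arcs ?D" for b
    proof (rule msuppI)
      show "p \<notin> I \<or> q \<notin> I \<Longrightarrow> g b p q = 0" for p q
        using g_nz[of b p q] that by auto
    qed
    show "mmul I (e (dhead Q b)) (g b) = g b" if "b \<in> arcs ?D" for b
    proof (intro ext)
      show "mmul I (e (dhead Q b)) (g b) p q = g b p q" for p q
        using g_nz[of b p q] that by (auto simp: e_mult)
    qed
    show "mmul I (g b) (e (dtail Q b)) = g b" if "b \<in> arcs ?D" for b
    proof (intro ext)
      show "mmul I (g b) (e (dtail Q b)) p q = g b p q" for p q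
        using g_nz[of b p q] that by (auto simp: mult_e)
    qed
  qed (auto simp: fun_eq_iff e_mult mult_e e_def intro!: msuppI)
  note F_rel = alg_hom_preprojective_relation[OF Q F(1) finI]
  have mom: "(\<Sum>a\<in>arcs Q. mmul I (K (Inl a)) (K (Inr a)) p q - mmul I (K (Inr a)) (K (Inl a)) p q) =
      moment Q \<beta> K K p q" for K :: "'a + 'a \<Rightarrow> 'v \<times> nat \<Rightarrow> 'v \<times> nat \<Rightarrow> trunc" and p q
    by (simp add: moment_def I_def)
  \<comment> \<open>The constant coefficient vanishes because V satisfies the moment map equation,
    the coefficient of t because X is tangent at V.\<close>
  have "F (preprojective_relation Q lam) \<in> trunc_ideal I"
  proof -
    have "F (preprojective_relation Q lam) \<in> msupp I"
      using alg_homD(3)[OF F(1) preprojective_relation_carrier(1)[OF Q]] by simp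
    moreover have "F (preprojective_relation Q lam) p q =
        moment Q \<beta> g g p q - (\<Sum>v\<in>verts Q. tconst (lam v) * e v p q)" for p q
      unfolding F_rel mom[symmetric] by (simp add: F(2,3) InlI InrI)
    moreover have "(\<Sum>v\<in>verts Q. tconst (lam v) * e v p q) = tconst (if p = q \<and> p \<in> I then lam (fst p) else 0)" for p q
    proof (cases "p = q \<and> p \<in> I")
      case True
      then have "fst p \<in> verts Q" by (auto simp: I_def total_idx_def)
      with True show ?thesis by (simp add: e_def Q.finite_verts tconst_hom(1) if_distrib[of "\<lambda>u. _ * u"] cong: if_cong)
    next
      case False
      then have "e v p q = 0" for v by (auto simp: e_def)
      then show ?thesis using False by (auto simp: tconst_hom(1))
    qed
    ultimately show ?thesis
      using VV VX by (simp add: trunc_ideal_def cf_moment g_def)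
  qed
  then obtain G where G: "G \<in> alg_hom ?A (trunc_mat_algebra I)"
    "G (preprojective_relation Q lam) = (\<lambda>p q. 0)"
    "\<And>x. x \<in> carrier ?A \<Longrightarrow> \<exists>j\<in>trunc_ideal I. G x = j \<oplus>\<^bsub>trunc_mat_algebra I\<^esub> F x"
  proof -
    obtain \<iota> :: "('v \<times> nat \<Rightarrow> 'v \<times> nat \<Rightarrow> trunc) \<Rightarrow> nat \<Rightarrow> complex"
      where \<iota>: "inj_on \<iota> (carrier (trunc_mat_algebra I))" using trunc_mat_algebra_embeds[OF finI] .
    have test: "lifts_modulo (alg_quot ?A (genideal ?A {preprojective_relation Q lam})) T J"
      if "complex_algebra T" "nilpotent_ideal J T" for T :: test_algebra and J
      using smooth that unfolding formally_smooth_def deformed_preprojective_algebra_def Let_def by blast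
    show thesis
      by (rule lift_presented_algebra[OF test D.complex_algebra_path_algebra _
          complex_algebra_trunc_mat[OF finI] nilpotent_trunc_ideal[OF finI] \<iota> F(1)])
        (use that preprojective_relation_carrier(1)[OF Q] \<open>F _ \<in> trunc_ideal I\<close> in auto)
  qed
  \<comment> \<open>The lift keeps V and X on the arrows, but the \<open>E v\<close> may have
    acquired t^2 terms, so the right-hand side of the lifted relation need not be constant in
    t.\<close>
  define K E where "K b = G (arrow_elt ?D b)" and "E v = G (vertex_elt v)" for b v
  have K: "cf0 (K b p q) = V b p q" "cf1 (K b p q) = X b p q" if "b \<in> arcs Q <+> arcs Q" for b p q
    using trunc_ideal_coset[OF G(3)[OF preprojective_relation_carrier(2)[OF Q that]], of p q] F(3)[of b] that
    by (simp_all add: K_def g_def)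
  have E: "cf0 (E v p q) = (if p = q \<and> p \<in> I \<and> fst p = v then 1 else 0)" "cf1 (E v p q) = 0"
    if "v \<in> verts Q" for v p q
    using trunc_ideal_coset[OF G(3)[OF preprojective_relation_carrier(3)[OF Q that]], of p q] F(2)[of v] that
    by (auto simp: E_def e_def)
  \<comment> \<open>The second-order term of a lifted idempotent is off-diagonal, so the diagonal \<open>\<theta>\<close>
    does not see it.\<close>
  have diag_E: "cf2 (E v p p) = 0" if v: "v \<in> verts Q" and p: "p \<in> I" for v p
  proof -
    have "path_prod (vertex_elt v) (vertex_elt v) = (vertex_elt v :: ('v, 'a + 'a) path \<Rightarrow>\<^sub>0 complex)"
      by (simp add: vertex_elt_def path_prod_single path_scale_simps)
    then have "mmul I (E v) (E v) = E v"
      using alg_homD(4)[OF G(1) preprojective_relation_carrier(3)[OF Q v] preprojective_relation_carrier(3)[OF Q v]] by (simp add: E_def)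
    then have "cf2 (E v p p) = cf2 (mmul I (E v) (E v) p p)" by simp
    also have "\<dots> = (\<Sum>k\<in>I. if k = p then if fst p = v then 2 * cf2 (E v p p) else 0 else 0)"
      unfolding mmul_def cf_sum by (rule sum.cong) (auto simp: E[OF v])
    also have "\<dots> = (if fst p = v then 2 * cf2 (E v p p) else 0)" using p finI by simp
    finally show ?thesis by (auto split: if_splits)
  qed
  have "cf2 (moment Q \<beta> K K p q) = (\<Sum>v\<in>verts Q. lam v * cf2 (E v p q))" for p q
  proof -
    have "moment Q \<beta> K K p q = (\<Sum>v\<in>verts Q. tconst (lam v) * E v p q)"
      using alg_hom_preprojective_relation[OF Q G(1) finI, of lam p q] G(2)
      unfolding mom[symmetric] K_def E_def by simp
    then show ?thesis by simp
  qed
  then have "mtr I \<theta> (\<lambda>p q. cf2 (moment Q \<beta> K K p q)) = (\<Sum>v\<in>verts Q. lam v * mtr I \<theta> (\<lambda>p q. cf2 (E v p q)))"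
    by (simp only: mtr_sum mtr_linear(3))
  also have "\<dots> = 0"
  proof (rule sum.neutral, rule ballI)
    fix v assume v: "v \<in> verts Q"
    have "\<theta> p q * cf2 (E v q p) = 0" if "p \<in> I" for p q
      using diag[of p q] diag_E[OF v that] by (cases "p = q") auto
    then show "lam v * mtr I \<theta> (\<lambda>p q. cf2 (E v p q)) = 0"
      by (simp add: mtr_def)
  qed
  finally have "mtr I \<theta> (\<lambda>p q. cf2 (moment Q \<beta> K K p q)) = 0" .
  then show False
    using trunc_lift_trace[of Q \<beta> \<theta> V K X] comm K obstr unfolding I_def by simp
qed

section \<open>The representation scheme\<close>

lemma trunc_point_moment:
  fixes V X :: "'a + 'a \<Rightarrow> 'v \<times> nat \<Rightarrow> 'v \<times> nat \<Rightarrow> complex"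
    and K :: "'a + 'a \<Rightarrow> 'v \<times> nat \<Rightarrow> 'v \<times> nat \<Rightarrow> trunc"
  assumes "\<And>b p q. b \<in> arcs Q <+> arcs Q \<Longrightarrow> cf0 (K b p q) = V b p q"
    and "\<And>b p q. b \<in> arcs Q <+> arcs Q \<Longrightarrow> cf1 (K b p q) = X b p q"
  shows "cf0 (moment Q \<beta> K K p q) = moment Q \<beta> V V p q"
    "cf1 (moment Q \<beta> K K p q) = moment Q \<beta> V X p q + moment Q \<beta> X V p q"
proof -
  have "moment Q \<beta> (\<lambda>b p q. cf0 (K b p q)) (\<lambda>b p q. cf0 (K b p q)) = moment Q \<beta> V V"
    "moment Q \<beta> (\<lambda>b p q. cf0 (K b p q)) (\<lambda>b p q. cf1 (K b p q)) = moment Q \<beta> V X"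
    "moment Q \<beta> (\<lambda>b p q. cf1 (K b p q)) (\<lambda>b p q. cf0 (K b p q)) = moment Q \<beta> X V"
    by (rule moment_cong; simp add: assms)+
  then show "cf0 (moment Q \<beta> K K p q) = moment Q \<beta> V V p q"
    "cf1 (moment Q \<beta> K K p q) = moment Q \<beta> V X p q + moment Q \<beta> X V p q"
    by (simp_all add: cf_moment)
qed

text \<open>Reads a C[t]/t^3-point of the coordinate algebra, given as a map to 1 x 1 matrices, as
  matrices on the total space. Positions that are not coordinates get 0, which makes the result a
  \<open>total_rep\<close>.\<close>

definition coord_point :: "('v, 'a) pre_digraph \<Rightarrow> ('v \<Rightarrow> nat) \<Rightarrow>
    ((('a + 'a) \<times> nat \<times> nat) mpoly \<Rightarrow> unit \<Rightarrow> unit \<Rightarrow> trunc) \<Rightarrow>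
    'a + 'a \<Rightarrow> 'v \<times> nat \<Rightarrow> 'v \<times> nat \<Rightarrow> trunc" where
  "coord_point Q \<beta> H b p q =
     (if (b, p, q) \<in> arrow_coords Q \<beta> then H (mvar (b, snd p, snd q)) () () else 0)"

lemma total_rep_coord_point:
  assumes "fin_digraph Q"
  shows "total_rep Q \<beta> (coord_point Q \<beta> H)"
  by (auto simp: total_rep_def coord_point_def fin_digraph.arrow_coords_iff[OF assms] split: if_splits)

context
  fixes Q :: "('v, 'a) pre_digraph" and \<beta> :: "'v \<Rightarrow> nat" and v :: 'v and i j :: nat
    and P :: "(complex, (('a + 'a) \<times> nat \<times> nat) mpoly) module"
  defines "P \<equiv> polynomial_algebra (rep_coordinates (double_quiver Q) \<beta>)"
  assumes Q: "fin_digraph Q" and v: "v \<in> verts Q" and i: "i < \<beta> v" and j: "j < \<beta> v"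
begin

text \<open>Connects the rectangular generic matrices with matrices on the total space: the inner
  index of the product runs over the basis at the tail of b, and every other inner index of the
  total space contributes 0.\<close>

lemma generic_product_entry:
  assumes "b \<in> arcs Q <+> arcs Q" "b' \<in> arcs Q <+> arcs Q"
    and "dtail Q b = dhead Q b'" "dhead Q b = v" "dtail Q b' = v"
  shows "(generic_matrix (double_quiver Q) \<beta> b * generic_matrix (double_quiver Q) \<beta> b') $$ (i, j) =
      (\<Sum>k<\<beta> (dtail Q b). mvar (b, i, k) * mvar (b', k, j))" (is ?eq)
    and "(\<Sum>k<\<beta> (dtail Q b). mvar (b, i, k) * mvar (b', k, j)) \<in> carrier P" (is ?mem)
    and "H \<in> alg_hom P (trunc_mat_algebra {()}) \<Longrightarrow>
      H (\<Sum>k<\<beta> (dtail Q b). mvar (b, i, k) * mvar (b', k, j)) () () =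
      mmul (total_idx Q \<beta>) (coord_point Q \<beta> H b) (coord_point Q \<beta> H b') (v, i) (v, j)"
proof -
  show ?eq
    using assms i j
    by (auto simp: generic_matrix_def scalar_prod_def atLeast0LessThan intro!: sum.cong)
  have mem: "mvar (b, i, k) \<in> carrier P" "mvar (b', k, j) \<in> carrier P" if "k < \<beta> (dtail Q b)" for k
    using assms i j that unfolding P_def
    by (auto intro!: polynomial_algebra_closed simp: rep_coordinates_def simp del: polynomial_algebra_simps(1))
  have prod: "mvar (b, i, k) * mvar (b', k, j) \<in> carrier P" if "k < \<beta> (dtail Q b)" for k
    using mem[OF that] unfolding P_def by (rule polynomial_algebra_closed(1))
  then show ?mem
    unfolding P_def by (intro polynomial_algebra_sum_closed) simp
  assume H: "H \<in> alg_hom P (trunc_mat_algebra {()})"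
  have ring: "ring P" unfolding P_def by (rule complex_algebraD(1)[OF complex_algebra_polynomial_algebra])
  have "H (\<Sum>k<\<beta> (dtail Q b). mvar (b, i, k) * mvar (b', k, j)) () () =
      (\<Sum>k<\<beta> (dtail Q b). H (mvar (b, i, k) * mvar (b', k, j)) () ())"
    by (subst alg_hom_trunc_mat_sum[OF H _ _ ring]) (use prod in \<open>simp_all add: P_def del: polynomial_algebra_simps(1)\<close>)
  also have "\<dots> = (\<Sum>k<\<beta> (dtail Q b). H (mvar (b, i, k)) () () * H (mvar (b', k, j)) () ())"
  proof (rule sum.cong[OF refl])
    fix k assume "k \<in> {..<\<beta> (dtail Q b)}"
    then have "k < \<beta> (dtail Q b)" by simp
    from alg_homD(4)[OF H mem[OF this]]
    show "H (mvar (b, i, k) * mvar (b', k, j)) () () = H (mvar (b, i, k)) () () * H (mvar (b', k, j)) () ()"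
      by (simp add: P_def mmul_def)
  qed
  also have "\<dots> = (\<Sum>k<\<beta> (dtail Q b). coord_point Q \<beta> H b (v, i) (dtail Q b, k) *
      coord_point Q \<beta> H b' (dtail Q b, k) (v, j))"
  proof (rule sum.cong[OF refl])
    fix k assume "k \<in> {..<\<beta> (dtail Q b)}"
    then have "(b, (v, i), (dtail Q b, k)) \<in> arrow_coords Q \<beta>" "(b', (dtail Q b, k), (v, j)) \<in> arrow_coords Q \<beta>"
      using assms i j by (auto simp: arrow_coords_def)
    then show "H (mvar (b, i, k)) () () * H (mvar (b', k, j)) () () =
        coord_point Q \<beta> H b (v, i) (dtail Q b, k) * coord_point Q \<beta> H b' (dtail Q b, k) (v, j)"
      by (simp add: coord_point_def)
  qed
  also have "\<dots> = mmul (total_idx Q \<beta>) (coord_point Q \<beta> H b) (coord_point Q \<beta> H b') (v, i) (v, j)"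
    unfolding mmul_def
  proof (rule sum_block[symmetric, OF Q])
    interpret D: fin_digraph "double_quiver Q" by (rule fin_digraph_double_quiver[OF Q])
    show "dtail Q b \<in> verts Q" using D.tail_in_verts[of b] assms(1) by simp
    show "coord_point Q \<beta> H b (v, i) r * coord_point Q \<beta> H b' r (v, j) \<noteq> 0 \<Longrightarrow> fst r = dtail Q b" for r
      using total_repD(4)[OF total_rep_coord_point[OF Q] assms(1), of \<beta> H "(v, i)" r] by fastforce
  qed
  finally show "H (\<Sum>k<\<beta> (dtail Q b). mvar (b, i, k) * mvar (b', k, j)) () () =
      mmul (total_idx Q \<beta>) (coord_point Q \<beta> H b) (coord_point Q \<beta> H b') (v, i) (v, j)" .
qed

lemma rep_equation_carrier: "rep_equation Q lam \<beta> v i j \<in> carrier P"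
  and alg_hom_rep_equation: "H \<in> alg_hom P (trunc_mat_algebra {()}) \<Longrightarrow>
    H (rep_equation Q lam \<beta> v i j) () () =
    moment Q \<beta> (coord_point Q \<beta> H) (coord_point Q \<beta> H) (v, i) (v, j) - (if i = j then tconst (lam v) else 0)"
proof -
  interpret fin_digraph Q by (rule Q)
  define hs ts where "hs = {a \<in> arcs Q. head Q a = v}" and "ts = {a \<in> arcs Q. tail Q a = v}"
  define s1 s2 :: "(('a + 'a) \<times> nat \<times> nat) mpoly"
    where "s1 = (\<Sum>a\<in>hs. \<Sum>k<\<beta> (dtail Q (Inl a)). mvar (Inl a, i, k) * mvar (Inr a, k, j))"
      and "s2 = (\<Sum>a\<in>ts. \<Sum>k<\<beta> (dtail Q (Inr a)). mvar (Inr a, i, k) * mvar (Inl a, k, j))"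
  define s3 :: "(('a + 'a) \<times> nat \<times> nat) mpoly" where "s3 = (if i = j then mconst (lam v) else 0)"
  have rel: "rep_equation Q lam \<beta> v i j = s1 - s2 - s3"
    unfolding rep_equation_def Let_def s1_def s2_def s3_def hs_def ts_def
    by (intro arg_cong2[of _ _ _ _ "(-)"] sum.cong refl generic_product_entry) auto
  have m1: "(\<Sum>k<\<beta> (dtail Q (Inl a)). mvar (Inl a, i, k) * mvar (Inr a, k, j)) \<in> carrier P" if "a \<in> hs" for a
    by (rule generic_product_entry(2)) (use that in \<open>auto simp: hs_def\<close>)
  have m2: "(\<Sum>k<\<beta> (dtail Q (Inr a)). mvar (Inr a, i, k) * mvar (Inl a, k, j)) \<in> carrier P" if "a \<in> ts" for a
    by (rule generic_product_entry(2)) (use that in \<open>auto simp: ts_def\<close>)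
  have c: "s1 \<in> carrier P" "s2 \<in> carrier P" "s3 \<in> carrier P"
    using m1 m2 unfolding s1_def s2_def s3_def P_def
    by (simp_all add: polynomial_algebra_sum_closed polynomial_algebra_closed del: polynomial_algebra_simps(1))
  have c12: "s1 - s2 \<in> carrier P" using c unfolding P_def by (intro polynomial_algebra_closed)
  show mem: "rep_equation Q lam \<beta> v i j \<in> carrier P"
    using c12 c unfolding rel P_def by (intro polynomial_algebra_closed)
  assume H: "H \<in> alg_hom P (trunc_mat_algebra {()})"
  let ?K = "coord_point Q \<beta> H" and ?I = "total_idx Q \<beta>"
  have ring: "ring P" unfolding P_def by (rule complex_algebraD(1)[OF complex_algebra_polynomial_algebra])
  have add: "f \<oplus>\<^bsub>P\<^esub> g = f + g" "\<zero>\<^bsub>P\<^esub> = 0" for f g by (simp_all add: P_def)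
  note Hs = alg_hom_trunc_mat_sum[OF H add ring] and Hd = alg_hom_trunc_mat_diff[OF H add(1)]
  \<comment> \<open>The equation at v sums over the arrows with head v, respectively tail v, whereas
    \<open>moment\<close> sums over all arrows; the additional ones have no entries in the rows over
    v.\<close>
  have zero: "mmul ?I (?K b) M (v, i) q = 0" if "b \<in> arcs Q <+> arcs Q" "dhead Q b \<noteq> v" for b M q
  proof -
    have "?K b (v, i) r = 0" for r
      using that by (auto simp: coord_point_def arrow_coords_iff)
    then show ?thesis by (simp add: mmul_def)
  qed
  have "H s1 () () = (\<Sum>a\<in>hs. mmul ?I (?K (Inl a)) (?K (Inr a)) (v, i) (v, j))"
  proof -
    have "H s1 () () = (\<Sum>a\<in>hs. H (\<Sum>k<\<beta> (dtail Q (Inl a)). mvar (Inl a, i, k) * mvar (Inr a, k, j)) () ())"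
      unfolding s1_def by (subst Hs) (use m1 in auto)
    also have "\<dots> = (\<Sum>a\<in>hs. mmul ?I (?K (Inl a)) (?K (Inr a)) (v, i) (v, j))"
      by (rule sum.cong[OF refl generic_product_entry(3)[OF _ _ _ _ _ H]]) (auto simp: hs_def)
    finally show ?thesis .
  qed
  also have "\<dots> = (\<Sum>a\<in>arcs Q. mmul ?I (?K (Inl a)) (?K (Inr a)) (v, i) (v, j))"
    by (rule sum.mono_neutral_left) (auto simp: hs_def intro!: zero)
  finally have H1: "H s1 () () = (\<Sum>a\<in>arcs Q. mmul ?I (?K (Inl a)) (?K (Inr a)) (v, i) (v, j))" .
  have "H s2 () () = (\<Sum>a\<in>ts. mmul ?I (?K (Inr a)) (?K (Inl a)) (v, i) (v, j))"
  proof -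
    have "H s2 () () = (\<Sum>a\<in>ts. H (\<Sum>k<\<beta> (dtail Q (Inr a)). mvar (Inr a, i, k) * mvar (Inl a, k, j)) () ())"
      unfolding s2_def by (subst Hs) (use m2 in auto)
    also have "\<dots> = (\<Sum>a\<in>ts. mmul ?I (?K (Inr a)) (?K (Inl a)) (v, i) (v, j))"
      by (rule sum.cong[OF refl generic_product_entry(3)[OF _ _ _ _ _ H]]) (auto simp: ts_def)
    finally show ?thesis .
  qed
  also have "\<dots> = (\<Sum>a\<in>arcs Q. mmul ?I (?K (Inr a)) (?K (Inl a)) (v, i) (v, j))"
    by (rule sum.mono_neutral_left) (auto simp: ts_def intro!: zero)
  finally have H2: "H s2 () () = (\<Sum>a\<in>arcs Q. mmul ?I (?K (Inr a)) (?K (Inl a)) (v, i) (v, j))" .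
  have one: "\<one>\<^bsub>P\<^esub> \<in> carrier P" using ring by (simp add: ring.ring_simprules(6))
  have "H s3 () () = (if i = j then tconst (lam v) else 0)"
  proof (cases "i = j")
    case True
    have "s3 = lam v \<odot>\<^bsub>P\<^esub> \<one>\<^bsub>P\<^esub>" using True by (simp add: s3_def P_def)
    then show ?thesis
      using True alg_homD(2)[OF H one, of "lam v"] alg_homD(6)[OF H] by (simp add: mid_def)
  next
    case False
    have "H \<zero>\<^bsub>P\<^esub> = (\<lambda>p q. 0)"
      using alg_hom_zero[OF H ring ring_trunc_mat_algebra] by simp
    then show ?thesis using False by (simp add: s3_def add)
  qed
  then show "H (rep_equation Q lam \<beta> v i j) () () =
    moment Q \<beta> ?K ?K (v, i) (v, j) - (if i = j then tconst (lam v) else 0)"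
    unfolding rel Hd[OF c12 c(3) mem[unfolded rel]] Hd[OF c(1,2) c12] H1 H2
    by (simp add: moment_def sum_subtractf)
qed

end

lemma rep_scheme_not_smooth:
  fixes Q :: "('v, 'a) pre_digraph"
  assumes Q: "fin_digraph Q" and \<alpha>: "\<alpha> \<in> Sigma_set Q lam" and two: "(\<lambda>v. 2 * \<alpha> v) \<in> Sigma_set Q lam"
  shows "\<not> smooth_affine_scheme (rep_scheme Q lam (\<lambda>v. 2 * \<alpha> v))"
proof
  define \<beta> where "\<beta> = (\<lambda>v. 2 * \<alpha> v)"
  define I where "I = total_idx Q \<beta>"
  assume "smooth_affine_scheme (rep_scheme Q lam (\<lambda>v. 2 * \<alpha> v))"
  then have smooth: "smooth_affine_scheme (rep_scheme Q lam \<beta>)" by (simp add: \<beta>_def)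
  interpret Q: fin_digraph Q by (rule Q)
  obtain V X \<theta> where V: "total_rep Q \<beta> V" and X: "total_rep Q \<beta> X"
    and VV: "\<And>p q. moment Q \<beta> V V p q = (if p = q \<and> p \<in> I then lam (fst p) else 0)"
    and VX: "\<And>p q. moment Q \<beta> V X p q + moment Q \<beta> X V p q = 0"
    and "\<And>p q. p \<noteq> q \<Longrightarrow> \<theta> p q = 0"
    and comm: "\<And>b. b \<in> arcs Q <+> arcs Q \<Longrightarrow> mmul I \<theta> (V b) = mmul I (V b) \<theta>"
    and obstr: "mtr I \<theta> (moment Q \<beta> X X) \<noteq> 0"
    using exists_obstructed_point[OF Q \<alpha> two] unfolding \<beta>_def I_def by blast
  define P where "P = polynomial_algebra (rep_coordinates (double_quiver Q) \<beta>)"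
  define eqs where "eqs = {rep_equation Q lam \<beta> v i j | v i j. v \<in> verts Q \<and> i < \<beta> v \<and> j < \<beta> v}"
  \<comment> \<open>The point V + t X. Coordinates carry only row and column numbers; the vertices
    are restored from the head and the tail of b.\<close>
  define \<rho> where "\<rho> = (\<lambda>(b, i, j). Trunc (V b (dhead Q b, i) (dtail Q b, j)) (X b (dhead Q b, i) (dtail Q b, j)) 0)"
  define F :: "(('a + 'a) \<times> nat \<times> nat) mpoly \<Rightarrow> unit \<Rightarrow> unit \<Rightarrow> trunc"
    where "F f = (\<lambda>_ _. poly_eval \<rho> f)" for f
  have F: "F \<in> alg_hom P (trunc_mat_algebra {()})"
    unfolding F_def P_def by (rule poly_eval_alg_hom)
  have eqs: "eqs \<subseteq> carrier P"
    unfolding eqs_def P_def using rep_equation_carrier[OF Q] by blast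
  have K: "cf0 (coord_point Q \<beta> F b p q) = V b p q" "cf1 (coord_point Q \<beta> F b p q) = X b p q"
    if b: "b \<in> arcs Q <+> arcs Q" for b p q
  proof -
    have "coord_point Q \<beta> F b p q = Trunc (V b p q) (X b p q) 0"
    proof (cases "(b, p, q) \<in> arrow_coords Q \<beta>")
      case True
      then have "p = (dhead Q b, snd p)" "q = (dtail Q b, snd q)"
        by (auto simp: Q.arrow_coords_iff prod_eq_iff)
      then have "\<rho> (b, snd p, snd q) = Trunc (V b p q) (X b p q) 0" by (simp add: \<rho>_def)
      then show ?thesis using True by (simp add: coord_point_def F_def poly_eval_simps)
    next
      case False
      then have "V b p q = 0" "X b p q = 0"
        using total_repD[OF V b, of p q] total_repD[OF X b, of p q] b by (auto simp: Q.arrow_coords_iff)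
      with False show ?thesis by (simp add: coord_point_def zero_trunc_def)
    qed
    then show "cf0 (coord_point Q \<beta> F b p q) = V b p q" "cf1 (coord_point Q \<beta> F b p q) = X b p q" by simp_all
  qed
  have F_eqs: "F s \<in> trunc_ideal {()}" if "s \<in> eqs" for s
  proof -
    from that obtain v i j where s: "s = rep_equation Q lam \<beta> v i j" "v \<in> verts Q" "i < \<beta> v" "j < \<beta> v"
      unfolding eqs_def by blast
    have "(v, i) \<in> I" using s by (simp add: I_def total_idx_def)
    then have "cf0 (F s () ()) = 0 \<and> cf1 (F s () ()) = 0"
      unfolding s(1) alg_hom_rep_equation[OF Q s(2-4) F[unfolded P_def]]
      using VV[of "(v, i)" "(v, j)"] VX[of "(v, i)" "(v, j)"]
        trunc_point_moment[of Q "coord_point Q \<beta> F" V X, OF K, of \<beta> "(v, i)" "(v, j)"] by simp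
    then show ?thesis by (simp add: trunc_ideal_def msupp_def)
  qed
  obtain \<iota> :: "(unit \<Rightarrow> unit \<Rightarrow> trunc) \<Rightarrow> nat \<Rightarrow> complex"
    where \<iota>: "inj_on \<iota> (carrier (trunc_mat_algebra {()}))"
    using trunc_mat_algebra_embeds[of "{()}"] by blast
  \<comment> \<open>The algebra of 1 x 1 matrices is commutative, so the test algebras that arise
    are commutative, as smoothness of the scheme demands.\<close>
  have test: "lifts_modulo (alg_quot P (genideal P eqs)) T J"
    if "complex_algebra T" "cring (trunc_mat_algebra {()}) \<Longrightarrow> cring T" "nilpotent_ideal J T"
    for T :: test_algebra and J
  proof -
    have "cring T" by (rule that(2)[OF cring_trunc_mat_singleton])
    moreover have "rep_scheme Q lam \<beta> = alg_quot P (genideal P eqs)"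
      by (simp only: rep_scheme_def Let_def P_def eqs_def)
    ultimately show ?thesis
      using smooth that(1,3) unfolding smooth_affine_scheme_def by simp
  qed
  obtain G where G: "G \<in> alg_hom P (trunc_mat_algebra {()})" "\<And>s. s \<in> eqs \<Longrightarrow> G s = (\<lambda>_ _. 0)"
    "\<And>x. x \<in> carrier P \<Longrightarrow> \<exists>j\<in>trunc_ideal {()}. G x = j \<oplus>\<^bsub>trunc_mat_algebra {()}\<^esub> F x"
  proof (rule lift_presented_algebra[OF test _ eqs complex_algebra_trunc_mat nilpotent_trunc_ideal \<iota> F F_eqs])
    show "complex_algebra P" unfolding P_def by (rule complex_algebra_polynomial_algebra)
  qed (use that in \<open>simp_all\<close>)
  let ?K = "coord_point Q \<beta> G"
  have "cf0 (?K b p q) = cf0 (coord_point Q \<beta> F b p q) \<and> cf1 (?K b p q) = cf1 (coord_point Q \<beta> F b p q)"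
    for b p q
  proof (cases "(b, p, q) \<in> arrow_coords Q \<beta>")
    case True
    then have "mvar (b, snd p, snd q) \<in> carrier P"
      unfolding P_def by (intro polynomial_algebra_closed) (auto simp: arrow_coords_def rep_coordinates_def)
    from trunc_ideal_coset[OF G(3)[OF this], of "()" "()"] True show ?thesis by (simp add: coord_point_def)
  qed (simp add: coord_point_def)
  then have K': "cf0 (?K b p q) = V b p q" "cf1 (?K b p q) = X b p q"
    if "b \<in> arcs Q <+> arcs Q" for b p q using K[OF that] by simp_all
  \<comment> \<open>The right-hand side \<lambda>_v is constant in t, so the moment of a lifted
    point has no t^2 term at pairs over one vertex; all other pairs vanish by support.\<close>
  have "cf2 (moment Q \<beta> ?K ?K p q) = 0" for p q
  proof (cases "fst p = fst q \<and> p \<in> I \<and> q \<in> I")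
    case True
    then obtain v i j where pq: "p = (v, i)" "q = (v, j)" "v \<in> verts Q" "i < \<beta> v" "j < \<beta> v"
      by (cases p; cases q) (auto simp: I_def total_idx_def)
    then have "G (rep_equation Q lam \<beta> v i j) = (\<lambda>_ _. 0)" by (intro G(2)) (auto simp: eqs_def)
    then have "moment Q \<beta> ?K ?K p q = (if i = j then tconst (lam v) else 0)"
      using alg_hom_rep_equation[OF Q pq(3-5) G(1)[unfolded P_def], of lam] pq by simp
    then show ?thesis by simp
  next
    case False
    then show ?thesis
      using moment_off_diagonal[OF total_rep_coord_point[OF Q] total_rep_coord_point[OF Q], of p q \<beta> G G]
      by (auto simp: I_def)
  qed
  then have "mtr I \<theta> (\<lambda>p q. cf2 (moment Q \<beta> ?K ?K p q)) = 0" by (simp add: mtr_def)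
  then show False
    using trunc_lift_trace[of Q \<beta> \<theta> V ?K X] comm K' obstr unfolding I_def by simp
qed

theorem proposition7p2:
  fixes Q :: "('v, 'a) pre_digraph" and lam :: "'v \<Rightarrow> complex" and \<alpha> :: "'v \<Rightarrow> nat"
  assumes "fin_digraph Q"
    and "\<alpha> \<in> Sigma_set Q lam"
    and "(\<lambda>v. 2 * \<alpha> v) \<in> Sigma_set Q lam"
  shows "\<not> smooth_affine_scheme (rep_scheme Q lam (\<lambda>v. 2 * \<alpha> v)) \<and>
         \<not> formally_smooth (deformed_preprojective_algebra Q lam)"
  using rep_scheme_not_smooth[OF assms] deformed_preprojective_not_formally_smooth[OF assms] by blast

end
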